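(* Let $n\ge 1$. For $d_1,d_2\in\mathbb{R}$ define $w_{d_1,d_2}:\mathbb{R}^n\to\mathbb{R}$ by $w_{d_1,d_2}(x):=d_1\frac{x_n^2}{2}$ if $x_n\ge 0$ and $w_{d_1,d_2}(x):=d_2\frac{x_n^2}{2}$ if $x_n<0$. If $w_{d_1,d_2}$ is a nontrivial (i.e. not identically zero) global minimizer of $\mathcal{F}$, then one of the following two cases occurs: (I) $d_1=\pm1$ and $d_2=0$, or $d_1=0$ and $d_2=\pm1$; i.e. $w_{d_1,d_2}$ is a Type-(I) minimizer. (II) $d_1,d_2\neq 0$ and $d_1=d_2$; i.e. $w_{d_1,d_2}$ is a Type-(II) minimizer.
   Context: For $\Omega\subset\mathbb{R}^n$ open and bounded and $u\in H^2(\Omega)$, the two-sided biharmonic Alt-Caffarelli functional is $\mathcal{F}(u,\Omega):=\int_\Omega(\Delta u)^2\,\mathrm{d}x+|\{x\in\Omega:u(x)\neq 0\}|$, where $|\cdot|$ is Lebesgue measure. A function $u\in H^2_{loc}(\mathbb{R}^n)$ is a global minimizer of $\mathcal{F}$ if for all bounded open sets $\Omega\subset\mathbb{R}^n$ and all $v\in H^2(\Omega)$ with $v-u\in H^2_0(\Omega)$ one has $\mathcal{F}(u,\Omega)\le\mathcal{F}(v,\Omega)$. Here $H^2_0(\Omega)$ is the closure of $C_0^\infty(\Omega)$ in $H^2(\Omega)$. Type-(I) minimizers are global minimizers of the form $u(x)=\pm\frac12((x-x_0)\cdot\nu)^2\chi_{(0,\infty)}((x-x_0)\cdot\nu)$ for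 a unit vector $\nu\in\mathbb{R}^n$ and $x_0\in\mathbb{R}^n$ ($\chi_E$ is the characteristic function of $E$); Type-(II) minimizers are global minimizers $u$ with constant Laplacian, $\Delta u= c$ for some $c\in\mathbb{R}$. *)

theory Defs
  imports "HOL-Analysis.Analysis"
begin

definition partial_deriv :: "'n::finite \<Rightarrow> (real^'n \<Rightarrow> real) \<Rightarrow> real^'n \<Rightarrow> real" where
  "partial_deriv i f x = frechet_derivative f (at x) (axis i 1)"

text \<open>A multi-index is encoded as the list of the coordinates to differentiate in;
  its length is the order of the derivative.\<close>

fun iter_partial :: "'n::finite list \<Rightarrow> (real^'n \<Rightarrow> real) \<Rightarrow> real^'n \<Rightarrow> real" where
  "iter_partial [] f = f"
| "iter_partial (i # js) f = partial_deriv i (iter_partial js f)"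

definition smooth :: "(real^'n::finite \<Rightarrow> real) \<Rightarrow> bool" where
  "smooth f \<longleftrightarrow> (\<forall>js x. iter_partial js f differentiable (at x))"

definition test_functions :: "(real^'n::finite) set \<Rightarrow> (real^'n \<Rightarrow> real) set" where
  "test_functions \<Omega> =
     {\<phi>. smooth \<phi> \<and> compact (closure {x. \<phi> x \<noteq> 0}) \<and> closure {x. \<phi> x \<noteq> 0} \<subseteq> \<Omega>}"

definition locally_integrable :: "(real^'n::finite) set \<Rightarrow> (real^'n \<Rightarrow> real) \<Rightarrow> bool" where
  "locally_integrable \<Omega> f \<longleftrightarrow>
     (\<forall>K. compact K \<and> K \<subseteq> \<Omega> \<longrightarrow> integrable (lebesgue_on K) f)"

definition square_integrable :: "(real^'n::finite) set \<Rightarrow> (real^'n \<Rightarrow> real) \<Rightarrow> bool" where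
  "square_integrable \<Omega> f \<longleftrightarrow>
     f \<in> borel_measurable (lebesgue_on \<Omega>) \<and> integrable (lebesgue_on \<Omega>) (\<lambda>x. (f x)\<^sup>2)"

definition has_weak_deriv ::
  "(real^'n::finite) set \<Rightarrow> 'n list \<Rightarrow> (real^'n \<Rightarrow> real) \<Rightarrow> (real^'n \<Rightarrow> real) \<Rightarrow> bool" where
  "has_weak_deriv \<Omega> js u g \<longleftrightarrow>
     locally_integrable \<Omega> u \<and> locally_integrable \<Omega> g \<and>
     (\<forall>\<phi>\<in>test_functions \<Omega>.
        (LINT x|lebesgue_on \<Omega>. u x * iter_partial js \<phi> x) =
        (-1) ^ length js * (LINT x|lebesgue_on \<Omega>. g x * \<phi> x))"

text \<open>On an open set the weak derivative is determined only up to a null set. The constant below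
  picks a representative and is meaningful only where a weak derivative exists; it is
  used only inside integrals and almost-everywhere statements.\<close>

definition weak_deriv ::
  "(real^'n::finite) set \<Rightarrow> 'n list \<Rightarrow> (real^'n \<Rightarrow> real) \<Rightarrow> real^'n \<Rightarrow> real" where
  "weak_deriv \<Omega> js u = (SOME g. has_weak_deriv \<Omega> js u g)"

definition weak_laplacian ::
  "(real^'n::finite) set \<Rightarrow> (real^'n \<Rightarrow> real) \<Rightarrow> real^'n \<Rightarrow> real" where
  "weak_laplacian \<Omega> u x = (\<Sum>i\<in>UNIV. weak_deriv \<Omega> [i, i] u x)"

text \<open>Elements of the Sobolev spaces are represented by functions on the whole space, of which
  only the values on \<open>\<Omega>\<close> (up to null sets) matter.\<close>

definition H2 :: "(real^'n::finite) set \<Rightarrow> (real^'n \<Rightarrow> real) set" where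
  "H2 \<Omega> = {u. square_integrable \<Omega> u \<and>
     (\<forall>js. length js \<le> 2 \<longrightarrow> (\<exists>g. square_integrable \<Omega> g \<and> has_weak_deriv \<Omega> js u g))}"

text \<open>Mixed second derivatives are counted once for each order of differentiation, i.e. the
  full Hessian is measured in the Frobenius norm.\<close>

definition H2_norm :: "(real^'n::finite) set \<Rightarrow> (real^'n \<Rightarrow> real) \<Rightarrow> real" where
  "H2_norm \<Omega> u =
     sqrt (\<Sum>js | length js \<le> 2. LINT x|lebesgue_on \<Omega>. (weak_deriv \<Omega> js u x)\<^sup>2)"

lemma finite_multi_indices: "finite {js :: 'n::finite list. length js \<le> m}"
  using finite_lists_length_le[of "UNIV :: 'n set" m] by simp

definition H2_0 :: "(real^'n::finite) set \<Rightarrow> (real^'n \<Rightarrow> real) set" where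
  "H2_0 \<Omega> = {u \<in> H2 \<Omega>. \<forall>\<epsilon>>0. \<exists>\<phi>\<in>test_functions \<Omega>. H2_norm \<Omega> (\<lambda>x. u x - \<phi> x) < \<epsilon>}"

definition H2_loc :: "(real^'n::finite \<Rightarrow> real) set" where
  "H2_loc = {u. \<forall>\<Omega>. open \<Omega> \<and> bounded \<Omega> \<longrightarrow> u \<in> H2 \<Omega>}"

definition biharmonic_AC :: "(real^'n::finite \<Rightarrow> real) \<Rightarrow> (real^'n) set \<Rightarrow> real" where
  "biharmonic_AC u \<Omega> =
     (LINT x|lebesgue_on \<Omega>. (weak_laplacian \<Omega> u x)\<^sup>2) + measure lebesgue {x \<in> \<Omega>. u x \<noteq> 0}"

definition global_minimizer :: "(real^'n::finite \<Rightarrow> real) \<Rightarrow> bool" where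
  "global_minimizer u \<longleftrightarrow> u \<in> H2_loc \<and>
     (\<forall>\<Omega>. open \<Omega> \<and> bounded \<Omega> \<longrightarrow>
        (\<forall>v\<in>H2 \<Omega>. (\<lambda>x. v x - u x) \<in> H2_0 \<Omega> \<longrightarrow> biharmonic_AC u \<Omega> \<le> biharmonic_AC v \<Omega>))"

definition type_I_minimizer :: "(real^'n::finite \<Rightarrow> real) \<Rightarrow> bool" where
  "type_I_minimizer u \<longleftrightarrow> global_minimizer u \<and>
     (\<exists>\<sigma>\<in>{1, -1}. \<exists>\<nu> x0. norm \<nu> = 1 \<and>
        u = (\<lambda>x. \<sigma> * (1/2) * ((x - x0) \<bullet> \<nu>)\<^sup>2 * indicator {0<..} ((x - x0) \<bullet> \<nu>)))"

definition type_II_minimizer :: "(real^'n::finite \<Rightarrow> real) \<Rightarrow> bool" where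
  "type_II_minimizer u \<longleftrightarrow> global_minimizer u \<and>
     (\<exists>c. AE x in lebesgue. weak_laplacian UNIV u x = c)"

text \<open>The coordinate \<open>k\<close> plays the role of the last coordinate; the index type carries no
  order.\<close>

definition two_phase :: "'n::finite \<Rightarrow> real \<Rightarrow> real \<Rightarrow> real^'n \<Rightarrow> real" where
  "two_phase k d1 d2 x =
     (if x $ k \<ge> 0 then d1 * ((x $ k)\<^sup>2 / 2) else d2 * ((x $ k)\<^sup>2 / 2))"

end

theory Submission
  imports Defs
begin

text \<open>
  Write \<open>w\<close> for the two-phase function and \<open>W\<close> for its profile, so that \<open>w x = W (x $ k)\<close>. Every
  competitor used here is \<open>w + \<phi>\<close> with a test function \<open>\<phi>\<close>, which lies in \<open>H2_0\<close> because it
  approximates itself. The analytic input is that weak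
  derivatives are unique almost everywhere (\<open>fundamental_lemma\<close>) and that the weak Laplacian of
  \<open>w\<close> is the piecewise constant function with values \<open>d1\<close> and \<open>d2\<close>
  (\<open>two_phase_has_weak_deriv\<close>). Minimality then says that the energy of \<open>w + \<phi>\<close> minus that of \<open>w\<close>,
  an integral of classical functions, is nonnegative (\<open>minimizer_energy_gap_nonneg\<close>).

  This reduces to dimension one. Take \<open>\<phi>\<close> to be a function \<open>h\<close> of \<open>x $ k\<close> times a cutoff that is \<open>1\<close>
  for \<open>\<bar>x $ i\<bar> \<le> R\<close> and falls to \<open>0\<close> over a layer of width one in each of the other directions. The
  energy change is the one-dimensional change produced by \<open>h\<close>, times \<open>(2 * R) ^ (n - 1)\<close>, up to an
  error bounded by a constant times the volume of the transition layer, which is of lower order in \<open>R\<close>. So no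
  smooth, compactly supported \<open>h\<close> lowers the one-dimensional energy of \<open>W\<close>
  (\<open>one_dim_energy_gap_nonneg\<close>).

  If \<open>d1\<close> and \<open>d2\<close> are both nonzero, then \<open>W\<close> already has full support, so the volume term cannot
  grow, and the first variation of the bending energy must vanish. It equals \<open>2 * (d2 - d1) * h' 0\<close>, whence
  \<open>d1 = d2\<close> (\<open>phase_equal_of_nonneg_gap\<close>).

  If only \<open>d = d1\<close> is nonzero, move the free boundary from \<open>0\<close> to \<open>a = \<plusminus>1\<close>, that is, replace
  \<open>d * x\<^sup>2 / 2\<close> by \<open>d * (x - a)\<^sup>2 / 2\<close> there and correct the difference \<open>d * (a * x - 1/2)\<close> slowly over a
  distance \<open>m\<close>. The volume changes by \<open>- a\<close>. The bending energy loses \<open>a * d\<^sup>2\<close> on the interval between the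
  boundaries and pays \<open>2 * a * d\<^sup>2\<close> for the extra slope \<open>a * d\<close> acquired along the correction, whose own
  quadratic cost is of order \<open>1 / m\<close>. The total is \<open>a * (d\<^sup>2 - 1)\<close> plus an error of order \<open>1 / m\<close>.
  Both signs of \<open>a\<close> are admissible, so \<open>d\<^sup>2 = 1\<close> (\<open>one_phase_curvature\<close>). Moving the boundary
  would seem to require a perturbation that is not smooth at \<open>0\<close>, where \<open>W''\<close> jumps; instead the
  jump stays at \<open>0\<close> and is compensated smoothly within \<open>[0, 1/m]\<close>, at a cost of order \<open>1 / m\<close>. The
  case \<open>d1 = 0\<close> follows by reflecting the line.
\<close>

section \<open>Smooth functions of one real variable\<close>

text \<open>
  Peeling off the first derivative, rather than describing the last one, turns each closure
  property below into an induction on the order: a derivative of a sum, product or inverse is built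
  from the same operations on functions that are differentiable one time less.
\<close>

primrec diff_times :: "nat \<Rightarrow> (real \<Rightarrow> real) \<Rightarrow> bool" where
  "diff_times 0 f = True"
| "diff_times (Suc n) f = ((\<forall>x. f differentiable (at x)) \<and> diff_times n (deriv f))"

definition smooth_real :: "(real \<Rightarrow> real) \<Rightarrow> bool" where
  "smooth_real f \<longleftrightarrow> (\<forall>n. diff_times n f)"

lemma diff_times_SucI:
  assumes "\<And>x. (f has_real_derivative f' x) (at x)" "diff_times n f'"
  shows "diff_times (Suc n) f"
proof -
  have "deriv f = f'" using assms(1) DERIV_imp_deriv by blast
  then show ?thesis using assms by (auto simp: real_differentiable_def)
qed

lemma diff_times_SucE:
  assumes "diff_times (Suc n) f"
  obtains f' where "\<And>x. (f has_real_derivative f' x) (at x)" "diff_times n f'"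
  using assms that[of "deriv f"] by (simp add: DERIV_deriv_iff_real_differentiable)

lemma diff_times_mono: "diff_times (Suc n) f \<Longrightarrow> diff_times n f"
  by (induction n arbitrary: f) auto

lemma diff_times_const: "diff_times n (\<lambda>x. c)"
proof (induction n arbitrary: c)
  case (Suc n)
  show ?case by (rule diff_times_SucI[OF DERIV_const Suc.IH])
qed simp

lemma diff_times_add: "diff_times n f \<Longrightarrow> diff_times n g \<Longrightarrow> diff_times n (\<lambda>x. f x + g x)"
proof (induction n arbitrary: f g)
  case (Suc n)
  from Suc.prems obtain f' g' where "\<And>x. (f has_real_derivative f' x) (at x)" "diff_times n f'"
    "\<And>x. (g has_real_derivative g' x) (at x)" "diff_times n g'"
    by (metis diff_times_SucE)
  then show ?case
    by (intro diff_times_SucI[of _ "\<lambda>x. f' x + g' x"] Suc.IH DERIV_add)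
qed simp

lemma diff_times_mult: "diff_times n f \<Longrightarrow> diff_times n g \<Longrightarrow> diff_times n (\<lambda>x. f x * g x)"
proof (induction n arbitrary: f g)
  case (Suc n)
  from Suc.prems obtain f' g' where d: "\<And>x. (f has_real_derivative f' x) (at x)" "diff_times n f'"
    "\<And>x. (g has_real_derivative g' x) (at x)" "diff_times n g'"
    by (metis diff_times_SucE)
  have "diff_times n f" "diff_times n g" using Suc.prems diff_times_mono by blast+
  then show ?case
    using d by (intro diff_times_SucI[of _ "\<lambda>x. f' x * g x + f x * g' x"] diff_times_add Suc.IH)
     (auto intro!: DERIV_mult'[THEN DERIV_cong])
qed simp

lemma diff_times_inverse:
  "diff_times n g \<Longrightarrow> (\<And>x. g x \<noteq> 0) \<Longrightarrow> diff_times n (\<lambda>x. inverse (g x))"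
proof (induction n)
  case (Suc n)
  from Suc.prems obtain g' where d: "\<And>x. (g has_real_derivative g' x) (at x)" "diff_times n g'"
    by (metis diff_times_SucE)
  have i: "diff_times n (\<lambda>x. inverse (g x))" using Suc diff_times_mono by blast
  show ?case
    using d Suc.prems
    by (intro diff_times_SucI[of _ "\<lambda>x. (-1 * g' x) * (inverse (g x) * inverse (g x))"]
          diff_times_mult diff_times_const i)
     (auto intro!: derivative_eq_intros simp: power2_eq_square)
qed simp

lemma diff_times_affine: "diff_times n f \<Longrightarrow> diff_times n (\<lambda>x. f (a * x + b))"
proof (induction n arbitrary: f)
  case (Suc n)
  from Suc.prems obtain f' where d: "\<And>x. (f has_real_derivative f' x) (at x)" "diff_times n f'"
    by (metis diff_times_SucE)
  show ?case
  proof (rule diff_times_SucI[of _ "\<lambda>x. f' (a * x + b) * a"])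
    show "((\<lambda>x. f (a * x + b)) has_real_derivative f' (a * x + b) * a) (at x)" for x
      by (rule DERIV_chain2[OF d(1)]) (auto intro!: derivative_eq_intros)
    show "diff_times n (\<lambda>x. f' (a * x + b) * a)"
      by (intro diff_times_mult diff_times_const Suc.IH d)
  qed
qed simp

lemma diff_times_id: "diff_times n (\<lambda>x. x)"
proof (cases n)
  case (Suc m)
  show ?thesis unfolding Suc by (rule diff_times_SucI[OF DERIV_ident diff_times_const])
qed simp

lemma smooth_real_const: "smooth_real (\<lambda>x. c)"
  and smooth_real_id: "smooth_real (\<lambda>x. x)"
  and smooth_real_add: "smooth_real f \<Longrightarrow> smooth_real g \<Longrightarrow> smooth_real (\<lambda>x. f x + g x)"
  and smooth_real_mult: "smooth_real f \<Longrightarrow> smooth_real g \<Longrightarrow> smooth_real (\<lambda>x. f x * g x)"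
  and smooth_real_inverse: "smooth_real f \<Longrightarrow> (\<And>x. f x \<noteq> 0) \<Longrightarrow> smooth_real (\<lambda>x. inverse (f x))"
  and smooth_real_affine: "smooth_real f \<Longrightarrow> smooth_real (\<lambda>x. f (a * x + b))"
  unfolding smooth_real_def
  by (auto intro: diff_times_const diff_times_id diff_times_add diff_times_mult diff_times_inverse diff_times_affine)

lemma smooth_real_diff:
  assumes "smooth_real f" "smooth_real g" shows "smooth_real (\<lambda>x. f x - g x)"
proof -
  have "smooth_real (\<lambda>x. f x + (-1) * g x)"
    by (intro smooth_real_add smooth_real_mult smooth_real_const assms)
  then show ?thesis by simp
qed

lemma smooth_real_DERIV:
  assumes "smooth_real f" shows "(f has_real_derivative deriv f x) (at x)"
proof -
  have "diff_times (Suc 0) f" using assms smooth_real_def by blast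
  then show ?thesis by (simp add: DERIV_deriv_iff_real_differentiable)
qed

lemma smooth_real_deriv: "smooth_real f \<Longrightarrow> smooth_real (deriv f)"
  unfolding smooth_real_def by (metis diff_times.simps(2))

lemma smooth_real_continuous: "smooth_real f \<Longrightarrow> continuous_on A f"
  by (meson DERIV_continuous_on has_field_derivative_at_within smooth_real_DERIV)

text \<open>
  The functions \<open>p (1/x) * exp (- 1/x)\<close>, extended by zero, form a family closed under
  differentiation, so \<open>exp (- 1/x)\<close> is handled together with all its derivatives.
\<close>

definition flat_exp :: "real poly \<Rightarrow> real \<Rightarrow> real" where
  "flat_exp p x = (if x > 0 then poly p (1 / x) * exp (- (1 / x)) else 0)"

lemma poly_times_exp_tendsto_0: "((\<lambda>y::real. poly p y * exp (- y)) \<longlongrightarrow> 0) at_top"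
proof -
  have "((\<lambda>y::real. \<Sum>i\<le>degree p. coeff p i * (y ^ i / exp y)) \<longlongrightarrow> (\<Sum>i\<le>degree p. coeff p i * 0)) at_top"
    by (intro tendsto_sum tendsto_mult tendsto_const tendsto_power_div_exp_0)
  moreover have "(\<lambda>y::real. poly p y * exp (- y)) = (\<lambda>y. \<Sum>i\<le>degree p. coeff p i * (y ^ i / exp y))"
    by (simp add: poly_altdef sum_distrib_right exp_minus divide_inverse mult.assoc)
  ultimately show ?thesis by simp
qed

text \<open>
  At the origin the difference quotient from the right is \<open>y * p y * exp (- y)\<close> with \<open>y = 1/x\<close>, and the
  exponential wins.
\<close>

lemma DERIV_flat_exp:
  "(flat_exp p has_real_derivative flat_exp ([:0, 0, 1:] * (p - pderiv p)) x) (at x)"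
proof -
  consider "x > 0" | "x < 0" | "x = 0" by linarith
  then show ?thesis
  proof cases
    case 1
    have "((\<lambda>x. poly p (1 / x) * exp (- (1 / x))) has_real_derivative
       poly ([:0, 0, 1:] * (p - pderiv p)) (1/x) * exp (- (1 / x))) (at x)"
      using 1 by (auto intro!: derivative_eq_intros DERIV_chain2[OF poly_DERIV]
        simp: algebra_simps power2_eq_square divide_simps)
    moreover have "eventually (\<lambda>y. y > 0) (nhds x)"
      using 1 by (metis eventually_nhds greaterThan_iff open_greaterThan)
    ultimately show ?thesis
      using 1 by (subst DERIV_cong_ev[OF refl _ refl]) (auto simp: flat_exp_def elim: eventually_mono)
  next
    case 2
    have "eventually (\<lambda>y. y < 0) (nhds x)"
      using 2 by (metis eventually_nhds lessThan_iff open_lessThan)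
    then have "eventually (\<lambda>y. flat_exp p y = 0) (nhds x)"
      by (auto simp: flat_exp_def elim: eventually_mono)
    then show ?thesis
      using 2 by (subst DERIV_cong_ev[OF refl _ refl]) (auto simp: flat_exp_def)
  next
    case 3
    have l: "((\<lambda>h. flat_exp p h / h) \<longlongrightarrow> 0) (at_left 0)"
      by (rule tendsto_eventually) (auto simp: flat_exp_def eventually_at_left_field intro!: exI[of _ "-1"])
    have "((\<lambda>h. poly ([:0,1:] * p) (inverse h) * exp (- inverse h)) \<longlongrightarrow> 0) (at_right 0)"
      by (rule filterlim_compose[OF poly_times_exp_tendsto_0 filterlim_inverse_at_top_right])
    moreover have "eventually (\<lambda>h. poly ([:0,1:] * p) (inverse h) * exp (- inverse h) = flat_exp p h / h) (at_right (0::real))"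
      by (auto simp: flat_exp_def eventually_at_right_field field_simps intro!: exI[of _ "1"])
    ultimately have r: "((\<lambda>h. flat_exp p h / h) \<longlongrightarrow> 0) (at_right 0)"
      by (rule Lim_transform_eventually)
    have "((\<lambda>h. flat_exp p h / h) \<longlongrightarrow> 0) (at 0)" using l r filterlim_split_at by blast
    then show ?thesis using 3 by (simp add: DERIV_def flat_exp_def)
  qed
qed

lemma smooth_real_flat_exp: "smooth_real (flat_exp p)"
proof -
  have "diff_times n (flat_exp p)" for n p
  proof (induction n arbitrary: p)
    case (Suc n)
    show ?case by (rule diff_times_SucI[OF DERIV_flat_exp Suc.IH])
  qed simp
  then show ?thesis by (simp add: smooth_real_def)
qed

text \<open>
  A smooth transition from \<open>0\<close> on the left of the unit interval to \<open>1\<close> on its right; all cutoffs below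
  are made from it.
\<close>

definition smooth_step :: "real \<Rightarrow> real" where
  "smooth_step x = flat_exp 1 x * inverse (flat_exp 1 x + flat_exp 1 (1 - x))"

lemma flat_exp_1: "flat_exp 1 x \<ge> 0" "x > 0 \<Longrightarrow> flat_exp 1 x > 0" "x \<le> 0 \<Longrightarrow> flat_exp 1 x = 0"
  by (auto simp: flat_exp_def)

lemma smooth_step_denominator: "flat_exp 1 x + flat_exp 1 (1 - x) > 0"
proof (cases "x > 0")
  case True
  then show ?thesis using flat_exp_1(2)[of x] flat_exp_1(1)[of "1 - x"] by linarith
next
  case False
  then show ?thesis using flat_exp_1(1)[of x] flat_exp_1(2)[of "1 - x"] by linarith
qed

lemma smooth_step_smooth: "smooth_real smooth_step"
proof -
  have "smooth_real (\<lambda>x. flat_exp 1 x * inverse (flat_exp 1 x + flat_exp 1 ((-1) * x + 1)))"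
    using smooth_step_denominator
    by (intro smooth_real_mult smooth_real_inverse smooth_real_add smooth_real_flat_exp smooth_real_affine)
       (simp add: less_imp_neq[symmetric])
  then show ?thesis by (simp add: smooth_step_def[abs_def])
qed

lemma smooth_step_0: "x \<le> 0 \<Longrightarrow> smooth_step x = 0"
  by (simp add: smooth_step_def flat_exp_1)

lemma smooth_step_1: "x \<ge> 1 \<Longrightarrow> smooth_step x = 1"
  using flat_exp_1(2)[of x] by (simp add: smooth_step_def flat_exp_1 less_imp_neq[symmetric])

lemma smooth_step_ge_0: "smooth_step x \<ge> 0"
  using smooth_step_denominator[of x] by (simp add: smooth_step_def flat_exp_1)

lemma smooth_step_le_1: "smooth_step x \<le> 1"
  using smooth_step_denominator[of x] flat_exp_1(1)[of "1 - x"] by (simp add: smooth_step_def field_simps)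

section \<open>Products of one-variable functions and test functions\<close>

definition coord_prod :: "('n::finite \<Rightarrow> real \<Rightarrow> real) \<Rightarrow> real^'n \<Rightarrow> real" where
  "coord_prod g x = (\<Prod>i\<in>UNIV. g i (x $ i))"

lemma has_derivative_coord_prod:
  assumes "\<And>i. smooth_real (g i)"
  shows "(coord_prod g has_derivative
    (\<lambda>v. \<Sum>i\<in>UNIV. deriv (g i) (x $ i) * v $ i * (\<Prod>j\<in>UNIV - {i}. g j (x $ j)))) (at x)"
proof -
  have "((\<lambda>x. g i (x $ i)) has_derivative (\<lambda>v. deriv (g i) (x $ i) * v $ i)) (at x)" for i
  proof -
    have "(g i has_derivative (*) (deriv (g i) (x $ i))) (at (x $ i))"
      using smooth_real_DERIV[OF assms] by (simp add: has_field_derivative_def)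
    moreover have "((\<lambda>x. x $ i) has_derivative (\<lambda>v. v $ i)) (at x)"
      by (rule bounded_linear_imp_has_derivative[OF bounded_linear_vec_nth])
    ultimately show ?thesis
      using has_derivative_compose[of "\<lambda>x. x $ i" "\<lambda>v. v $ i" x UNIV "g i"] by simp
  qed
  then show ?thesis
    unfolding coord_prod_def[abs_def] by (rule has_derivative_prod)
qed

text \<open>
  Partial derivatives act on a product of one-variable functions by differentiating a single factor.
  The class of such products is therefore closed under partial derivatives, and smoothness in several
  variables follows from smoothness of the factors.
\<close>

lemma partial_deriv_coord_prod:
  assumes "\<And>i. smooth_real (g i)"
  shows "partial_deriv i (coord_prod g) = coord_prod (g(i := deriv (g i)))"
proof
  fix x
  note D = has_derivative_coord_prod[of g x, OF assms]
  have "partial_deriv i (coord_prod g) x =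
    (\<Sum>j\<in>UNIV. deriv (g j) (x $ j) * axis i 1 $ j * (\<Prod>l\<in>UNIV - {j}. g l (x $ l)))"
    unfolding partial_deriv_def frechet_derivative_at[OF D, symmetric] by simp
  also have "\<dots> = (\<Sum>j\<in>UNIV. if j = i then deriv (g i) (x $ i) * (\<Prod>l\<in>UNIV - {i}. g l (x $ l)) else 0)"
    by (intro sum.cong) (auto simp: axis_def)
  also have "\<dots> = deriv (g i) (x $ i) * (\<Prod>l\<in>UNIV - {i}. (g(i := deriv (g i))) l (x $ l))"
    by (simp add: sum.delta)
  also have "\<dots> = coord_prod (g(i := deriv (g i))) x"
    unfolding coord_prod_def by (subst prod.remove[of _ i]) auto
  finally show "partial_deriv i (coord_prod g) x = coord_prod (g(i := deriv (g i))) x" .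
qed

lemma smooth_coord_prod:
  fixes g :: "'n::finite \<Rightarrow> real \<Rightarrow> real"
  assumes "\<And>i. smooth_real (g i)" shows "smooth (coord_prod g)"
proof -
  have "\<exists>g'. (\<forall>i. smooth_real (g' i)) \<and> iter_partial js (coord_prod g) = coord_prod g'" for js
  proof (induction js)
    case (Cons i js)
    then obtain g' where g': "\<And>i. smooth_real (g' i)" "iter_partial js (coord_prod g) = coord_prod g'"
      by blast
    show ?case
      by (rule exI[of _ "g'(i := deriv (g' i))"])
         (simp add: g' partial_deriv_coord_prod smooth_real_deriv del: fun_upd_apply, simp add: g' smooth_real_deriv)
  next
    case Nil
    show ?case using assms by (intro exI[of _ g]) simp
  qed
  moreover have "coord_prod g' differentiable (at x)" if "\<forall>i. smooth_real (g' i)" for g' :: "'n \<Rightarrow> real \<Rightarrow> real" and x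
    using has_derivative_coord_prod[of g'] that unfolding differentiable_def by blast
  ultimately show ?thesis
    unfolding smooth_def by metis
qed

lemma test_function_coord_prod:
  fixes a b :: "real^'n::finite"
  assumes "\<And>i. smooth_real (g i)" "\<And>i t. g i t \<noteq> 0 \<Longrightarrow> a $ i \<le> t \<and> t \<le> b $ i" "cbox a b \<subseteq> \<Omega>"
  shows "coord_prod g \<in> test_functions \<Omega>"
proof -
  have "{x. coord_prod g x \<noteq> 0} \<subseteq> cbox a b"
    using assms(2) by (auto simp: coord_prod_def mem_box_cart)
  then have c: "closure {x. coord_prod g x \<noteq> 0} \<subseteq> cbox a b"
    by (rule closure_minimal) (rule closed_cbox)
  have "bounded (closure {x. coord_prod g x \<noteq> 0})"
    by (rule bounded_subset[OF bounded_cbox c])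
  then have "compact (closure {x. coord_prod g x \<noteq> 0})"
    using compact_eq_bounded_closed closed_closure by blast
  moreover have "closure {x. coord_prod g x \<noteq> 0} \<subseteq> \<Omega>"
    using c assms(3) by (rule subset_trans)
  ultimately show ?thesis
    using smooth_coord_prod[of g] assms(1) unfolding test_functions_def by blast
qed

lemma iter_partial_append: "iter_partial (js @ is) f = iter_partial js (iter_partial is f)"
  by (induction js) auto

lemma partial_deriv_locally_zero:
  assumes "open S" "x \<in> S" "\<And>y. y \<in> S \<Longrightarrow> f y = 0"
  shows "partial_deriv i f x = 0"
proof -
  have D: "(f has_derivative (\<lambda>_. 0)) (at x)"
    by (rule has_derivative_transform_within_open[OF _ assms(1,2), of "\<lambda>_. 0"]) (auto simp: assms)
  then show ?thesis
    unfolding partial_deriv_def frechet_derivative_at[OF D, symmetric] by simp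
qed

text \<open>
  The complement of the support is open, so derivatives vanish there together with the function.
\<close>

lemma iter_partial_outside_support:
  assumes "x \<notin> closure {y. \<phi> y \<noteq> 0}" shows "iter_partial js \<phi> x = 0"
  using assms
proof (induction js arbitrary: x)
  case Nil
  then have "x \<notin> {y. \<phi> y \<noteq> 0}" using closure_subset[of "{y. \<phi> y \<noteq> 0}"] by blast
  then show ?case by simp
next
  case (Cons i js)
  have "partial_deriv i (iter_partial js \<phi>) x = 0"
  proof (rule partial_deriv_locally_zero)
    show "open (- closure {y. \<phi> y \<noteq> 0})" by (simp add: open_Compl)
    show "x \<in> - closure {y. \<phi> y \<noteq> 0}" using Cons.prems by blast
    show "iter_partial js \<phi> y = 0" if "y \<in> - closure {y. \<phi> y \<noteq> 0}" for y
      using Cons.IH that by blast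
  qed
  then show ?case by simp
qed

lemma test_function_outside:
  "\<phi> \<in> test_functions \<Omega> \<Longrightarrow> x \<notin> \<Omega> \<Longrightarrow> iter_partial js \<phi> x = 0"
  by (rule iter_partial_outside_support) (auto simp: test_functions_def)

lemma test_function_iter_partial:
  assumes "\<phi> \<in> test_functions \<Omega>" shows "iter_partial js \<phi> \<in> test_functions \<Omega>"
proof -
  have "{x. iter_partial js \<phi> x \<noteq> 0} \<subseteq> closure {y. \<phi> y \<noteq> 0}"
    using iter_partial_outside_support by blast
  then have c: "closure {x. iter_partial js \<phi> x \<noteq> 0} \<subseteq> closure {y. \<phi> y \<noteq> 0}"
    by (rule closure_minimal) (rule closed_closure)
  have "bounded (closure {x. iter_partial js \<phi> x \<noteq> 0})"
    using bounded_subset[OF _ c] assms by (simp add: test_functions_def compact_imp_bounded)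
  then have "compact (closure {x. iter_partial js \<phi> x \<noteq> 0})"
    using compact_eq_bounded_closed closed_closure by blast
  moreover have "closure {x. iter_partial js \<phi> x \<noteq> 0} \<subseteq> \<Omega>"
    using c assms unfolding test_functions_def by blast
  moreover have "smooth (iter_partial js \<phi>)"
    using assms by (simp add: test_functions_def smooth_def flip: iter_partial_append)
  ultimately show ?thesis by (simp add: test_functions_def)
qed

lemma test_function_differentiable:
  "\<phi> \<in> test_functions \<Omega> \<Longrightarrow> iter_partial js \<phi> differentiable (at x)"
  by (auto simp: test_functions_def smooth_def)

lemma test_function_continuous:
  assumes "\<phi> \<in> test_functions \<Omega>" shows "continuous_on A (iter_partial js \<phi>)"
  using test_function_differentiable[OF assms]
  by (simp add: continuous_at_imp_continuous_on differentiable_imp_continuous_within)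

lemma test_function_borel:
  assumes "\<phi> \<in> test_functions \<Omega>" shows "iter_partial js \<phi> \<in> borel_measurable borel"
  by (rule borel_measurable_continuous_onI[OF test_function_continuous[OF assms]])

lemma test_function_bounded:
  assumes "\<phi> \<in> test_functions \<Omega>" obtains B where "\<And>x. \<bar>iter_partial js \<phi> x\<bar> \<le> B"
proof -
  let ?K = "closure {y. \<phi> y \<noteq> 0}"
  have "compact (iter_partial js \<phi> ` ?K)"
    using assms test_function_continuous[OF assms]
    by (intro compact_continuous_image) (auto simp: test_functions_def)
  then obtain B where B: "\<And>x. x \<in> ?K \<Longrightarrow> \<bar>iter_partial js \<phi> x\<bar> \<le> B"
    using compact_imp_bounded[of "iter_partial js \<phi> ` ?K"] unfolding bounded_iff real_norm_def by blast
  have "\<bar>iter_partial js \<phi> x\<bar> \<le> max B 0" for x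
    using B[of x] iter_partial_outside_support[of x \<phi> js] by (cases "x \<in> ?K") auto
  then show ?thesis by (rule that)
qed

lemma test_function_support_cball:
  assumes "\<phi> \<in> test_functions \<Omega>"
  obtains M where "M > 0" "\<And>js x. norm x > M \<Longrightarrow> iter_partial js \<phi> x = 0"
proof -
  have "bounded (closure {y. \<phi> y \<noteq> 0})"
    using assms by (auto simp: test_functions_def compact_imp_bounded)
  then obtain M where "M > 0" "\<And>x. x \<in> closure {y. \<phi> y \<noteq> 0} \<Longrightarrow> norm x \<le> M"
    unfolding bounded_pos by blast
  then have "iter_partial js \<phi> x = 0" if "norm x > M" for js x
    using that iter_partial_outside_support[of x \<phi> js] by force
  then show ?thesis using that \<open>M > 0\<close> by blast
qed

lemma DERIV_along_axis:
  assumes "f differentiable (at (x::real^'n::finite))"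
  shows "((\<lambda>t. f (x + t *\<^sub>R axis i 1)) has_real_derivative partial_deriv i f x) (at 0)"
proof -
  have "(f has_derivative frechet_derivative f (at x)) (at x)"
    using assms frechet_derivative_works by blast
  then have 1: "(f has_derivative frechet_derivative f (at x)) (at (x + 0 *\<^sub>R axis i 1))" by simp
  have 2: "((\<lambda>t. x + t *\<^sub>R axis i 1) has_derivative (\<lambda>t. t *\<^sub>R axis i 1)) (at 0)"
    by (auto intro!: derivative_eq_intros)
  have "((\<lambda>t. f (x + t *\<^sub>R axis i 1)) has_derivative
     (\<lambda>t. frechet_derivative f (at x) (t *\<^sub>R axis i 1))) (at 0)"
    by (rule has_derivative_compose[OF 2 1])
  moreover have "frechet_derivative f (at x) (t *\<^sub>R axis i 1) = partial_deriv i f x * t" for t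
    using linear_frechet_derivative[OF assms] by (simp add: partial_deriv_def linear_cmul)
  ultimately show ?thesis by (simp add: has_field_derivative_def)
qed

section \<open>Integration by parts against test functions\<close>

lemma integrable_bounded_support:
  fixes f :: "'a::euclidean_space \<Rightarrow> real"
  assumes [measurable]: "f \<in> borel_measurable borel"
    and B: "\<And>x. \<bar>f x\<bar> \<le> B" and M: "\<And>x. norm x > M \<Longrightarrow> f x = 0"
  shows "integrable lborel f"
proof (rule Bochner_Integration.integrable_bound)
  show "integrable lborel (\<lambda>x. B * indicator (cball 0 M) x :: real)"
    by (intro integrable_mult_right integrable_real_indicator emeasure_lborel_cball_finite) auto
  show "AE x in lborel. norm (f x) \<le> norm (B * indicator (cball 0 M) x :: real)"
  proof (intro AE_I2)
    fix x show "norm (f x) \<le> norm (B * indicator (cball 0 M) x :: real)"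
      using B[of x] M[of x] by (cases "norm x \<le> M") (auto simp: indicator_def)
  qed
qed measurable

text \<open>
  This is the mean value inequality on lines. Finitely many exceptional points on each line are allowed,
  because the slope of the two-phase function has a kink where the line crosses the hyperplane.
\<close>

lemma lipschitz_along_axis:
  fixes F G :: "real^'n::finite \<Rightarrow> real"
  assumes cont: "continuous_on UNIV F"
    and fin: "finite {t. x + t *\<^sub>R axis i 1 \<in> N}"
    and der: "\<And>x. x \<notin> N \<Longrightarrow> ((\<lambda>t. F (x + t *\<^sub>R axis i 1)) has_real_derivative G x) (at 0)"
    and B: "\<And>x. \<bar>G x\<bar> \<le> B" and t: "t \<ge> 0"
  shows "\<bar>F (x + t *\<^sub>R axis i 1) - F x\<bar> \<le> B * t"
proof -
  let ?e = "axis i 1 :: real^'n"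
  let ?S = "{t. x + t *\<^sub>R ?e \<in> N}"
  have D: "((\<lambda>s. F (x + s *\<^sub>R ?e)) has_vector_derivative G (x + s *\<^sub>R ?e)) (at s)"
    if "s \<in> {0<..<t} - ?S" for s
  proof -
    have "((\<lambda>r. F ((x + s *\<^sub>R ?e) + r *\<^sub>R ?e)) has_real_derivative G (x + s *\<^sub>R ?e)) (at 0)"
      using that by (intro der) auto
    then have "((\<lambda>r. F (x + (r + s) *\<^sub>R ?e)) has_real_derivative G (x + s *\<^sub>R ?e)) (at 0)"
      by (simp add: algebra_simps)
    then have "((\<lambda>s. F (x + s *\<^sub>R ?e)) has_real_derivative G (x + s *\<^sub>R ?e)) (at (0 + s))"
      using DERIV_shift[of "\<lambda>s. F (x + s *\<^sub>R ?e)" "G (x + s *\<^sub>R ?e)" 0 s] by blast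
    then show ?thesis by (simp add: has_real_derivative_iff_has_vector_derivative)
  qed
  have "continuous_on {0..t} (\<lambda>s. F (x + s *\<^sub>R ?e))"
    by (intro continuous_on_compose2[OF cont] continuous_intros) auto
  then have "((\<lambda>s. G (x + s *\<^sub>R ?e)) has_integral (F (x + t *\<^sub>R ?e) - F (x + 0 *\<^sub>R ?e))) {0..t}"
    using fundamental_theorem_of_calculus_interior_strong[where f="\<lambda>s. F (x + s *\<^sub>R ?e)"
        and f'="\<lambda>s. G (x + s *\<^sub>R ?e)", OF fin t D] by blast
  moreover have "0 \<le> B" using B[of x] by linarith
  ultimately have "norm (F (x + t *\<^sub>R ?e) - F (x + 0 *\<^sub>R ?e)) \<le> B * measure lborel (cbox 0 t)"
    using B by (intro has_integral_bound[where f="\<lambda>s. G (x + s *\<^sub>R ?e)"]) auto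
  then show ?thesis using t by simp
qed

lemma integral_translate:
  fixes f :: "'a::euclidean_space \<Rightarrow> real"
  assumes "f \<in> borel_measurable borel"
  shows "(LINT x|lborel. f (x + c)) = (LINT x|lborel. f x)"
proof -
  have "(LINT x|lborel. f x) = (LINT x|distr lborel borel ((+) c). f x)"
    by (simp add: lborel_distr_plus)
  also have "\<dots> = (LINT x|lborel. f (c + x))"
    using assms by (subst integral_distr) auto
  finally show ?thesis by (simp add: add.commute)
qed

text \<open>
  The integral of \<open>F\<close> is invariant under translations, so all difference quotients of \<open>F\<close> along the axis
  have integral zero. They converge to \<open>G\<close> and are dominated by the Lipschitz bound.
\<close>

lemma integral_axis_derivative_eq_0:
  fixes F G :: "real^'n::finite \<Rightarrow> real"
  assumes cont: "continuous_on UNIV F" and M: "\<And>x. norm x > M \<Longrightarrow> F x = 0"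
    and N: "N \<in> null_sets lborel" and fin: "\<And>x. finite {t. x + t *\<^sub>R axis i 1 \<in> N}"
    and der: "\<And>x. x \<notin> N \<Longrightarrow> ((\<lambda>t. F (x + t *\<^sub>R axis i 1)) has_real_derivative G x) (at 0)"
    and B: "\<And>x. \<bar>G x\<bar> \<le> B" and [measurable]: "G \<in> borel_measurable borel"
  shows "(LINT x|lborel. G x) = 0"
proof -
  let ?e = "axis i 1 :: real^'n"
  define t where "t n = 1 / (real n + 1)" for n
  have t: "t n > 0" "t n \<le> 1" for n by (auto simp: t_def)
  define D where "D n x = (F (x + t n *\<^sub>R ?e) - F x) / t n" for n x
  have F[measurable]: "F \<in> borel_measurable borel" by (rule borel_measurable_continuous_onI[OF cont])
  have "B \<ge> 0" using B[of 0] by linarith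
  have Dbound: "\<bar>D n x\<bar> \<le> B" for n x
    using lipschitz_along_axis[OF cont fin der B, where x=x and t="t n"] t[of n]
    by (simp add: D_def field_simps)
  have Dsupp: "D n x = 0" if "norm x > M + 1" for n x
  proof -
    have "norm x \<le> norm (x + t n *\<^sub>R ?e) + norm (t n *\<^sub>R ?e)"
      using norm_triangle_ineq4[of "x + t n *\<^sub>R ?e" "t n *\<^sub>R ?e"] by simp
    moreover have "norm (t n *\<^sub>R ?e) \<le> 1" using t[of n] by simp
    ultimately have "norm (x + t n *\<^sub>R ?e) > M" using that by linarith
    then show ?thesis using that M by (simp add: D_def)
  qed
  have "bounded (F ` cball 0 M)"
    by (intro compact_imp_bounded compact_continuous_image continuous_on_subset[OF cont]) auto
  then obtain C where C: "\<And>x. norm x \<le> M \<Longrightarrow> \<bar>F x\<bar> \<le> C"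
    unfolding bounded_iff by (force simp: Ball_def)
  have Fint: "integrable lborel F"
  proof (rule integrable_bounded_support[OF F _ M])
    show "\<bar>F x\<bar> \<le> max C 0" for x using C[of x] M[of x] by (cases "norm x \<le> M") auto
  qed
  have [measurable]: "D n \<in> borel_measurable borel" for n unfolding D_def by measurable
  have int0: "(LINT x|lborel. D n x) = 0" for n
  proof -
    have "integrable lborel (\<lambda>x. F (x + t n *\<^sub>R ?e))"
    proof (rule integrable_bounded_support)
      show "\<bar>F (x + t n *\<^sub>R ?e)\<bar> \<le> max C 0" for x
        using C[of "x + t n *\<^sub>R ?e"] M[of "x + t n *\<^sub>R ?e"] by (cases "norm (x + t n *\<^sub>R ?e) \<le> M") auto
      show "F (x + t n *\<^sub>R ?e) = 0" if "norm x > M + 1" for x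
        using Dsupp[OF that, of n] M[of x] that t[of n] by (simp add: D_def)
    qed measurable
    then have "(LINT x|lborel. F (x + t n *\<^sub>R ?e) - F x) = 0"
      using Fint integral_translate[OF F] by simp
    then show ?thesis unfolding D_def by simp
  qed
  have "(\<lambda>n. LINT x|lborel. D n x) \<longlonglongrightarrow> (LINT x|lborel. G x)"
  proof (rule integral_dominated_convergence[where w="\<lambda>x. B * indicator (cball 0 (M + 1)) x"])
    show "integrable lborel (\<lambda>x. B * indicator (cball 0 (M + 1)) x :: real)"
      by (intro integrable_mult_right integrable_real_indicator emeasure_lborel_cball_finite) auto
    show "AE x in lborel. norm (D n x) \<le> B * indicator (cball 0 (M + 1)) x" for n
    proof (intro AE_I2)
      fix x show "norm (D n x) \<le> B * indicator (cball 0 (M + 1)) x"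
        using Dbound[of n x] Dsupp[of x n] \<open>B \<ge> 0\<close> by (cases "norm x \<le> M + 1") (auto simp: indicator_def)
    qed
    show "AE x in lborel. (\<lambda>n. D n x) \<longlonglongrightarrow> G x"
    proof (rule AE_I'[OF N])
      have "(\<lambda>n. D n x) \<longlonglongrightarrow> G x" if "x \<notin> N" for x
      proof -
        have "((\<lambda>h. (F (x + h *\<^sub>R ?e) - F x) / h) \<longlongrightarrow> G x) (at 0)"
          using der[OF that] by (simp add: DERIV_def)
        moreover have "filterlim t (at 0) sequentially"
          unfolding filterlim_at t_def using LIMSEQ_inverse_real_of_nat
          by (auto simp: inverse_eq_divide add.commute)
        ultimately show ?thesis unfolding D_def by (rule filterlim_compose)
      qed
      then show "{x \<in> space lborel. \<not> (\<lambda>n. D n x) \<longlonglongrightarrow> G x} \<subseteq> N" by blast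
    qed
  qed measurable
  then show ?thesis using int0 by (simp add: LIMSEQ_const_iff)
qed

text \<open>
  The product \<open>u * \<phi>\<close> inherits a bounded derivative along the axis from its factors, because only the values
  of \<open>u\<close> on the support of \<open>\<phi>\<close> matter. Local boundedness of \<open>u'\<close> is what quadratic growth
  of the two-phase function permits.
\<close>

lemma integral_by_parts_test_function:
  fixes u u' :: "real^'n::finite \<Rightarrow> real"
  assumes cont: "continuous_on UNIV u"
    and N: "N \<in> null_sets lborel" "\<And>x. finite {t. x + t *\<^sub>R axis i 1 \<in> N}"
    and der: "\<And>x. x \<notin> N \<Longrightarrow> ((\<lambda>t. u (x + t *\<^sub>R axis i 1)) has_real_derivative u' x) (at 0)"
    and bd: "\<And>M. \<exists>B. \<forall>x. norm x \<le> M \<longrightarrow> \<bar>u' x\<bar> \<le> B" and [measurable]: "u' \<in> borel_measurable borel"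
    and \<phi>: "\<phi> \<in> test_functions \<Omega>"
  shows "(LINT x|lborel. u x * partial_deriv i \<phi> x) = - (LINT x|lborel. u' x * \<phi> x)"
proof -
  have cont\<phi>: "continuous_on UNIV \<phi>" using test_function_continuous[OF \<phi>, of UNIV "[]"] by simp
  have [measurable]: "u \<in> borel_measurable borel" "\<phi> \<in> borel_measurable borel"
    "partial_deriv i \<phi> \<in> borel_measurable borel"
    using test_function_borel[OF \<phi>, of "[]"] test_function_borel[OF \<phi>, of "[i]"]
      borel_measurable_continuous_onI[OF cont] by auto
  obtain M where M: "\<And>js x. norm x > M \<Longrightarrow> iter_partial js \<phi> x = 0"
    using test_function_support_cball[OF \<phi>] by metis
  have M0: "norm x > M \<Longrightarrow> \<phi> x = 0" and M1: "norm x > M \<Longrightarrow> partial_deriv i \<phi> x = 0" for x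
    using M[of x "[]"] M[of x "[i]"] by auto
  obtain B0 where B0: "\<And>x. \<bar>\<phi> x\<bar> \<le> B0" using test_function_bounded[OF \<phi>, of "[]"] by auto
  obtain B1 where B1: "\<And>x. \<bar>partial_deriv i \<phi> x\<bar> \<le> B1" using test_function_bounded[OF \<phi>, of "[i]"] by auto
  obtain C' where C': "\<And>x. norm x \<le> M \<Longrightarrow> \<bar>u' x\<bar> \<le> C'" using bd by blast
  have "bounded (u ` cball 0 M)"
    by (intro compact_imp_bounded compact_continuous_image continuous_on_subset[OF cont]) auto
  then obtain C where C: "\<And>x. norm x \<le> M \<Longrightarrow> \<bar>u x\<bar> \<le> C" unfolding bounded_iff by (force simp: Ball_def)
  have nn: "B0 \<ge> 0" "B1 \<ge> 0" using B0[of 0] B1[of 0] by linarith+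
  have b1: "\<bar>u x * partial_deriv i \<phi> x\<bar> \<le> \<bar>C\<bar> * B1" for x
  proof (cases "norm x \<le> M")
    case True
    have "\<bar>u x\<bar> \<le> \<bar>C\<bar>" using C[OF True] by linarith
    then show ?thesis unfolding abs_mult using B1[of x] by (intro mult_mono) auto
  qed (use M1[of x] nn in auto)
  have b2: "\<bar>u' x * \<phi> x\<bar> \<le> \<bar>C'\<bar> * B0" for x
  proof (cases "norm x \<le> M")
    case True
    have "\<bar>u' x\<bar> \<le> \<bar>C'\<bar>" using C'[OF True] by linarith
    then show ?thesis unfolding abs_mult using B0[of x] by (intro mult_mono) auto
  qed (use M0[of x] nn in auto)
  have i1: "integrable lborel (\<lambda>x. u x * partial_deriv i \<phi> x)"
    by (rule integrable_bounded_support[OF _ b1, where M=M]) (auto simp: M1)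
  have i2: "integrable lborel (\<lambda>x. u' x * \<phi> x)"
    by (rule integrable_bounded_support[OF _ b2, where M=M]) (auto simp: M0)
  have "(LINT x|lborel. u x * partial_deriv i \<phi> x + u' x * \<phi> x) = 0"
  proof (rule integral_axis_derivative_eq_0[where F="\<lambda>x. u x * \<phi> x" and M=M, OF _ _ N])
    show "continuous_on UNIV (\<lambda>x. u x * \<phi> x)" by (intro continuous_on_mult cont cont\<phi>)
    show "\<bar>u x * partial_deriv i \<phi> x + u' x * \<phi> x\<bar> \<le> \<bar>C\<bar> * B1 + \<bar>C'\<bar> * B0" for x
      using b1[of x] b2[of x] by linarith
    show "((\<lambda>t. u (x + t *\<^sub>R axis i 1) * \<phi> (x + t *\<^sub>R axis i 1)) has_real_derivative
         u x * partial_deriv i \<phi> x + u' x * \<phi> x) (at 0)" if "x \<notin> N" for x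
    proof -
      have "((\<lambda>t. \<phi> (x + t *\<^sub>R axis i 1)) has_real_derivative partial_deriv i \<phi> x) (at 0)"
        by (rule DERIV_along_axis) (use test_function_differentiable[OF \<phi>, of "[]"] in simp)
      from DERIV_mult[OF der[OF that] this] show ?thesis by (simp add: algebra_simps)
    qed
  qed (auto simp: M0)
  then show ?thesis using i1 i2 by simp
qed

section \<open>Uniqueness of weak derivatives\<close>

lemma integral_lebesgue_on_borel:
  fixes f :: "real^'n::finite \<Rightarrow> real"
  assumes "f \<in> borel_measurable borel" "\<Omega> \<in> sets borel" "\<And>x. x \<notin> \<Omega> \<Longrightarrow> f x = 0"
  shows "(LINT x|lebesgue_on \<Omega>. f x) = (LINT x|lborel. f x)"
proof -
  have "(LINT x|lebesgue_on \<Omega>. f x) = (LINT x|lebesgue. indicator \<Omega> x *\<^sub>R f x)"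
    using assms by (intro integral_restrict_space) auto
  also have "(\<lambda>x. indicator \<Omega> x *\<^sub>R f x) = f"
    using assms(3) by (auto simp: fun_eq_iff indicator_def)
  also have "(LINT x|lebesgue. f x) = (LINT x|lborel. f x)"
    using assms by (intro integral_completion) auto
  finally show ?thesis .
qed

text \<open>
  A locally integrable function need not be integrable up to the boundary, but the product only
  sees the compact support of the test function.
\<close>

lemma integrable_mult_test_function:
  assumes u: "locally_integrable \<Omega> u" and \<Omega>: "open \<Omega>" and \<phi>: "\<phi> \<in> test_functions \<Omega>"
  shows "integrable (lebesgue_on \<Omega>) (\<lambda>x. u x * \<phi> x)"
proof -
  let ?K = "closure {x. \<phi> x \<noteq> 0}"
  have K: "compact ?K" "?K \<subseteq> \<Omega>" using \<phi> by (auto simp: test_functions_def)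
  then have Ks: "?K \<in> sets lebesgue" by (simp add: borel_closed)
  have "integrable (lebesgue_on ?K) u" using u K by (auto simp: locally_integrable_def)
  then have 1: "integrable lebesgue (\<lambda>x. indicator ?K x *\<^sub>R u x)"
    using Ks by (subst (asm) integrable_restrict_space) auto
  obtain B where B: "\<And>x. \<bar>\<phi> x\<bar> \<le> B" using test_function_bounded[OF \<phi>, of "[]"] by auto
  have m: "\<phi> \<in> borel_measurable borel" using test_function_borel[OF \<phi>, of "[]"] by simp
  have 2: "integrable lebesgue (\<lambda>x. B * (indicator ?K x *\<^sub>R u x))" using 1 by (rule integrable_mult_right)
  have 3: "integrable lebesgue (\<lambda>x. \<phi> x * (indicator ?K x *\<^sub>R u x))"
  proof (rule Bochner_Integration.integrable_bound[OF 2])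
    show "(\<lambda>x. \<phi> x * (indicator ?K x *\<^sub>R u x)) \<in> borel_measurable lebesgue"
      using m 1 by (intro borel_measurable_times) (auto intro: measurable_completion)
    have "\<bar>\<phi> x\<bar> * \<bar>indicator ?K x *\<^sub>R u x\<bar> \<le> \<bar>B\<bar> * \<bar>indicator ?K x *\<^sub>R u x\<bar>" for x
      using B[of x] by (intro mult_right_mono) auto
    then show "AE x in lebesgue. norm (\<phi> x * (indicator ?K x *\<^sub>R u x)) \<le> norm (B * (indicator ?K x *\<^sub>R u x))"
      by (intro AE_I2) (simp add: abs_mult)
  qed
  have "(\<lambda>x. indicator \<Omega> x *\<^sub>R (u x * \<phi> x)) = (\<lambda>x. \<phi> x * (indicator ?K x *\<^sub>R u x))"
  proof
    fix x show "indicator \<Omega> x *\<^sub>R (u x * \<phi> x) = \<phi> x * (indicator ?K x *\<^sub>R u x)"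
      using K(2) closure_subset[of "{x. \<phi> x \<noteq> 0}"] by (cases "\<phi> x = 0") (auto simp: indicator_def)
  qed
  then show ?thesis
    using 3 \<Omega> by (subst integrable_restrict_space) auto
qed

text \<open>
  Each factor is supported in the corresponding side of the box, and becomes \<open>1\<close> at any
  interior point once \<open>m\<close> is large. These test functions approximate the indicator of the open box from
  inside.
\<close>

definition box_cutoff :: "real^'n::finite \<Rightarrow> real^'n \<Rightarrow> nat \<Rightarrow> real^'n \<Rightarrow> real" where
  "box_cutoff a b m = coord_prod (\<lambda>i t. smooth_step (real m * (t - a $ i)) * smooth_step (real m * (b $ i - t)))"

lemma box_cutoff_test_function:
  fixes a b :: "real^'n::finite"
  assumes "cbox a b \<subseteq> \<Omega>" shows "box_cutoff a b m \<in> test_functions \<Omega>"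
  unfolding box_cutoff_def
proof (rule test_function_coord_prod[OF _ _ assms])
  show "smooth_real (\<lambda>t. smooth_step (real m * (t - a $ i)) * smooth_step (real m * (b $ i - t)))" for i
  proof -
    have "smooth_real (\<lambda>t. smooth_step (real m * t + (- real m * a $ i)) * smooth_step ((- real m) * t + real m * b $ i))"
      by (intro smooth_real_mult smooth_real_affine smooth_step_smooth)
    then show ?thesis by (simp add: algebra_simps)
  qed
  show "a $ i \<le> t \<and> t \<le> b $ i"
    if "smooth_step (real m * (t - a $ i)) * smooth_step (real m * (b $ i - t)) \<noteq> 0" for i t
  proof -
    have "real m * (t - a $ i) > 0" "real m * (b $ i - t) > 0"
      using that smooth_step_0 by (metis mult_zero_left mult_zero_right not_le)+
    then show ?thesis by (simp add: zero_less_mult_iff)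
  qed
qed

lemma box_cutoff_range: "0 \<le> box_cutoff a b m x" "box_cutoff a b m x \<le> 1"
  unfolding box_cutoff_def coord_prod_def
  by (auto intro!: prod_nonneg prod_le_1 mult_nonneg_nonneg mult_le_one simp: smooth_step_ge_0 smooth_step_le_1)

lemma box_cutoff_outside: "x \<notin> box a b \<Longrightarrow> box_cutoff a b m x = 0"
proof -
  assume "x \<notin> box a b"
  then obtain i where "x $ i \<le> a $ i \<or> x $ i \<ge> b $ i" by (auto simp: mem_box_cart not_less)
  then have "real m * (x $ i - a $ i) \<le> 0 \<or> real m * (b $ i - x $ i) \<le> 0"
    by (auto simp: mult_le_0_iff)
  then have "smooth_step (real m * (x $ i - a $ i)) * smooth_step (real m * (b $ i - x $ i)) = 0"
    using smooth_step_0 by auto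
  then show ?thesis
    unfolding box_cutoff_def coord_prod_def by (intro prod_zero) auto
qed

lemma box_cutoff_inside:
  assumes "x \<in> box a b" shows "eventually (\<lambda>m. box_cutoff a b m x = 1) sequentially"
proof -
  have *: "eventually (\<lambda>m. smooth_step (real m * c) = 1) sequentially" if c: "c > 0" for c :: real
  proof -
    obtain N :: nat where N: "1 / c < real N" using reals_Archimedean2 by blast
    have "smooth_step (real m * c) = 1" if "m \<ge> N" for m
    proof -
      have "1 / c \<le> real m" using N that by linarith
      then have "1 \<le> real m * c" using c by (simp add: divide_le_eq)
      then show ?thesis by (rule smooth_step_1)
    qed
    then show ?thesis unfolding eventually_sequentially by blast
  qed
  have "eventually (\<lambda>m. \<forall>i. smooth_step (real m * (x $ i - a $ i)) = 1 \<and> smooth_step (real m * (b $ i - x $ i)) = 1) sequentially"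
    using assms by (intro eventually_all_finite eventually_conj *) (auto simp: mem_box_cart)
  then show ?thesis
    by eventually_elim (simp add: box_cutoff_def coord_prod_def)
qed

text \<open>
  The cutoffs of the box converge to its indicator, and they are dominated by that of the closed box, on which
  \<open>g\<close> is integrable.
\<close>

lemma integral_box_eq_0:
  fixes a b :: "real^'n::finite"
  assumes \<Omega>: "open \<Omega>" and g: "locally_integrable \<Omega> g"
    and 0: "\<And>\<phi>. \<phi> \<in> test_functions \<Omega> \<Longrightarrow> (LINT x|lebesgue_on \<Omega>. g x * \<phi> x) = 0"
    and ab: "cbox a b \<subseteq> \<Omega>"
  shows "(LINT x|lebesgue. indicator (box a b) x * g x) = 0"
proof -
  have "integrable (lebesgue_on (cbox a b)) g" using g ab by (auto simp: locally_integrable_def)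
  then have i: "integrable lebesgue (\<lambda>x. indicator (cbox a b) x *\<^sub>R g x)"
    by (subst (asm) integrable_restrict_space) auto
  note im = borel_measurable_integrable[OF i]
  have eq: "indicator (box a b) x * g x = indicator (box a b) x * (indicator (cbox a b) x *\<^sub>R g x)" for x
    using box_subset_cbox[of a b] by (auto simp: indicator_def)
  have cm: "box_cutoff a b m \<in> borel_measurable lebesgue" for m
    using test_function_borel[OF box_cutoff_test_function[OF ab], of "[]"] by (auto intro: measurable_completion)
  have eqm: "g x * box_cutoff a b m x = box_cutoff a b m x * (indicator (cbox a b) x *\<^sub>R g x)" for m x
    using box_cutoff_outside[of x a b m] box_subset_cbox[of a b] by (auto simp: indicator_def)
  have z: "(LINT x|lebesgue. g x * box_cutoff a b m x) = 0" for m
  proof -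
    have "(LINT x|lebesgue. g x * box_cutoff a b m x) = (LINT x|lebesgue. indicator \<Omega> x *\<^sub>R (g x * box_cutoff a b m x))"
      using ab box_cutoff_outside[of _ a b m] box_subset_cbox[of a b]
      by (intro Bochner_Integration.integral_cong) (auto simp: indicator_def)
    also have "\<dots> = (LINT x|lebesgue_on \<Omega>. g x * box_cutoff a b m x)"
      using \<Omega> by (intro integral_restrict_space[symmetric]) auto
    finally show ?thesis using 0[OF box_cutoff_test_function[OF ab]] by simp
  qed
  have "(\<lambda>m. LINT x|lebesgue. g x * box_cutoff a b m x) \<longlonglongrightarrow> (LINT x|lebesgue. indicator (box a b) x * g x)"
  proof (rule integral_dominated_convergence[OF _ _ integrable_norm[OF i]])
    show "(\<lambda>x. indicator (box a b) x * g x) \<in> borel_measurable lebesgue"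
      unfolding eq by (intro borel_measurable_times borel_measurable_indicator im) auto
    show "(\<lambda>x. g x * box_cutoff a b m x) \<in> borel_measurable lebesgue" for m
      unfolding eqm by (intro borel_measurable_times cm im)
    have "norm (g x * box_cutoff a b m x) \<le> norm (indicator (cbox a b) x *\<^sub>R g x)" for x m
      unfolding eqm norm_mult using box_cutoff_range[of a b m x]
      by (intro mult_left_le_one_le) auto
    then show "AE x in lebesgue. norm (g x * box_cutoff a b m x) \<le> norm (indicator (cbox a b) x *\<^sub>R g x)" for m
      by (intro AE_I2)
    have "(\<lambda>m. g x * box_cutoff a b m x) \<longlonglongrightarrow> indicator (box a b) x * g x" for x
    proof (cases "x \<in> box a b")
      case True
      show ?thesis
        by (rule tendsto_eventually, rule eventually_mono[OF box_cutoff_inside[OF True]]) (use True in simp)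
    qed (simp add: box_cutoff_outside)
    then show "AE x in lebesgue. (\<lambda>m. g x * box_cutoff a b m x) \<longlonglongrightarrow> indicator (box a b) x * g x"
      by (intro AE_I2)
  qed
  then show ?thesis unfolding z by (simp add: LIMSEQ_const_iff)
qed

text \<open>
  Boxes generate the Borel sets and are closed under intersection, so integrals over boxes determine
  integrals over all Borel sets, and these determine the function almost everywhere.
\<close>

lemma AE_eq_0_of_box_integrals:
  fixes f :: "'a::euclidean_space \<Rightarrow> real"
  assumes f: "integrable lebesgue f"
    and box: "\<And>a b. (LINT x|lebesgue. indicator (box a b) x * f x) = 0"
    and total: "(LINT x|lebesgue. f x) = 0"
  shows "AE x in lebesgue. f x = 0"
proof -
  have ind: "integrable lebesgue (\<lambda>x. indicator A x * f x)" if "A \<in> sets borel" for A :: "'a set"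
    using integrable_mult_indicator[OF _ f, of A] that by simp
  have all0: "(LINT x|lebesgue. indicator A x * f x) = 0" if A: "A \<in> sets borel" for A :: "'a set"
  proof -
    have "Int_stable (range (\<lambda>(a, b). box a b :: 'a set))"
      by (auto simp: Int_stable_def box_Int_box)
    moreover have "range (\<lambda>(a, b). box a b :: 'a set) \<subseteq> Pow UNIV" by auto
    moreover have "A \<in> sigma_sets UNIV (range (\<lambda>(a, b). box a b))"
      using A unfolding borel_eq_box by simp
    ultimately show ?thesis
    proof (induction rule: sigma_sets_induct_disjoint)
      case (basic A) then show ?case using box by auto
    next
      case empty then show ?case by simp
    next
      case (compl A)
      have A: "A \<in> sets borel" using compl(1) unfolding borel_eq_box by simp
      have "(LINT x|lebesgue. indicator (UNIV - A) x * f x) = (LINT x|lebesgue. f x - indicator A x * f x)"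
        by (intro Bochner_Integration.integral_cong) (auto simp: indicator_def)
      also have "\<dots> = (LINT x|lebesgue. f x) - (LINT x|lebesgue. indicator A x * f x)"
        using f ind[OF A] by (rule Bochner_Integration.integral_diff)
      finally show ?case using compl(2) total by simp
    next
      case (union A)
      have A: "A i \<in> sets borel" for i using union(2) unfolding borel_eq_box by auto
      have "(LINT x:(\<Union>i. A i)|lebesgue. f x) = (\<Sum>i. (LINT x:(A i)|lebesgue. f x))"
      proof (rule lebesgue_integral_countable_add)
        show "A i \<in> sets lebesgue" for i using A by simp
        show "A i \<inter> A j = {}" if "i \<noteq> j" for i j
          using union(1) that unfolding disjoint_family_on_def by auto
        have "(\<Union>i. A i) \<in> sets borel" using A by auto
        then show "set_integrable lebesgue (\<Union>i. A i) f"
          unfolding set_integrable_def using ind by simp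
      qed
      then show ?case using union(3) by (simp add: set_lebesgue_integral_def)
    qed
  qed
  obtain f' where f': "f' \<in> borel_measurable lborel" and ae0: "AE x in lborel. f x = f' x"
    using completion_ex_borel_measurable_real[OF borel_measurable_integrable[OF f]] by blast
  have ae: "AE x in lebesgue. f x = f' x" using ae0 by (rule AE_completion)
  have f'm: "f' \<in> borel_measurable lebesgue" using f' by (rule measurable_completion)
  have "integrable lebesgue f'" by (rule integrable_cong_AE_imp[OF f f'm ae])
  then have f'i: "integrable lborel f'" using f' integrable_completion by blast
  have "AE x in lborel. f' x = 0"
  proof (rule sigma_finite_measure.density_zero[OF sigma_finite_lborel f'i])
    fix A :: "'a set" assume A: "A \<in> sets lborel"
    have "(LINT x:A|lborel. f' x) = (LINT x|lborel. indicator A x * f' x)"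
      by (simp add: set_lebesgue_integral_def)
    also have "\<dots> = (LINT x|lebesgue. indicator A x * f' x)"
      using A f' by (intro integral_completion[symmetric] borel_measurable_times borel_measurable_indicator) auto
    also have "\<dots> = (LINT x|lebesgue. indicator A x * f x)"
    proof (rule integral_cong_AE)
      show "(\<lambda>x. indicator A x * f' x) \<in> borel_measurable lebesgue"
        using A f'm by (intro borel_measurable_times borel_measurable_indicator) auto
      show "(\<lambda>x. indicator A x * f x) \<in> borel_measurable lebesgue"
        using A f by (intro borel_measurable_times borel_measurable_indicator) auto
      show "AE x in lebesgue. indicator A x * f' x = indicator A x * f x"
        using ae by eventually_elim simp
    qed
    finally show "(LINT x:A|lborel. f' x) = 0" using all0 A by simp
  qed
  then have "AE x in lebesgue. f' x = 0" by (rule AE_completion)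
  with ae show ?thesis by eventually_elim simp
qed

text \<open>
  The fundamental lemma of the calculus of variations. It is applied to the difference of two weak
  derivatives, and holds on unbounded sets as well because the open set is a countable union of boxes.
\<close>

lemma fundamental_lemma:
  fixes \<Omega> :: "(real^'n::finite) set"
  assumes \<Omega>: "open \<Omega>" and g: "locally_integrable \<Omega> g"
    and 0: "\<And>\<phi>. \<phi> \<in> test_functions \<Omega> \<Longrightarrow> (LINT x|lebesgue_on \<Omega>. g x * \<phi> x) = 0"
  shows "AE x in lebesgue_on \<Omega>. g x = 0"
proof -
  have cb: "AE x in lebesgue. x \<in> cbox c d \<longrightarrow> g x = 0" if cd: "cbox c d \<subseteq> \<Omega>" for c d
  proof -
    let ?f = "\<lambda>x. indicator (box c d) x * g x"
    have "integrable (lebesgue_on (cbox c d)) g" using g cd by (auto simp: locally_integrable_def)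
    then have i: "integrable lebesgue (\<lambda>x. indicator (cbox c d) x *\<^sub>R g x)"
      by (subst (asm) integrable_restrict_space) auto
    have fi: "integrable lebesgue ?f"
    proof -
      have "integrable lebesgue (\<lambda>x. indicator (box c d) x *\<^sub>R (indicator (cbox c d) x *\<^sub>R g x))"
        by (rule integrable_mult_indicator[OF _ i]) simp
      moreover have "(\<lambda>x. indicator (box c d) x *\<^sub>R (indicator (cbox c d) x *\<^sub>R g x)) = ?f"
        using box_subset_cbox[of c d] by (auto simp: indicator_def fun_eq_iff)
      ultimately show ?thesis by metis
    qed
    have "AE x in lebesgue. ?f x = 0"
    proof (rule AE_eq_0_of_box_integrals[OF fi])
      show "(LINT x|lebesgue. ?f x) = 0" by (rule integral_box_eq_0[OF \<Omega> g 0 cd])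
      fix a b :: "real^'n"
      obtain p q :: "real^'n" where pq: "box a b \<inter> box c d = box p q" unfolding box_Int_box by blast
      have "(LINT x|lebesgue. indicator (box a b) x * ?f x) = (LINT x|lebesgue. indicator (box p q) x * g x)"
        unfolding pq[symmetric] by (intro Bochner_Integration.integral_cong) (auto simp: indicator_def)
      also have "\<dots> = 0"
      proof (cases "box p q = {}")
        case False
        have "cbox p q = closure (box p q)" using False by (rule closure_box[symmetric])
        also have "\<dots> \<subseteq> cbox c d"
          using pq box_subset_cbox[of c d] by (intro closure_minimal) auto
        finally show ?thesis using integral_box_eq_0[OF \<Omega> g 0] cd by auto
      qed simp
      finally show "(LINT x|lebesgue. indicator (box a b) x * ?f x) = 0" .
    qed
    moreover have "AE x in lebesgue. x \<notin> cbox c d - box c d"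
      using negligible_frontier_interval[of c d] by (intro AE_not_in) (simp add: negligible_iff_null_sets)
    ultimately show ?thesis by eventually_elim (auto simp: indicator_def split: if_splits)
  qed
  obtain \<D> where D: "countable \<D>" "\<D> \<subseteq> Pow \<Omega>" "\<And>X. X \<in> \<D> \<Longrightarrow> \<exists>a b. X = cbox a b" "\<Union>\<D> = \<Omega>"
    using open_countable_Union_open_cbox[OF \<Omega>] by metis
  have "AE x in lebesgue. \<forall>X\<in>\<D>. x \<in> X \<longrightarrow> g x = 0"
  proof (rule AE_ball_countable'[OF _ D(1)])
    fix X assume "X \<in> \<D>"
    then obtain a b where "X = cbox a b" "cbox a b \<subseteq> \<Omega>" using D by blast
    then show "AE x in lebesgue. x \<in> X \<longrightarrow> g x = 0" using cb by simp
  qed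
  then have "AE x in lebesgue. x \<in> \<Omega> \<longrightarrow> g x = 0"
    by eventually_elim (use D(4) in blast)
  then show ?thesis using \<Omega> by (subst AE_restrict_space_iff) auto
qed

section \<open>Test functions in Sobolev spaces\<close>

lemma AE_lebesgue_on_iff:
  "open \<Omega> \<Longrightarrow> (AE x in lebesgue_on \<Omega>. P x) \<longleftrightarrow> (AE x in lebesgue. x \<in> \<Omega> \<longrightarrow> P x)"
  by (subst AE_restrict_space_iff) auto

lemma locally_integrable_diff:
  "locally_integrable \<Omega> f \<Longrightarrow> locally_integrable \<Omega> g \<Longrightarrow> locally_integrable \<Omega> (\<lambda>x. f x - g x)"
  by (auto simp: locally_integrable_def)

lemma locally_integrable_add:
  "locally_integrable \<Omega> f \<Longrightarrow> locally_integrable \<Omega> g \<Longrightarrow> locally_integrable \<Omega> (\<lambda>x. f x + g x)"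
  by (auto simp: locally_integrable_def)

lemma has_weak_deriv_unique:
  assumes \<Omega>: "open \<Omega>" and g: "has_weak_deriv \<Omega> js u g" and h: "has_weak_deriv \<Omega> js u h"
  shows "AE x in lebesgue_on \<Omega>. g x = h x"
proof -
  have gl: "locally_integrable \<Omega> g" and hl: "locally_integrable \<Omega> h"
    using g h by (auto simp: has_weak_deriv_def)
  have "AE x in lebesgue_on \<Omega>. g x - h x = 0"
  proof (rule fundamental_lemma[OF \<Omega> locally_integrable_diff[OF gl hl]])
    fix \<phi> assume \<phi>: "\<phi> \<in> test_functions \<Omega>"
    have "(LINT x|lebesgue_on \<Omega>. u x * iter_partial js \<phi> x) = (-1) ^ length js * (LINT x|lebesgue_on \<Omega>. g x * \<phi> x)"
      using g \<phi> unfolding has_weak_deriv_def by blast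
    moreover have "(LINT x|lebesgue_on \<Omega>. u x * iter_partial js \<phi> x) = (-1) ^ length js * (LINT x|lebesgue_on \<Omega>. h x * \<phi> x)"
      using h \<phi> unfolding has_weak_deriv_def by blast
    ultimately have "(LINT x|lebesgue_on \<Omega>. g x * \<phi> x) = (LINT x|lebesgue_on \<Omega>. h x * \<phi> x)" by simp
    then show "(LINT x|lebesgue_on \<Omega>. (g x - h x) * \<phi> x) = 0"
      using integrable_mult_test_function[OF gl \<Omega> \<phi>] integrable_mult_test_function[OF hl \<Omega> \<phi>]
      by (simp add: left_diff_distrib)
  qed
  then show ?thesis by eventually_elim simp
qed

text \<open>
  This is how the chosen representative is computed: any explicit weak derivative agrees with it.
\<close>

lemma weak_deriv_eq:
  assumes "open \<Omega>" "has_weak_deriv \<Omega> js u g"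
  shows "AE x in lebesgue_on \<Omega>. weak_deriv \<Omega> js u x = g x"
proof -
  have "has_weak_deriv \<Omega> js u (weak_deriv \<Omega> js u)"
    unfolding weak_deriv_def using assms(2) by (rule someI[of "has_weak_deriv \<Omega> js u"])
  then show ?thesis using has_weak_deriv_unique[OF assms(1) _ assms(2)] by blast
qed

lemma has_weak_deriv_add:
  assumes \<Omega>: "open \<Omega>" and g: "has_weak_deriv \<Omega> js u g" and h: "has_weak_deriv \<Omega> js v h"
  shows "has_weak_deriv \<Omega> js (\<lambda>x. u x + v x) (\<lambda>x. g x + h x)"
proof -
  have l: "locally_integrable \<Omega> g" "locally_integrable \<Omega> h" "locally_integrable \<Omega> u" "locally_integrable \<Omega> v"
    using g h by (auto simp: has_weak_deriv_def)
  have "(LINT x|lebesgue_on \<Omega>. (u x + v x) * iter_partial js \<phi> x) =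
      (- 1) ^ length js * (LINT x|lebesgue_on \<Omega>. (g x + h x) * \<phi> x)"
    if \<phi>: "\<phi> \<in> test_functions \<Omega>" for \<phi>
  proof -
    note i = integrable_mult_test_function[OF _ \<Omega> \<phi>]
      integrable_mult_test_function[OF _ \<Omega> test_function_iter_partial[OF \<phi>]]
    have "(LINT x|lebesgue_on \<Omega>. (u x + v x) * iter_partial js \<phi> x) =
       (LINT x|lebesgue_on \<Omega>. u x * iter_partial js \<phi> x) + (LINT x|lebesgue_on \<Omega>. v x * iter_partial js \<phi> x)"
      using i l by (simp add: distrib_right)
    also have "\<dots> = (- 1) ^ length js * ((LINT x|lebesgue_on \<Omega>. g x * \<phi> x) + (LINT x|lebesgue_on \<Omega>. h x * \<phi> x))"
      using g h \<phi> unfolding has_weak_deriv_def by (simp add: distrib_left)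
    also have "(LINT x|lebesgue_on \<Omega>. g x * \<phi> x) + (LINT x|lebesgue_on \<Omega>. h x * \<phi> x) = (LINT x|lebesgue_on \<Omega>. (g x + h x) * \<phi> x)"
      using i l by (simp add: distrib_right)
    finally show ?thesis .
  qed
  then show ?thesis using l by (simp add: has_weak_deriv_def locally_integrable_add)
qed

lemma square_integrable_add:
  assumes "square_integrable \<Omega> f" "square_integrable \<Omega> g"
  shows "square_integrable \<Omega> (\<lambda>x. f x + g x)"
proof -
  have m: "f \<in> borel_measurable (lebesgue_on \<Omega>)" "g \<in> borel_measurable (lebesgue_on \<Omega>)"
    and i: "integrable (lebesgue_on \<Omega>) (\<lambda>x. (f x)\<^sup>2)" "integrable (lebesgue_on \<Omega>) (\<lambda>x. (g x)\<^sup>2)"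
    using assms by (auto simp: square_integrable_def)
  have "integrable (lebesgue_on \<Omega>) (\<lambda>x. (f x + g x)\<^sup>2)"
  proof (rule Bochner_Integration.integrable_bound)
    show "integrable (lebesgue_on \<Omega>) (\<lambda>x. 2 * (f x)\<^sup>2 + 2 * (g x)\<^sup>2)"
      by (intro Bochner_Integration.integrable_add integrable_mult_right i)
    have "norm ((f x + g x)\<^sup>2) \<le> norm (2 * (f x)\<^sup>2 + 2 * (g x)\<^sup>2)" for x
      using zero_le_power2[of "f x - g x"] zero_le_power2[of "f x + g x"] by (simp add: power2_sum power2_diff)
    then show "AE x in lebesgue_on \<Omega>. norm ((f x + g x)\<^sup>2) \<le> norm (2 * (f x)\<^sup>2 + 2 * (g x)\<^sup>2)" by (intro AE_I2)
  qed (intro borel_measurable_power borel_measurable_add m)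
  then show ?thesis using m by (auto simp: square_integrable_def intro: borel_measurable_add)
qed

lemma H2_add:
  assumes \<Omega>: "open \<Omega>" and u: "u \<in> H2 \<Omega>" and v: "v \<in> H2 \<Omega>"
  shows "(\<lambda>x. u x + v x) \<in> H2 \<Omega>"
proof -
  have "\<exists>g. square_integrable \<Omega> g \<and> has_weak_deriv \<Omega> js (\<lambda>x. u x + v x) g" if js: "length js \<le> 2" for js
  proof -
    obtain g h where "square_integrable \<Omega> g" "has_weak_deriv \<Omega> js u g" "square_integrable \<Omega> h" "has_weak_deriv \<Omega> js v h"
      using u v js unfolding H2_def by blast
    then show ?thesis
      using has_weak_deriv_add[OF \<Omega>] square_integrable_add by blast
  qed
  then show ?thesis using u v by (simp add: H2_def square_integrable_add)
qed

lemma locally_integrable_bounded: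
  fixes f :: "real^'n::finite \<Rightarrow> real"
  assumes [measurable]: "f \<in> borel_measurable borel" and bd: "\<And>M. \<exists>B. \<forall>x. norm x \<le> M \<longrightarrow> \<bar>f x\<bar> \<le> B"
  shows "locally_integrable \<Omega> f"
  unfolding locally_integrable_def
proof (intro allI impI)
  fix K assume "compact K \<and> K \<subseteq> \<Omega>"
  then have K: "compact K" by simp
  then have Kb: "K \<in> sets borel" by (simp add: borel_closed compact_imp_closed)
  obtain M where M: "\<And>x. x \<in> K \<Longrightarrow> norm x \<le> M"
    using compact_imp_bounded[OF K] unfolding bounded_iff by blast
  obtain B where B: "\<And>x. norm x \<le> M \<Longrightarrow> \<bar>f x\<bar> \<le> B" using bd by blast
  have i: "integrable lborel (\<lambda>x. indicator K x *\<^sub>R f x)"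
  proof (rule integrable_bounded_support[where M=M])
    show "(\<lambda>x. indicator K x *\<^sub>R f x) \<in> borel_measurable borel"
      using Kb by measurable
    show "\<bar>indicator K x *\<^sub>R f x\<bar> \<le> \<bar>B\<bar>" for x
      using B[OF M[of x]] by (auto simp: indicator_def)
    show "indicator K x *\<^sub>R f x = 0" if "norm x > M" for x
      using M[of x] that by (auto simp: indicator_def)
  qed
  have "integrable lebesgue (\<lambda>x. indicator K x *\<^sub>R f x)"
    using i integrable_completion[OF borel_measurable_integrable[OF i]] by blast
  then show "integrable (lebesgue_on K) f"
    using Kb by (subst integrable_restrict_space) auto
qed

lemma square_integrable_bounded:
  fixes f :: "real^'n::finite \<Rightarrow> real"
  assumes m: "f \<in> borel_measurable borel" and B: "\<And>x. \<bar>f x\<bar> \<le> B" and \<Omega>: "open \<Omega>" "bounded \<Omega>"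
  shows "square_integrable \<Omega> f"
proof -
  have \<Omega>b: "\<Omega> \<in> sets borel" using \<Omega> by simp
  obtain M where M: "\<And>x. x \<in> \<Omega> \<Longrightarrow> norm x \<le> M"
    using \<Omega>(2) unfolding bounded_iff by blast
  have i: "integrable lborel (\<lambda>x. indicator \<Omega> x *\<^sub>R (f x)\<^sup>2)"
  proof (rule integrable_bounded_support[where M=M])
    show "(\<lambda>x. indicator \<Omega> x *\<^sub>R (f x)\<^sup>2) \<in> borel_measurable borel"
      using \<Omega>b m by measurable
    show "\<bar>indicator \<Omega> x *\<^sub>R (f x)\<^sup>2\<bar> \<le> B\<^sup>2" for x
      using abs_le_square_iff[of "f x" B] B[of x] by (auto simp: indicator_def)
    show "indicator \<Omega> x *\<^sub>R (f x)\<^sup>2 = 0" if "norm x > M" for x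
      using M[of x] that by (auto simp: indicator_def)
  qed
  have "integrable lebesgue (\<lambda>x. indicator \<Omega> x *\<^sub>R (f x)\<^sup>2)"
    using i integrable_completion[OF borel_measurable_integrable[OF i]] by blast
  then have "integrable (lebesgue_on \<Omega>) (\<lambda>x. (f x)\<^sup>2)"
    using \<Omega>b by (subst integrable_restrict_space) auto
  moreover have "f \<in> borel_measurable (lebesgue_on \<Omega>)"
    using m by (intro measurable_restrict_space1 measurable_completion) simp
  ultimately show ?thesis by (simp add: square_integrable_def)
qed

text \<open>
  Moving the derivatives one at a time onto \<open>\<phi>\<close> takes the leftmost one off \<open>\<psi>\<close> first and
  applies it to \<open>\<phi>\<close> first, which reverses their order.
\<close>

lemma integral_test_function_derivs:
  fixes \<phi> \<psi> :: "real^'n::finite \<Rightarrow> real"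
  assumes \<psi>: "\<psi> \<in> test_functions \<Omega>"
  shows "\<phi> \<in> test_functions \<Omega> \<Longrightarrow>
    (LINT x|lborel. \<phi> x * iter_partial js \<psi> x) = (-1) ^ length js * (LINT x|lborel. iter_partial (rev js) \<phi> x * \<psi> x)"
proof (induction js arbitrary: \<phi>)
  case (Cons i js)
  note \<phi> = Cons.prems
  have d: "partial_deriv i \<phi> \<in> test_functions \<Omega>" using test_function_iter_partial[OF \<phi>, of "[i]"] by simp
  obtain B where B: "\<And>x. \<bar>partial_deriv i \<phi> x\<bar> \<le> B" using test_function_bounded[OF \<phi>, of "[i]"] by auto
  have "(LINT x|lborel. \<phi> x * partial_deriv i (iter_partial js \<psi>) x) = - (LINT x|lborel. partial_deriv i \<phi> x * iter_partial js \<psi> x)"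
  proof (rule integral_by_parts_test_function[where N="{}" and \<Omega>=\<Omega>])
    show "continuous_on UNIV \<phi>" using test_function_continuous[OF \<phi>, of UNIV "[]"] by simp
    show "((\<lambda>t. \<phi> (x + t *\<^sub>R axis i 1)) has_real_derivative partial_deriv i \<phi> x) (at 0)" for x
      by (rule DERIV_along_axis) (use test_function_differentiable[OF \<phi>, of "[]"] in simp)
    show "\<exists>B. \<forall>x. norm x \<le> M \<longrightarrow> \<bar>partial_deriv i \<phi> x\<bar> \<le> B" for M using B by blast
    show "partial_deriv i \<phi> \<in> borel_measurable borel" using test_function_borel[OF \<phi>, of "[i]"] by simp
    show "iter_partial js \<psi> \<in> test_functions \<Omega>" by (rule test_function_iter_partial[OF \<psi>])
  qed auto
  also have "\<dots> = (-1) ^ length (i # js) * (LINT x|lborel. iter_partial (rev (i # js)) \<phi> x * \<psi> x)"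
    using Cons.IH[OF d] by (simp add: iter_partial_append)
  finally show ?case by simp
qed simp

lemma test_function_locally_integrable:
  assumes "\<phi> \<in> test_functions \<Omega>" shows "locally_integrable \<Omega>' (iter_partial js \<phi>)"
proof -
  obtain B where "\<And>x. \<bar>iter_partial js \<phi> x\<bar> \<le> B" using test_function_bounded[OF assms] by blast
  then show ?thesis by (intro locally_integrable_bounded test_function_borel[OF assms]) blast
qed

lemma test_function_has_weak_deriv:
  assumes \<Omega>: "open \<Omega>" and \<phi>: "\<phi> \<in> test_functions \<Omega>"
  shows "has_weak_deriv \<Omega> js \<phi> (iter_partial (rev js) \<phi>)"
proof -
  have "(LINT x|lebesgue_on \<Omega>. \<phi> x * iter_partial js \<psi> x) =
      (- 1) ^ length js * (LINT x|lebesgue_on \<Omega>. iter_partial (rev js) \<phi> x * \<psi> x)"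
    if \<psi>: "\<psi> \<in> test_functions \<Omega>" for \<psi>
  proof -
    have m: "\<phi> \<in> borel_measurable borel" "\<psi> \<in> borel_measurable borel"
      using test_function_borel[OF \<phi>, of "[]"] test_function_borel[OF \<psi>, of "[]"] by auto
    have z: "\<psi> x = 0" "\<phi> x = 0" if "x \<notin> \<Omega>" for x
      using test_function_outside[OF \<psi> that, of "[]"] test_function_outside[OF \<phi> that, of "[]"] by auto
    have "(LINT x|lebesgue_on \<Omega>. \<phi> x * iter_partial js \<psi> x) = (LINT x|lborel. \<phi> x * iter_partial js \<psi> x)"
      using \<Omega> by (intro integral_lebesgue_on_borel borel_measurable_times m test_function_borel[OF \<psi>]) (auto simp: z)
    moreover have "(LINT x|lebesgue_on \<Omega>. iter_partial (rev js) \<phi> x * \<psi> x) = (LINT x|lborel. iter_partial (rev js) \<phi> x * \<psi> x)"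
      using \<Omega> by (intro integral_lebesgue_on_borel borel_measurable_times m test_function_borel[OF \<phi>]) (auto simp: z)
    ultimately show ?thesis using integral_test_function_derivs[OF \<psi> \<phi>] by simp
  qed
  then show ?thesis
    using test_function_locally_integrable[OF \<phi>, of \<Omega> "[]"] test_function_locally_integrable[OF \<phi>]
    by (simp add: has_weak_deriv_def)
qed

lemma test_function_H2:
  assumes \<Omega>: "open \<Omega>" "bounded \<Omega>" and \<phi>: "\<phi> \<in> test_functions \<Omega>"
  shows "\<phi> \<in> H2 \<Omega>"
proof -
  have sq: "square_integrable \<Omega> (iter_partial js \<phi>)" for js
  proof -
    obtain B where B: "\<And>x. \<bar>iter_partial js \<phi> x\<bar> \<le> B" using test_function_bounded[OF \<phi>] by blast
    then show ?thesis by (rule square_integrable_bounded[OF test_function_borel[OF \<phi>] _ \<Omega>])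
  qed
  then show ?thesis
    using sq[of "[]"] test_function_has_weak_deriv[OF \<Omega>(1) \<phi>] unfolding H2_def by auto
qed

text \<open>
  The norm of zero is an integral of arbitrarily chosen weak derivatives, so even this needs uniqueness.
\<close>

lemma H2_norm_0: assumes \<Omega>: "open \<Omega>" shows "H2_norm \<Omega> (\<lambda>x. 0) = 0"
proof -
  have "(LINT x|lebesgue_on \<Omega>. (weak_deriv \<Omega> js (\<lambda>x. 0) x)\<^sup>2) = 0" for js
  proof -
    have "has_weak_deriv \<Omega> js (\<lambda>x. 0) (\<lambda>x. 0)"
      by (auto simp: has_weak_deriv_def locally_integrable_def)
    then have "AE x in lebesgue_on \<Omega>. (weak_deriv \<Omega> js (\<lambda>x. 0) x)\<^sup>2 = 0"
      using weak_deriv_eq[OF \<Omega>] by fastforce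
    then show ?thesis by (rule integral_eq_zero_AE)
  qed
  then show ?thesis by (simp add: H2_norm_def)
qed

lemma test_function_H2_0:
  assumes \<Omega>: "open \<Omega>" "bounded \<Omega>" and \<phi>: "\<phi> \<in> test_functions \<Omega>"
  shows "\<phi> \<in> H2_0 \<Omega>"
  using test_function_H2[OF assms] \<phi> H2_norm_0[OF \<Omega>(1)] unfolding H2_0_def by force

section \<open>The weak Laplacian of the two-phase function\<close>

definition phase_profile :: "real \<Rightarrow> real \<Rightarrow> real \<Rightarrow> real" where
  "phase_profile d1 d2 t = (if t \<ge> 0 then d1 * (t\<^sup>2 / 2) else d2 * (t\<^sup>2 / 2))"

definition phase_slope :: "real \<Rightarrow> real \<Rightarrow> real \<Rightarrow> real" where
  "phase_slope d1 d2 t = (if t \<ge> 0 then d1 * t else d2 * t)"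

definition phase_curvature :: "real \<Rightarrow> real \<Rightarrow> real \<Rightarrow> real" where
  "phase_curvature d1 d2 t = (if t \<ge> 0 then d1 else d2)"

lemma two_phase_profile: "two_phase k d1 d2 x = phase_profile d1 d2 (x $ k)"
  by (simp add: two_phase_def phase_profile_def)

lemma DERIV_piecewise:
  assumes "t \<noteq> 0" "(f has_real_derivative f') (at t)" "(g has_real_derivative g') (at t)"
  shows "((\<lambda>t. if t \<ge> 0 then f t else g t) has_real_derivative (if t \<ge> 0 then f' else g')) (at (t::real))"
proof (cases "t > 0")
  case True
  have "((\<lambda>t. if t \<ge> 0 then f t else g t) has_real_derivative f') (at t)"
    by (rule has_field_derivative_transform_within_open[OF assms(2), of "{0<..}"]) (use True in auto)
  then show ?thesis using True by simp
next
  case False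
  then have *: "t < 0" using assms(1) by simp
  have "((\<lambda>t. if t \<ge> 0 then f t else g t) has_real_derivative g') (at t)"
    by (rule has_field_derivative_transform_within_open[OF assms(3), of "{..<0}"]) (use * in auto)
  then show ?thesis using * by simp
qed

lemma DERIV_phase_slope:
  "t \<noteq> 0 \<Longrightarrow> (phase_slope d1 d2 has_real_derivative phase_curvature d1 d2 t) (at t)"
  unfolding phase_slope_def[abs_def] phase_curvature_def
  by (rule DERIV_piecewise) (auto intro!: derivative_eq_intros)

text \<open>
  The two parabolas join at the origin with equal value and slope; only the second derivative jumps.
\<close>

lemma DERIV_phase_profile:
  "(phase_profile d1 d2 has_real_derivative phase_slope d1 d2 t) (at t)"
proof (cases "t = 0")
  case False
  show ?thesis
    unfolding phase_profile_def[abs_def] phase_slope_def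
    by (rule DERIV_piecewise[OF False]) (auto intro!: derivative_eq_intros)
next
  case True
  have "((\<lambda>h. phase_profile d1 d2 h / h) \<longlongrightarrow> 0) (at 0)"
  proof (rule Lim_null_comparison)
    have "norm (phase_profile d1 d2 h / h) \<le> (\<bar>d1\<bar> + \<bar>d2\<bar>) * \<bar>h\<bar>" for h
    proof -
      have "\<bar>d1 * h\<bar> / 2 \<le> (\<bar>d1\<bar> + \<bar>d2\<bar>) * \<bar>h\<bar>" "\<bar>d2 * h\<bar> / 2 \<le> (\<bar>d1\<bar> + \<bar>d2\<bar>) * \<bar>h\<bar>"
        by (auto simp: abs_mult distrib_right intro: add_increasing add_increasing2)
      then show ?thesis
        by (auto simp: phase_profile_def power2_eq_square abs_mult)
    qed
    then show "eventually (\<lambda>h. norm (phase_profile d1 d2 h / h) \<le> (\<bar>d1\<bar> + \<bar>d2\<bar>) * \<bar>h\<bar>) (at 0)"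
      by simp
    show "((\<lambda>h. (\<bar>d1\<bar> + \<bar>d2\<bar>) * \<bar>h\<bar>) \<longlongrightarrow> 0) (at (0::real))"
      by (auto intro!: tendsto_eq_intros)
  qed
  then show ?thesis using True by (simp add: DERIV_def phase_profile_def phase_slope_def)
qed

lemma phase_bounds:
  "\<bar>phase_slope d1 d2 t\<bar> \<le> (\<bar>d1\<bar> + \<bar>d2\<bar>) * \<bar>t\<bar>"
  "\<bar>phase_curvature d1 d2 t\<bar> \<le> \<bar>d1\<bar> + \<bar>d2\<bar>"
  "\<bar>phase_profile d1 d2 t\<bar> \<le> (\<bar>d1\<bar> + \<bar>d2\<bar>) * t\<^sup>2"
proof -
  have "\<bar>d1\<bar> * \<bar>t\<bar> \<ge> 0" "\<bar>d2\<bar> * \<bar>t\<bar> \<ge> 0" "\<bar>d1\<bar> * t\<^sup>2 \<ge> 0" "\<bar>d2\<bar> * t\<^sup>2 \<ge> 0" by auto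
  then show "\<bar>phase_slope d1 d2 t\<bar> \<le> (\<bar>d1\<bar> + \<bar>d2\<bar>) * \<bar>t\<bar>"
    "\<bar>phase_profile d1 d2 t\<bar> \<le> (\<bar>d1\<bar> + \<bar>d2\<bar>) * t\<^sup>2"
    by (auto simp: phase_slope_def phase_profile_def abs_mult distrib_right mult_nonneg_nonpos)
qed (simp add: phase_curvature_def)

lemma phase_measurable[measurable]:
  "phase_profile d1 d2 \<in> borel_measurable borel" "phase_slope d1 d2 \<in> borel_measurable borel"
  "phase_curvature d1 d2 \<in> borel_measurable borel"
  unfolding phase_profile_def[abs_def] phase_slope_def[abs_def] phase_curvature_def[abs_def] by measurable

lemma continuous_phase_profile: "continuous_on A (phase_profile d1 d2)"
  by (meson DERIV_continuous_on DERIV_phase_profile has_field_derivative_at_within)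

lemma continuous_phase_slope: "continuous_on A (phase_slope d1 d2)"
proof -
  have "phase_slope d1 d2 = (\<lambda>t. d1 * max t 0 + d2 * min t 0)"
    by (auto simp: phase_slope_def fun_eq_iff)
  then show ?thesis by (simp add: continuous_intros)
qed

lemma vec_nth_measurable[measurable]: "(\<lambda>x::real^'n::finite. x $ k) \<in> borel_measurable borel"
  by (intro borel_measurable_continuous_onI continuous_intros)

lemma DERIV_coordinate_function:
  fixes x :: "real^'n::finite"
  assumes "(f has_real_derivative D) (at (x $ k))"
  shows "((\<lambda>t. f ((x + t *\<^sub>R axis i 1) $ k)) has_real_derivative (if i = k then D else 0)) (at 0)"
proof (cases "i = k")
  case True
  have "((\<lambda>t. f (t + x $ k)) has_real_derivative D) (at 0)"
    using assms by (subst DERIV_shift[symmetric]) simp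
  then show ?thesis using True by (simp add: axis_def add.commute)
next
  case False
  then show ?thesis by (simp add: axis_def)
qed

lemma hyperplane_null: "{x::real^'n::finite. x $ k = 0} \<in> null_sets lborel"
proof -
  have "{x::real^'n. x $ k = 0} \<in> null_sets lebesgue"
    using negligible_standard_hyperplane_cart[of k] by (simp add: negligible_iff_null_sets)
  moreover have "{x::real^'n. x $ k = 0} \<in> sets lborel" by measurable
  ultimately show ?thesis using null_sets_completion_iff by blast
qed

text \<open>
  Two integrations by parts. The first uses that \<open>w\<close> is continuously differentiable, the second that its slope is
  continuous and differentiable off the hyperplane, which is a null set met at most once by lines in direction \<open>k\<close>;
  continuity of the slope is what keeps a surface term from appearing.
\<close>

lemma two_phase_has_weak_deriv:
  fixes k :: "'n::finite"
  assumes \<Omega>: "open \<Omega>"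
  shows "has_weak_deriv \<Omega> [i, i] (two_phase k d1 d2) (\<lambda>x. if i = k then phase_curvature d1 d2 (x $ k) else 0)"
    (is "has_weak_deriv \<Omega> _ ?w ?w2")
proof -
  let ?D = "\<bar>d1\<bar> + \<bar>d2\<bar>"
  let ?w1 = "\<lambda>x::real^'n. if i = k then phase_slope d1 d2 (x $ k) else 0"
  have wm: "?w \<in> borel_measurable borel" unfolding two_phase_profile by measurable
  have w1m: "?w1 \<in> borel_measurable borel" by measurable
  have w2m: "?w2 \<in> borel_measurable borel" by measurable
  have wc: "continuous_on UNIV ?w"
    unfolding two_phase_profile
    by (intro continuous_on_compose2[OF continuous_phase_profile[of UNIV]] continuous_intros) auto
  have w1c: "continuous_on UNIV ?w1"
    by (cases "i = k") (auto intro!: continuous_on_compose2[OF continuous_phase_slope[of UNIV]] continuous_intros)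
  have coord: "\<bar>x $ k\<bar> \<le> M" if "norm x \<le> M" for x :: "real^'n" and M
    using that component_le_norm_cart[of x k] by linarith
  have wb: "\<exists>B. \<forall>x. norm x \<le> M \<longrightarrow> \<bar>?w x\<bar> \<le> B" for M
  proof (intro exI allI impI)
    fix x :: "real^'n" assume "norm x \<le> M"
    from coord[OF this] have "(x $ k)\<^sup>2 \<le> M\<^sup>2" using abs_le_square_iff[of "x $ k" M] by auto
    then have "?D * (x $ k)\<^sup>2 \<le> ?D * M\<^sup>2" by (intro mult_left_mono) auto
    then show "\<bar>?w x\<bar> \<le> ?D * M\<^sup>2"
      unfolding two_phase_profile using phase_bounds(3)[of d1 d2 "x $ k"] by linarith
  qed
  have w1b: "\<exists>B. \<forall>x. norm x \<le> M \<longrightarrow> \<bar>?w1 x\<bar> \<le> B" for M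
  proof (intro exI allI impI)
    fix x :: "real^'n" assume "norm x \<le> M"
    from coord[OF this] have "?D * \<bar>x $ k\<bar> \<le> ?D * M" "0 \<le> ?D * M"
      by (auto intro!: mult_left_mono mult_nonneg_nonneg)
    then show "\<bar>?w1 x\<bar> \<le> ?D * M"
      using phase_bounds(1)[of d1 d2 "x $ k"] by auto
  qed
  have w2b: "\<exists>B. \<forall>x. norm x \<le> M \<longrightarrow> \<bar>?w2 x\<bar> \<le> B" for M
    using phase_bounds(2)[of d1 d2] by (intro exI[of _ ?D]) auto
  have ibp: "(LINT x|lborel. ?w x * iter_partial [i, i] \<phi> x) = (LINT x|lborel. ?w2 x * \<phi> x)"
    if \<phi>: "\<phi> \<in> test_functions \<Omega>" for \<phi>
  proof -
    have \<phi>1: "partial_deriv i \<phi> \<in> test_functions \<Omega>" using test_function_iter_partial[OF \<phi>, of "[i]"] by simp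
    have "(LINT x|lborel. ?w x * partial_deriv i (partial_deriv i \<phi>) x) = - (LINT x|lborel. ?w1 x * partial_deriv i \<phi> x)"
    proof (rule integral_by_parts_test_function[where N="{}", OF wc _ _ _ w1b w1m \<phi>1])
      show "((\<lambda>t. ?w (x + t *\<^sub>R axis i 1)) has_real_derivative ?w1 x) (at 0)" for x
        unfolding two_phase_profile by (rule DERIV_coordinate_function[OF DERIV_phase_profile])
    qed auto
    also have "(LINT x|lborel. ?w1 x * partial_deriv i \<phi> x) = - (LINT x|lborel. ?w2 x * \<phi> x)"
    proof (cases "i = k")
      case True
      show ?thesis
      proof (rule integral_by_parts_test_function[OF w1c hyperplane_null[of k] _ _ w2b w2m \<phi>])
        fix x :: "real^'n"
        have "{t. x + t *\<^sub>R axis i 1 \<in> {x. x $ k = 0}} \<subseteq> {- x $ k}"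
          using True by (auto simp: axis_def)
        then show "finite {t. x + t *\<^sub>R axis i 1 \<in> {x. x $ k = 0}}" by (rule finite_subset) simp
        show "((\<lambda>t. ?w1 (x + t *\<^sub>R axis i 1)) has_real_derivative ?w2 x) (at 0)" if "x \<notin> {x. x $ k = 0}"
          using DERIV_coordinate_function[where x=x and k=k and i=i, OF DERIV_phase_slope[of "x $ k" d1 d2]] that True by simp
      qed
    qed simp
    finally show ?thesis by simp
  qed
  have "(LINT x|lebesgue_on \<Omega>. ?w x * iter_partial [i, i] \<phi> x) = (-1) ^ length [i, i] * (LINT x|lebesgue_on \<Omega>. ?w2 x * \<phi> x)"
    if \<phi>: "\<phi> \<in> test_functions \<Omega>" for \<phi>
  proof -
    have m: "\<phi> \<in> borel_measurable borel" using test_function_borel[OF \<phi>, of "[]"] by simp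
    have z: "\<phi> x = 0" "iter_partial [i, i] \<phi> x = 0" if "x \<notin> \<Omega>" for x
      using test_function_outside[OF \<phi> that, of "[]"] test_function_outside[OF \<phi> that, of "[i, i]"] by auto
    have "(LINT x|lebesgue_on \<Omega>. ?w x * iter_partial [i, i] \<phi> x) = (LINT x|lborel. ?w x * iter_partial [i, i] \<phi> x)"
      using \<Omega> z by (intro integral_lebesgue_on_borel borel_measurable_times wm test_function_borel[OF \<phi>]) auto
    moreover have "(LINT x|lebesgue_on \<Omega>. ?w2 x * \<phi> x) = (LINT x|lborel. ?w2 x * \<phi> x)"
      using \<Omega> z by (intro integral_lebesgue_on_borel borel_measurable_times w2m m) auto
    ultimately show ?thesis using ibp[OF \<phi>] by simp
  qed
  then show ?thesis
    using locally_integrable_bounded[OF wm wb] locally_integrable_bounded[OF w2m w2b]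
    unfolding has_weak_deriv_def by blast
qed

lemma weak_laplacian_eq:
  assumes "open \<Omega>" "\<And>i. has_weak_deriv \<Omega> [i, i] u (g i)"
  shows "AE x in lebesgue_on \<Omega>. weak_laplacian \<Omega> u x = (\<Sum>i\<in>UNIV. g i x)"
proof -
  have "AE x in lebesgue_on \<Omega>. \<forall>i\<in>UNIV. weak_deriv \<Omega> [i, i] u x = g i x"
    by (intro AE_ball_countable' weak_deriv_eq assms countable_finite) auto
  then show ?thesis by eventually_elim (simp add: weak_laplacian_def)
qed

section \<open>The energy change caused by a test function\<close>

text \<open>
  The change of the energy density at a point with coordinate \<open>t\<close> when the function changes by \<open>v\<close> and its
  Laplacian by \<open>l\<close>. Using the change, and not the energies themselves, makes the integrand vanish off the
  support of the perturbation, so that integrals can be taken over the whole space.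
\<close>

definition energy_gap :: "real \<Rightarrow> real \<Rightarrow> real \<Rightarrow> real \<Rightarrow> real \<Rightarrow> real" where
  "energy_gap d1 d2 t v l = (phase_curvature d1 d2 t + l)\<^sup>2 - (phase_curvature d1 d2 t)\<^sup>2
     + of_bool (phase_profile d1 d2 t + v \<noteq> 0) - of_bool (phase_profile d1 d2 t \<noteq> 0)"

lemma energy_gap_0 [simp]: "energy_gap d1 d2 t 0 0 = 0"
  by (simp add: energy_gap_def)

lemma energy_gap_measurable:
  assumes [measurable]: "f \<in> borel_measurable M" "g \<in> borel_measurable M" "h \<in> borel_measurable M"
  shows "(\<lambda>x. energy_gap d1 d2 (f x) (g x) (h x)) \<in> borel_measurable M"
proof -
  have [measurable]: "(\<lambda>x. phase_curvature d1 d2 (f x)) \<in> borel_measurable M"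
    "(\<lambda>x. phase_profile d1 d2 (f x)) \<in> borel_measurable M"
    by (rule measurable_compose[OF assms(1) phase_measurable(3)], rule measurable_compose[OF assms(1) phase_measurable(1)])
  show ?thesis unfolding energy_gap_def by measurable
qed

lemma energy_gap_bound:
  assumes "\<bar>l\<bar> \<le> \<Lambda>"
  shows "\<bar>energy_gap d1 d2 t v l\<bar> \<le> 2 * (\<bar>d1\<bar> + \<bar>d2\<bar>) * \<Lambda> + \<Lambda>\<^sup>2 + 1"
proof -
  let ?p = "phase_curvature d1 d2 t"
  have "\<bar>?p * l\<bar> \<le> (\<bar>d1\<bar> + \<bar>d2\<bar>) * \<Lambda>"
    unfolding abs_mult using assms phase_bounds(2)[of d1 d2 t] by (intro mult_mono) auto
  moreover have "l\<^sup>2 \<le> \<Lambda>\<^sup>2" using assms abs_le_square_iff[of l \<Lambda>] by auto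
  moreover have "\<bar>(of_bool (phase_profile d1 d2 t + v \<noteq> 0) - of_bool (phase_profile d1 d2 t \<noteq> 0) :: real)\<bar> \<le> 1"
    by auto
  moreover have "energy_gap d1 d2 t v l = 2 * (?p * l) + l\<^sup>2 +
     (of_bool (phase_profile d1 d2 t + v \<noteq> 0) - of_bool (phase_profile d1 d2 t \<noteq> 0))"
    by (simp add: energy_gap_def power2_sum)
  ultimately show ?thesis using zero_le_power2[of l] by linarith
qed

lemma integral_lebesgue_on_bounded:
  fixes f :: "real^'n::finite \<Rightarrow> real"
  assumes f: "f \<in> borel_measurable borel" and B: "\<And>x. \<bar>f x\<bar> \<le> B" and \<Omega>: "open \<Omega>" "bounded \<Omega>"
  shows "integrable lborel (\<lambda>x. indicator \<Omega> x * f x)"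
    and "(LINT x|lebesgue_on \<Omega>. f x) = (LINT x|lborel. indicator \<Omega> x * f x)"
proof -
  have m: "(\<lambda>x. indicator \<Omega> x * f x) \<in> borel_measurable borel"
    using f \<Omega> by (intro borel_measurable_times borel_measurable_indicator) auto
  obtain M where M: "\<And>x. x \<in> \<Omega> \<Longrightarrow> norm x \<le> M" using \<Omega>(2) unfolding bounded_iff by blast
  show "integrable lborel (\<lambda>x. indicator \<Omega> x * f x)"
  proof (rule integrable_bounded_support[OF m])
    show "\<bar>indicator \<Omega> x * f x\<bar> \<le> \<bar>B\<bar>" for x using B[of x] by (auto simp: indicator_def)
    show "indicator \<Omega> x * f x = 0" if "norm x > M" for x using M[of x] that by (auto simp: indicator_def)
  qed
  have "(LINT x|lebesgue_on \<Omega>. f x) = (LINT x|lebesgue. indicator \<Omega> x *\<^sub>R f x)"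
    using \<Omega> by (intro integral_restrict_space) auto
  also have "\<dots> = (LINT x|lborel. indicator \<Omega> x *\<^sub>R f x)"
    using m by (intro integral_completion) simp
  finally show "(LINT x|lebesgue_on \<Omega>. f x) = (LINT x|lborel. indicator \<Omega> x * f x)" by simp
qed

lemma integral_lebesgue_on_cong_AE:
  fixes f g :: "real^'n::finite \<Rightarrow> real"
  assumes f: "f \<in> borel_measurable lebesgue" and \<Omega>: "open \<Omega>"
    and ae: "AE x in lebesgue_on \<Omega>. f x = g x"
  shows "(LINT x|lebesgue_on \<Omega>. f x) = (LINT x|lebesgue_on \<Omega>. g x)"
proof -
  let ?F = "\<lambda>x. indicator \<Omega> x *\<^sub>R f x" and ?G = "\<lambda>x. indicator \<Omega> x *\<^sub>R g x"
  have F: "?F \<in> borel_measurable lebesgue"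
    using \<Omega> by (intro borel_measurable_scaleR borel_measurable_indicator f) simp
  have "AE x in lebesgue. x \<in> \<Omega> \<longrightarrow> f x = g x" using ae by (simp only: AE_lebesgue_on_iff[OF \<Omega>])
  then have FG: "AE x in lebesgue. ?F x = ?G x" by eventually_elim (auto simp: indicator_def)
  have G: "?G \<in> borel_measurable lebesgue" by (rule borel_measurable_AE[OF F FG])
  have "(LINT x|lebesgue. ?F x) = (LINT x|lebesgue. ?G x)" by (rule integral_cong_AE[OF F G FG])
  then show ?thesis using \<Omega> by (simp only: integral_restrict_space[of \<Omega> lebesgue] sets_completionI_sets borel_open sets_lborel space_completion space_lborel space_borel Int_UNIV_right)
qed

text \<open>
  Once the weak Laplacian is known almost everywhere, the functional is a single integral of Borel
  functions with respect to \<open>lborel\<close>.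
\<close>

lemma biharmonic_AC_eq:
  fixes u L :: "real^'n::finite \<Rightarrow> real"
  assumes \<Omega>: "open \<Omega>" "bounded \<Omega>"
    and lap: "AE x in lebesgue_on \<Omega>. weak_laplacian \<Omega> u x = L x"
    and L: "L \<in> borel_measurable borel" "\<And>x. \<bar>L x\<bar> \<le> B" and u: "u \<in> borel_measurable borel"
  shows "biharmonic_AC u \<Omega> = (LINT x|lborel. indicator \<Omega> x * ((L x)\<^sup>2 + of_bool (u x \<noteq> 0)))"
    and "integrable lborel (\<lambda>x. indicator \<Omega> x * ((L x)\<^sup>2 + of_bool (u x \<noteq> 0)))"
proof -
  have Lb: "\<bar>(L x)\<^sup>2\<bar> \<le> B\<^sup>2" for x using L(2)[of x] abs_le_square_iff[of "L x" B] by auto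
  have Lm: "(\<lambda>x. (L x)\<^sup>2) \<in> borel_measurable borel" using L by measurable
  have um: "(\<lambda>x. of_bool (u x \<noteq> 0) :: real) \<in> borel_measurable borel" using u by measurable
  have ub: "\<bar>of_bool (u x \<noteq> 0) :: real\<bar> \<le> 1" for x by auto
  note iL = integral_lebesgue_on_bounded[OF Lm Lb \<Omega>]
  note iu = integral_lebesgue_on_bounded[OF um ub \<Omega>]
  have S: "{x \<in> \<Omega>. u x \<noteq> 0} \<in> sets borel" using u \<Omega>(1) by measurable
  have w: "(LINT x|lebesgue_on \<Omega>. (weak_laplacian \<Omega> u x)\<^sup>2) = (LINT x|lebesgue_on \<Omega>. (L x)\<^sup>2)"
  proof -
    have ae: "AE x in lebesgue_on \<Omega>. (L x)\<^sup>2 = (weak_laplacian \<Omega> u x)\<^sup>2"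
      using lap by eventually_elim simp
    have "(\<lambda>x. (L x)\<^sup>2) \<in> borel_measurable lebesgue"
      using Lm by (intro measurable_completion) simp
    then show ?thesis by (rule integral_lebesgue_on_cong_AE[OF _ \<Omega>(1) ae, symmetric])
  qed
  have "measure lebesgue {x \<in> \<Omega>. u x \<noteq> 0} = measure lborel {x \<in> \<Omega>. u x \<noteq> 0}"
    using S by simp
  also have "\<dots> = (LINT x|lborel. indicator {x \<in> \<Omega>. u x \<noteq> 0} x)" using S by simp
  also have "\<dots> = (LINT x|lborel. indicator \<Omega> x * of_bool (u x \<noteq> 0))"
    by (intro Bochner_Integration.integral_cong) (auto simp: indicator_def)
  finally have "biharmonic_AC u \<Omega> = (LINT x|lborel. indicator \<Omega> x * (L x)\<^sup>2) + (LINT x|lborel. indicator \<Omega> x * of_bool (u x \<noteq> 0))"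
    unfolding biharmonic_AC_def w iL(2) by simp
  also have "\<dots> = (LINT x|lborel. indicator \<Omega> x * (L x)\<^sup>2 + indicator \<Omega> x * of_bool (u x \<noteq> 0))"
    using iL(1) iu(1) by (rule Bochner_Integration.integral_add[symmetric])
  finally show "biharmonic_AC u \<Omega> = (LINT x|lborel. indicator \<Omega> x * ((L x)\<^sup>2 + of_bool (u x \<noteq> 0)))"
    by (simp add: distrib_left)
  have "integrable lborel (\<lambda>x. indicator \<Omega> x * (L x)\<^sup>2 + indicator \<Omega> x * of_bool (u x \<noteq> 0))"
    using iL(1) iu(1) by (rule Bochner_Integration.integrable_add)
  then show "integrable lborel (\<lambda>x. indicator \<Omega> x * ((L x)\<^sup>2 + of_bool (u x \<noteq> 0)))"
    by (simp add: distrib_left)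
qed

definition laplacian :: "(real^'n::finite \<Rightarrow> real) \<Rightarrow> real^'n \<Rightarrow> real" where
  "laplacian \<phi> x = (\<Sum>i\<in>UNIV. iter_partial [i, i] \<phi> x)"

text \<open>
  The competitor is \<open>w + \<phi>\<close>. The open set disappears from the conclusion because the integrand vanishes off
  the support of \<open>\<phi>\<close>.
\<close>

lemma minimizer_energy_gap_nonneg:
  fixes k :: "'n::finite"
  assumes min: "global_minimizer (two_phase k d1 d2)"
    and \<Omega>: "open \<Omega>" "bounded \<Omega>" and \<phi>: "\<phi> \<in> test_functions \<Omega>"
  shows "0 \<le> (LINT x|lborel. energy_gap d1 d2 (x $ k) (\<phi> x) (laplacian \<phi> x))"
proof -
  let ?w = "two_phase k d1 d2 :: real^'n \<Rightarrow> real"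
  let ?p = "\<lambda>x::real^'n. phase_curvature d1 d2 (x $ k)"
  have w: "?w \<in> H2 \<Omega>" using min \<Omega> by (auto simp: global_minimizer_def H2_loc_def)
  have v: "(\<lambda>x. ?w x + \<phi> x) \<in> H2 \<Omega>" by (rule H2_add[OF \<Omega>(1) w test_function_H2[OF \<Omega> \<phi>]])
  have d: "(\<lambda>x. (?w x + \<phi> x) - ?w x) \<in> H2_0 \<Omega>" using test_function_H2_0[OF \<Omega> \<phi>] by simp
  have "\<forall>v\<in>H2 \<Omega>. (\<lambda>x. v x - ?w x) \<in> H2_0 \<Omega> \<longrightarrow> biharmonic_AC ?w \<Omega> \<le> biharmonic_AC v \<Omega>"
    using min \<Omega> unfolding global_minimizer_def by simp
  from bspec[OF this v] have le: "biharmonic_AC ?w \<Omega> \<le> biharmonic_AC (\<lambda>x. ?w x + \<phi> x) \<Omega>"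
    using d by (rule mp)
  have wm: "?w \<in> borel_measurable borel" unfolding two_phase_profile by measurable
  have \<phi>m: "\<phi> \<in> borel_measurable borel" using test_function_borel[OF \<phi>, of "[]"] by simp
  have lm: "laplacian \<phi> \<in> borel_measurable borel"
    unfolding laplacian_def[abs_def] by (intro borel_measurable_sum test_function_borel[OF \<phi>])
  have "\<exists>B. \<forall>i. \<forall>x. \<bar>iter_partial [i, i] \<phi> x\<bar> \<le> B i"
  proof (intro choice allI)
    fix i show "\<exists>B. \<forall>x. \<bar>iter_partial [i, i] \<phi> x\<bar> \<le> B"
      by (rule test_function_bounded[OF \<phi>, of "[i, i]"]) blast
  qed
  then obtain B where B: "\<And>i x. \<bar>iter_partial [i, i] \<phi> x\<bar> \<le> B i" by blast
  have lb: "\<bar>laplacian \<phi> x\<bar> \<le> (\<Sum>i\<in>UNIV. B i)" for x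
    unfolding laplacian_def by (rule order_trans[OF sum_abs sum_mono[OF B]])
  have pm: "?p \<in> borel_measurable borel" by measurable
  have lap1: "AE x in lebesgue_on \<Omega>. weak_laplacian \<Omega> ?w x = ?p x"
    using weak_laplacian_eq[OF \<Omega>(1) two_phase_has_weak_deriv[OF \<Omega>(1)], of k d1 d2] by simp
  have hw: "has_weak_deriv \<Omega> [i, i] (\<lambda>x. ?w x + \<phi> x) (\<lambda>x. (if i = k then ?p x else 0) + iter_partial [i, i] \<phi> x)" for i
    using has_weak_deriv_add[OF \<Omega>(1) two_phase_has_weak_deriv[OF \<Omega>(1), of i k d1 d2] test_function_has_weak_deriv[OF \<Omega>(1) \<phi>, of "[i, i]"]]
    by simp
  have lap2: "AE x in lebesgue_on \<Omega>. weak_laplacian \<Omega> (\<lambda>x. ?w x + \<phi> x) x = ?p x + laplacian \<phi> x"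
    using weak_laplacian_eq[OF \<Omega>(1) hw] by (simp add: sum.distrib laplacian_def)
  have pb2: "\<bar>?p x + laplacian \<phi> x\<bar> \<le> (\<bar>d1\<bar> + \<bar>d2\<bar>) + (\<Sum>i\<in>UNIV. B i)" for x
    using phase_bounds(2)[of d1 d2 "x $ k"] lb[of x] by linarith
  note E1 = biharmonic_AC_eq[OF \<Omega> lap1 pm phase_bounds(2) wm]
  note E2 = biharmonic_AC_eq[OF \<Omega> lap2 borel_measurable_add[OF pm lm] pb2 borel_measurable_add[OF wm \<phi>m]]
  have "0 \<le> biharmonic_AC (\<lambda>x. ?w x + \<phi> x) \<Omega> - biharmonic_AC ?w \<Omega>" using le by simp
  also have "\<dots> = (LINT x|lborel. indicator \<Omega> x * ((?p x + laplacian \<phi> x)\<^sup>2 + of_bool (?w x + \<phi> x \<noteq> 0))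
      - indicator \<Omega> x * ((?p x)\<^sup>2 + of_bool (?w x \<noteq> 0)))"
    unfolding E1(1) E2(1) by (rule Bochner_Integration.integral_diff[symmetric, OF E2(2) E1(2)])
  also have "\<dots> = (LINT x|lborel. energy_gap d1 d2 (x $ k) (\<phi> x) (laplacian \<phi> x))"
  proof (intro Bochner_Integration.integral_cong refl)
    fix x :: "real^'n"
    have "\<phi> x = 0 \<and> laplacian \<phi> x = 0" if "x \<notin> \<Omega>"
    proof -
      have "iter_partial js \<phi> x = 0" for js by (rule test_function_outside[OF \<phi> that])
      from this[of "[]"] this show ?thesis unfolding laplacian_def by (simp del: iter_partial.simps(2))
    qed
    then show "indicator \<Omega> x * ((?p x + laplacian \<phi> x)\<^sup>2 + of_bool (?w x + \<phi> x \<noteq> 0))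
      - indicator \<Omega> x * ((?p x)\<^sup>2 + of_bool (?w x \<noteq> 0)) = energy_gap d1 d2 (x $ k) (\<phi> x) (laplacian \<phi> x)"
      by (cases "x \<in> \<Omega>") (auto simp: energy_gap_def two_phase_profile)
  qed
  finally show ?thesis .
qed

section \<open>Integrals of coordinate products and cutoffs\<close>

lemma
  fixes g :: "'n::finite \<Rightarrow> real \<Rightarrow> real"
  assumes g: "\<And>i. integrable lborel (g i)"
  shows integrable_coord_prod: "integrable lborel (coord_prod g)"
    and integral_coord_prod: "(LINT x|lborel. coord_prod g x) = (\<Prod>i\<in>UNIV. LINT t|lborel. g i t)"
proof -
  interpret product_sigma_finite "\<lambda>_::real^'n. lborel :: real measure" by standard
  have gm: "g i \<in> borel_measurable borel" for i using borel_measurable_integrable[OF g[of i]] by simp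
  have cm: "coord_prod g \<in> borel_measurable borel"
    unfolding coord_prod_def[abs_def]
    by (intro borel_measurable_prod measurable_compose[OF vec_nth_measurable gm])
  define e where "e = (\<lambda>i. axis i 1 :: real^'n)"
  have inj: "inj e" by (auto simp: e_def inj_def axis_eq_axis)
  have B: "(Basis :: (real^'n) set) = range e" by (auto simp: Basis_vec_def e_def)
  \<comment> \<open>\<open>lborel\<close> is an image of the product measure indexed by basis vectors, so the factors are
     re-indexed from coordinates to basis vectors.\<close>
  define G where "G b = g (inv e b)" for b
  have G: "G (e i) = g i" for i by (simp add: G_def inv_f_f[OF inj])
  have c: "(\<Sum>b\<in>Basis. f b *\<^sub>R b) $ i = f (e i)" for f :: "real^'n \<Rightarrow> real" and i
  proof -
    have "(\<Sum>b\<in>Basis. f b *\<^sub>R b) $ i = (\<Sum>j\<in>UNIV. f (e j) * e j $ i)"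
      unfolding B by (simp add: sum.reindex[OF inj])
    also have "\<dots> = (\<Sum>j\<in>UNIV. if j = i then f (e i) else 0)"
      by (intro sum.cong) (auto simp: e_def axis_def)
    finally show ?thesis by simp
  qed
  have pull: "coord_prod g (\<Sum>b\<in>Basis. f b *\<^sub>R b) = (\<Prod>b\<in>Basis. G b (f b))" for f :: "real^'n \<Rightarrow> real"
    unfolding coord_prod_def c by (simp add: B prod.reindex[OF inj] G)
  have Gi: "integrable lborel (G b)" if "b \<in> Basis" for b using that by (auto simp: B G g)
  have sm: "(\<lambda>f. \<Sum>b\<in>Basis. f b *\<^sub>R b) \<in> measurable (PiM Basis (\<lambda>_. lborel)) (borel :: (real^'n) measure)"
    by measurable
  have "integrable (PiM Basis (\<lambda>_::real^'n. lborel)) (\<lambda>f. (\<Prod>b\<in>Basis. G b (f b)))"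
    by (rule product_integrable_prod) (auto intro: Gi)
  then show "integrable lborel (coord_prod g)"
    by (subst lborel_eq, subst integrable_distr_eq[OF sm cm]) (simp only: pull)
  have "(LINT x|lborel. coord_prod g x) =
      (LINT f|PiM Basis (\<lambda>_. lborel). coord_prod g (\<Sum>b\<in>Basis. f b *\<^sub>R b))"
    by (subst lborel_eq, rule integral_distr[OF sm cm])
  also have "\<dots> = (LINT f|PiM Basis (\<lambda>_. lborel). (\<Prod>b\<in>Basis. G b (f b)))"
    by (simp only: pull)
  also have "\<dots> = (\<Prod>b\<in>Basis. LINT t|lborel. G b t)"
    by (rule product_integral_prod) (auto intro: Gi)
  also have "\<dots> = (\<Prod>i\<in>UNIV. LINT t|lborel. g i t)"
    by (simp add: B prod.reindex[OF inj] G)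
  finally show "(LINT x|lborel. coord_prod g x) = (\<Prod>i\<in>UNIV. LINT t|lborel. g i t)" .
qed

lemma coord_prod_split:
  "coord_prod (\<lambda>i. if i = k then f else g) x = f (x $ k) * (\<Prod>i\<in>UNIV - {k}. g (x $ i))"
  unfolding coord_prod_def by (subst prod.remove[of _ k]) auto

lemma abs_coord_prod_le:
  fixes g :: "'n::finite \<Rightarrow> real \<Rightarrow> real"
  assumes "\<And>i t. \<bar>g i t\<bar> \<le> C" shows "\<bar>coord_prod g x\<bar> \<le> C ^ CARD('n)"
proof -
  have "(\<Prod>i\<in>UNIV. \<bar>g i (x $ i)\<bar>) \<le> (\<Prod>i\<in>(UNIV::'n set). C)"
    by (intro prod_mono) (simp add: assms)
  then show ?thesis by (simp add: coord_prod_def abs_prod)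
qed

lemma iter_partial_coord_prod:
  assumes "\<And>i. smooth_real (g i)"
  shows "iter_partial [i, i] (coord_prod g) = coord_prod (g(i := deriv (deriv (g i))))"
proof -
  have "partial_deriv i (coord_prod (g(i := deriv (g i)))) =
     coord_prod ((g(i := deriv (g i)))(i := deriv ((g(i := deriv (g i))) i)))"
    by (rule partial_deriv_coord_prod) (simp add: assms smooth_real_deriv)
  then show ?thesis by (simp add: partial_deriv_coord_prod[of g, OF assms] del: fun_upd_apply) (simp add: fun_upd_same)
qed

text \<open>
  A cutoff equal to \<open>1\<close> on \<open>[-R, R]\<close> whose transition layers have width one for every \<open>R\<close>; therefore its
  derivatives are bounded independently of \<open>R\<close>.
\<close>

definition plateau :: "real \<Rightarrow> real \<Rightarrow> real" where
  "plateau R t = smooth_step (t + R + 1) * smooth_step (R + 1 - t)"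

lemma plateau_smooth: "smooth_real (plateau R)"
proof -
  have "smooth_real (\<lambda>t. smooth_step (1 * t + (R + 1)) * smooth_step ((- 1) * t + (R + 1)))"
    by (intro smooth_real_mult smooth_real_affine smooth_step_smooth)
  then show ?thesis by (simp add: plateau_def[abs_def] algebra_simps)
qed

lemma plateau_simps: "\<bar>t\<bar> \<le> R \<Longrightarrow> plateau R t = 1" "\<bar>t\<bar> > R + 1 \<Longrightarrow> plateau R t = 0"
  "\<bar>plateau R t\<bar> \<le> 1"
proof -
  show "\<bar>t\<bar> \<le> R \<Longrightarrow> plateau R t = 1" by (simp add: plateau_def smooth_step_1)
  show "\<bar>t\<bar> > R + 1 \<Longrightarrow> plateau R t = 0"
    using smooth_step_0[of "t + R + 1"] smooth_step_0[of "R + 1 - t"] by (cases "t > 0") (auto simp: plateau_def)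
  show "\<bar>plateau R t\<bar> \<le> 1"
    unfolding plateau_def abs_mult by (intro mult_le_one) (auto simp: smooth_step_ge_0 smooth_step_le_1)
qed

lemma deriv_eq: assumes "\<And>x. (f has_real_derivative f' x) (at x)" shows "deriv f = f'"
  using DERIV_imp_deriv[OF assms] by blast

lemma deriv_locally_const:
  assumes "open S" "x \<in> S" "\<And>y. y \<in> S \<Longrightarrow> f y = (c::real)"
  shows "deriv f x = 0"
proof -
  have "(f has_real_derivative 0) (at x)"
    by (rule has_field_derivative_transform_within_open[OF DERIV_const assms(1,2), of c]) (simp add: assms(3))
  then show ?thesis by (rule DERIV_imp_deriv)
qed

lemma deriv2_locally_const:
  assumes "open S" "x \<in> S" "\<And>y. y \<in> S \<Longrightarrow> f y = (c::real)"
  shows "deriv (deriv f) x = 0"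
  using deriv_locally_const[OF assms(1) _ assms(3)] by (intro deriv_locally_const[OF assms(1,2), of _ 0]) auto

lemma bounded_of_compact_support:
  assumes "continuous_on UNIV f" "\<And>t. \<bar>t\<bar> > L \<Longrightarrow> f t = (0::real)"
  obtains B where "B \<ge> 0" "\<And>t::real. \<bar>f t\<bar> \<le> B"
proof -
  have "bounded (f ` {-L..L})"
    by (intro compact_imp_bounded compact_continuous_image continuous_on_subset[OF assms(1)]) auto
  then obtain C where C: "\<And>t. t \<in> {-L..L} \<Longrightarrow> \<bar>f t\<bar> \<le> C" unfolding bounded_iff by (force simp: Ball_def)
  have "\<bar>f t\<bar> \<le> \<bar>C\<bar>" for t
  proof (cases "\<bar>t\<bar> \<le> L")
    case True then have "\<bar>f t\<bar> \<le> C" by (intro C) auto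
    then show ?thesis by linarith
  qed (use assms(2)[of t] in auto)
  then show ?thesis by (intro that[of "\<bar>C\<bar>"]) auto
qed

lemma smooth_step_derivs_bounded:
  obtains B where "B \<ge> 1" "\<And>t. \<bar>deriv smooth_step t\<bar> \<le> B" "\<And>t. \<bar>deriv (deriv smooth_step) t\<bar> \<le> B"
proof -
  have z: "deriv smooth_step t = 0 \<and> deriv (deriv smooth_step) t = 0" if "\<bar>t\<bar> > 1" for t
  proof (cases "t > 1")
    case True
    then show ?thesis
      using deriv_locally_const[of "{1<..}" t smooth_step 1] deriv2_locally_const[of "{1<..}" t smooth_step 1]
      by (simp add: smooth_step_1)
  next
    case False
    then show ?thesis
      using that deriv_locally_const[of "{..<0}" t smooth_step 0] deriv2_locally_const[of "{..<0}" t smooth_step 0]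
      by (simp add: smooth_step_0)
  qed
  note s = smooth_step_smooth
  obtain B1 where B1: "\<And>t. \<bar>deriv smooth_step t\<bar> \<le> B1"
    by (rule bounded_of_compact_support[OF smooth_real_continuous[OF smooth_real_deriv[OF s]], of 1]) (use z in auto)
  obtain B2 where B2: "\<And>t. \<bar>deriv (deriv smooth_step) t\<bar> \<le> B2"
    by (rule bounded_of_compact_support[OF smooth_real_continuous[OF smooth_real_deriv[OF smooth_real_deriv[OF s]]], of 1]) (use z in auto)
  show ?thesis
    by (rule that[of "max 1 (max B1 B2)"]) (auto simp: le_max_iff_disj B1 B2)
qed

lemma plateau_deriv2_bounded:
  obtains C where "C \<ge> 1" "\<And>R t. \<bar>deriv (deriv (plateau R)) t\<bar> \<le> C"
proof -
  let ?s = smooth_step let ?s1 = "deriv ?s" let ?s2 = "deriv ?s1"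
  obtain B where B: "B \<ge> 1" "\<And>t. \<bar>?s1 t\<bar> \<le> B" "\<And>t. \<bar>?s2 t\<bar> \<le> B"
    using smooth_step_derivs_bounded by blast
  note D0 = smooth_real_DERIV[OF smooth_step_smooth]
  note D1 = smooth_real_DERIV[OF smooth_real_deriv[OF smooth_step_smooth]]
  have up: "((\<lambda>t. t + R + 1) has_real_derivative 1) (at t)" for R t :: real
    by (auto intro!: derivative_eq_intros)
  have dn: "((\<lambda>t. R + 1 - t) has_real_derivative -1) (at t)" for R t :: real
    by (auto intro!: derivative_eq_intros)
  have d1: "deriv (plateau R) = (\<lambda>t. ?s1 (t + R + 1) * ?s (R + 1 - t) - ?s (t + R + 1) * ?s1 (R + 1 - t))" for R
  proof (rule deriv_eq)
    fix t
    show "(plateau R has_real_derivative ?s1 (t + R + 1) * ?s (R + 1 - t) - ?s (t + R + 1) * ?s1 (R + 1 - t)) (at t)"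
      using DERIV_mult[OF DERIV_chain2[OF D0 up[of R t]] DERIV_chain2[OF D0 dn[of R t]]]
      unfolding plateau_def[abs_def] by (simp add: algebra_simps)
  qed
  have d2: "deriv (deriv (plateau R)) = (\<lambda>t. ?s2 (t + R + 1) * ?s (R + 1 - t) - 2 * (?s1 (t + R + 1) * ?s1 (R + 1 - t))
      + ?s (t + R + 1) * ?s2 (R + 1 - t))" for R
    unfolding d1
  proof (rule deriv_eq)
    fix t
    show "((\<lambda>t. ?s1 (t + R + 1) * ?s (R + 1 - t) - ?s (t + R + 1) * ?s1 (R + 1 - t)) has_real_derivative
       ?s2 (t + R + 1) * ?s (R + 1 - t) - 2 * (?s1 (t + R + 1) * ?s1 (R + 1 - t))
      + ?s (t + R + 1) * ?s2 (R + 1 - t)) (at t)"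
      using DERIV_diff[OF DERIV_mult[OF DERIV_chain2[OF D1 up[of R t]] DERIV_chain2[OF D0 dn[of R t]]]
         DERIV_mult[OF DERIV_chain2[OF D0 up[of R t]] DERIV_chain2[OF D1 dn[of R t]]]]
      by (simp add: algebra_simps)
  qed
  have "\<bar>deriv (deriv (plateau R)) t\<bar> \<le> 2 * B + 2 * (B * B)" for R t
  proof -
    have s: "\<bar>?s x\<bar> \<le> 1" for x using smooth_step_ge_0 smooth_step_le_1 by simp
    have "\<bar>?s2 (t + R + 1) * ?s (R + 1 - t)\<bar> \<le> B * 1" "\<bar>?s (t + R + 1) * ?s2 (R + 1 - t)\<bar> \<le> 1 * B"
      "\<bar>?s1 (t + R + 1) * ?s1 (R + 1 - t)\<bar> \<le> B * B"
      unfolding abs_mult using B(1) by (intro mult_mono B(2,3) s; simp)+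
    then show ?thesis unfolding d2 by linarith
  qed
  moreover have "2 * B + 2 * (B * B) \<ge> 1" using B(1) by (simp add: add_increasing2)
  ultimately show ?thesis using that by blast
qed

section \<open>Reduction to one dimension\<close>

lemma integral_coord_prod_split:
  fixes k :: "'n::finite"
  assumes "integrable lborel f" "integrable lborel g"
  shows "integrable lborel (coord_prod (\<lambda>i::'n. if i = k then f else g))"
    and "(LINT x|lborel. coord_prod (\<lambda>i::'n. if i = k then f else g) x)
      = (LINT t|lborel. f t) * (LINT t|lborel. g t) ^ (CARD('n) - 1)"
proof -
  have i: "integrable lborel (if i = k then f else g)" for i using assms by simp
  show "integrable lborel (coord_prod (\<lambda>i::'n. if i = k then f else g))"
    by (rule integrable_coord_prod[OF i])
  have "(LINT x|lborel. coord_prod (\<lambda>i::'n. if i = k then f else g) x)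
     = (\<Prod>i\<in>UNIV. LINT t|lborel. (if i = k then f else g) t)"
    by (rule integral_coord_prod[OF i])
  also have "\<dots> = (LINT t|lborel. f t) * (\<Prod>i\<in>UNIV - {k}. LINT t|lborel. (if i = k then f else g) t)"
    by (subst prod.remove[of _ k]) auto
  also have "(\<Prod>i\<in>UNIV - {k}. LINT t|lborel. (if i = k then f else g) t) = (\<Prod>i\<in>UNIV - {k}. LINT t|lborel. g t)"
    by (intro prod.cong) auto
  finally show "(LINT x|lborel. coord_prod (\<lambda>i::'n. if i = k then f else g) x)
      = (LINT t|lborel. f t) * (LINT t|lborel. g t) ^ (CARD('n) - 1)"
    by (simp add: card_Diff_singleton)
qed

lemma laplacian_coord_prod:
  assumes "\<And>i. smooth_real (g i)"
  shows "laplacian (coord_prod g) x = (\<Sum>i\<in>UNIV. coord_prod (g(i := deriv (deriv (g i)))) x)"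
  unfolding laplacian_def using iter_partial_coord_prod[of g, OF assms] by (simp del: iter_partial.simps fun_upd_apply)

lemma coord_prod_eq_0: "g i (x $ i) = 0 \<Longrightarrow> coord_prod g x = 0"
  unfolding coord_prod_def by (rule prod_zero) auto

lemma abs_laplacian_coord_prod_le:
  fixes g :: "'n::finite \<Rightarrow> real \<Rightarrow> real"
  assumes "\<And>i. smooth_real (g i)" "\<And>i t. \<bar>g i t\<bar> \<le> C" "\<And>i t. \<bar>deriv (deriv (g i)) t\<bar> \<le> C"
  shows "\<bar>laplacian (coord_prod g) x\<bar> \<le> real CARD('n) * C ^ CARD('n)"
proof -
  have "\<bar>coord_prod (g(i := deriv (deriv (g i)))) x\<bar> \<le> C ^ CARD('n)" for i
    by (rule abs_coord_prod_le) (use assms(2,3) in simp)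
  then have "(\<Sum>i\<in>UNIV. \<bar>coord_prod (g(i := deriv (deriv (g i)))) x\<bar>) \<le> (\<Sum>i\<in>(UNIV::'n set). C ^ CARD('n))"
    by (intro sum_mono)
  then show ?thesis
    unfolding laplacian_coord_prod[of g, OF assms(1)] by (intro order_trans[OF sum_abs]) simp
qed

text \<open>
  The perturbation is \<open>h (x $ k)\<close> times plateau cutoffs in the other coordinates. Where all of these coordinates
  are less than \<open>R\<close> in absolute value, the energy change is that of \<open>h\<close>. Elsewhere it is bounded by
  the constant \<open>K\<close>, and it vanishes outside the box with half-width \<open>R + 1\<close> in these coordinates and
  \<open>M\<close> in direction \<open>k\<close>; the last summand is \<open>K\<close> times the volume of what remains.
\<close>

lemma one_dim_gap_with_cutoff:
  fixes k :: "'n::finite"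
  assumes min: "global_minimizer (two_phase k d1 d2)"
    and h: "smooth_real h" and M: "M > 0" "\<And>t. \<bar>t\<bar> > M \<Longrightarrow> h t = 0"
    and C: "C \<ge> 1" "\<And>t. \<bar>h t\<bar> \<le> C" "\<And>t. \<bar>deriv (deriv h) t\<bar> \<le> C" "\<And>R t. \<bar>deriv (deriv (plateau R)) t\<bar> \<le> C"
    and R: "R > 0"
  defines "\<Lambda> \<equiv> real CARD('n) * C ^ CARD('n)"
  defines "K \<equiv> 2 * (\<bar>d1\<bar> + \<bar>d2\<bar>) * \<Lambda> + \<Lambda>\<^sup>2 + 1"
  defines "m \<equiv> CARD('n) - 1"
  shows "0 \<le> (2 * R) ^ m * (LINT t|lborel. energy_gap d1 d2 t (h t) (deriv (deriv h) t))
      + K * (2 * M * (2 * R + 2) ^ m - 2 * M * (2 * R) ^ m)"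
proof -
  let ?h2 = "deriv (deriv h)"
  define e where "e t = energy_gap d1 d2 t (h t) (?h2 t)" for t
  define g where "g = (\<lambda>i::'n. if i = k then h else plateau R)"
  define \<phi> where "\<phi> = coord_prod g"
  define E where "E x = energy_gap d1 d2 (x $ k) (\<phi> x) (laplacian \<phi> x)" for x
  define qe where "qe = coord_prod (\<lambda>i. if i = k then e else indicator {-R<..<R})"
  define q :: "real^'n \<Rightarrow> real" where "q = coord_prod (\<lambda>i. if i = k then indicator {-M..M} else indicator {-R<..<R})"
  define p :: "real^'n \<Rightarrow> real" where "p = coord_prod (\<lambda>i. if i = k then indicator {-M..M} else indicator {-(R + 1)..R + 1})"
  have g: "smooth_real (g i)" for i by (simp add: g_def h plateau_smooth)
  have h2: "?h2 t = 0" if "\<bar>t\<bar> > M" for t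
    by (rule deriv2_locally_const[of "{t. M < \<bar>t\<bar>}"]) (use that M(2) in \<open>auto intro!: open_Collect_less continuous_intros\<close>)
  have pl2: "deriv (deriv (plateau R)) t = 0" if "\<bar>t\<bar> > R + 1 \<or> \<bar>t\<bar> < R" for t
  proof (cases "\<bar>t\<bar> < R")
    case True
    show ?thesis
      by (rule deriv2_locally_const[of "{t. \<bar>t\<bar> < R}" _ _ 1]) (use True plateau_simps(1)[of _ R] in \<open>auto intro!: open_Collect_less continuous_intros\<close>)
  next
    case False
    then have *: "\<bar>t\<bar> > R + 1" using that by simp
    show ?thesis
      by (rule deriv2_locally_const[of "{t. R + 1 < \<bar>t\<bar>}" _ _ 0]) (use * plateau_simps(2)[of R] in \<open>auto intro!: open_Collect_less continuous_intros\<close>)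
  qed
  have gC: "\<bar>g i t\<bar> \<le> C" "\<bar>deriv (deriv (g i)) t\<bar> \<le> C" for i t
    using C plateau_simps(3)[of R t] by (auto simp: g_def)
  have lapb: "\<bar>laplacian \<phi> x\<bar> \<le> \<Lambda>" for x
    unfolding \<phi>_def \<Lambda>_def by (rule abs_laplacian_coord_prod_le[OF g gC])
  have EK: "\<bar>E x\<bar> \<le> K" for x unfolding E_def K_def by (rule energy_gap_bound[OF lapb])
  have K0: "K \<ge> 0" using EK[of 0] by linarith
  have ind1: "(\<Prod>i\<in>UNIV - {k}. indicator A (x $ i) :: real) = 1" if "\<And>i. i \<noteq> k \<Longrightarrow> x $ i \<in> A" for A and x :: "real^'n"
    using that by (intro prod.neutral) auto
  have psplit: "p x = indicator {-M..M} (x $ k) * (\<Prod>i\<in>UNIV - {k}. indicator {-(R + 1)..R + 1} (x $ i))" for x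
    unfolding p_def by (rule coord_prod_split)
  have p01: "0 \<le> p x" for x unfolding psplit by (intro mult_nonneg_nonneg prod_nonneg) auto
  have out: "\<phi> x = 0 \<and> laplacian \<phi> x = 0" if "\<not> (\<bar>x $ k\<bar> \<le> M \<and> (\<forall>i. i \<noteq> k \<longrightarrow> \<bar>x $ i\<bar> \<le> R + 1))" for x
  proof -
    obtain j where "g j (x $ j) = 0" "deriv (deriv (g j)) (x $ j) = 0"
    proof (cases "\<bar>x $ k\<bar> \<le> M")
      case False
      then show ?thesis using that[of k] M(2)[of "x $ k"] h2[of "x $ k"] by (simp add: g_def)
    next
      case True
      then obtain i where i: "i \<noteq> k" "\<bar>x $ i\<bar> > R + 1"
        using \<open>\<not> (\<bar>x $ k\<bar> \<le> M \<and> (\<forall>i. i \<noteq> k \<longrightarrow> \<bar>x $ i\<bar> \<le> R + 1))\<close> by force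
      then show ?thesis using that[of i] plateau_simps(2)[of R "x $ i"] pl2[of "x $ i"] by (simp add: g_def)
    qed
    then have "coord_prod g x = 0" and "coord_prod (g(i := deriv (deriv (g i)))) x = 0" for i
      by (auto intro: coord_prod_eq_0[of _ j])
    then show ?thesis unfolding \<phi>_def laplacian_coord_prod[of g, OF g] by simp
  qed
  \<comment> \<open>\<open>p\<close> is the indicator of the box that contains the support of the perturbation.\<close>
  have Ep: "\<bar>E x\<bar> \<le> K * p x" for x
  proof (cases "\<bar>x $ k\<bar> \<le> M \<and> (\<forall>i. i \<noteq> k \<longrightarrow> \<bar>x $ i\<bar> \<le> R + 1)")
    case True
    have "p x = 1" unfolding psplit using True by (subst ind1) (auto simp: abs_le_iff)
    then show ?thesis using EK by simp
  next
    case False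
    then show ?thesis using out[OF False] p01[of x] K0 by (simp add: E_def)
  qed
  \<comment> \<open>\<open>q\<close> is the indicator of the part of this box where the other coordinates are less than \<open>R\<close> in
     absolute value and all cutoffs equal one, so \<open>p - q\<close> is the
     indicator of the transition layer.\<close>
  have Eq: "E x \<le> qe x + K * (p x - q x)" for x
  proof (cases "\<forall>i. i \<noteq> k \<longrightarrow> \<bar>x $ i\<bar> < R")
    case True
    have m1: "(\<Prod>i\<in>UNIV - {k}. indicator {-R<..<R} (x $ i) :: real) = 1"
      "(\<Prod>i\<in>UNIV - {k}. indicator {-(R + 1)..R + 1} (x $ i) :: real) = 1"
      using True by (force intro!: ind1 simp: abs_less_iff)+
    have m2: "(\<Prod>i\<in>UNIV - {k}. plateau R (x $ i)) = 1"
      using True plateau_simps(1)[of _ R] by (intro prod.neutral) (auto simp: less_imp_le)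
    have "\<phi> x = h (x $ k)" unfolding \<phi>_def g_def coord_prod_split m2 by simp
    moreover have "laplacian \<phi> x = ?h2 (x $ k)"
    proof -
      have "coord_prod (g(i := deriv (deriv (g i)))) x = (if i = k then ?h2 (x $ k) else 0)" for i
      proof (cases "i = k")
        case True
        have "g(i := deriv (deriv (g i))) = (\<lambda>i. if i = k then ?h2 else plateau R)"
          using True by (auto simp: g_def)
        then show ?thesis using True by (simp add: coord_prod_split m2)
      next
        case False
        have "coord_prod (g(i := deriv (deriv (g i)))) x = 0"
          by (rule coord_prod_eq_0[of _ i]) (use False True pl2[of "x $ i"] \<open>\<forall>i. i \<noteq> k \<longrightarrow> \<bar>x $ i\<bar> < R\<close> in \<open>simp add: g_def\<close>)
        then show ?thesis using False by simp
      qed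
      then show ?thesis unfolding \<phi>_def laplacian_coord_prod[of g, OF g] by simp
    qed
    ultimately have "E x = e (x $ k)" by (simp add: E_def e_def)
    moreover have "qe x = e (x $ k)" unfolding qe_def coord_prod_split m1 by simp
    moreover have "p x = q x" unfolding p_def q_def coord_prod_split m1 by simp
    ultimately show ?thesis by simp
  next
    case False
    then obtain i where i: "i \<noteq> k" "\<not> \<bar>x $ i\<bar> < R" by blast
    have z: "indicator {-R<..<R} (x $ i) = (0::real)" using i(2) by (auto simp: indicator_def)
    have "qe x = 0" "q x = 0" unfolding qe_def q_def using i(1) z by (auto intro!: coord_prod_eq_0[of _ i])
    then show ?thesis using Ep[of x] by simp
  qed
  have hm: "h \<in> borel_measurable borel" "?h2 \<in> borel_measurable borel"
    using smooth_real_continuous[OF h] smooth_real_continuous[OF smooth_real_deriv[OF smooth_real_deriv[OF h]]]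
    by (auto intro: borel_measurable_continuous_onI)
  have em: "e \<in> borel_measurable borel"
    unfolding e_def[abs_def] by (intro energy_gap_measurable hm) simp
  have ei: "integrable lborel e"
  proof (rule integrable_bounded_support[OF em])
    show "\<bar>e t\<bar> \<le> 2 * (\<bar>d1\<bar> + \<bar>d2\<bar>) * C + C\<^sup>2 + 1" for t
      unfolding e_def by (rule energy_gap_bound[OF C(3)])
    show "e t = 0" if "norm t > M" for t using that M(2)[of t] h2[of t] by (simp add: e_def)
  qed
  have indi: "integrable lborel (indicator {-M..M} :: real \<Rightarrow> real)" "integrable lborel (indicator {-R<..<R} :: real \<Rightarrow> real)"
     "integrable lborel (indicator {-(R+1)..R+1} :: real \<Rightarrow> real)"
    using M(1) R by (auto intro!: integrable_real_indicator)
  have indv: "(LINT t|lborel. indicator {-M..M} t :: real) = 2 * M" "(LINT t|lborel. indicator {-R<..<R} t :: real) = 2 * R"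
     "(LINT t|lborel. indicator {-(R+1)..R+1} t :: real) = 2 * R + 2"
    using M(1) R by auto
  note iqe = integral_coord_prod_split[OF ei indi(2), of k, folded qe_def, unfolded indv, folded m_def]
  note iq = integral_coord_prod_split[OF indi(1,2), of k, folded q_def, unfolded indv, folded m_def]
  note ip = integral_coord_prod_split[OF indi(1,3), of k, folded p_def, unfolded indv, folded m_def]
  define b :: "real^'n" where "b = (\<chi> i. if i = k then M else R + 1)"
  obtain r where r: "cbox (- b) b \<subseteq> ball 0 r" using bounded_subset_ballD[OF bounded_cbox] by blast
  have test: "\<phi> \<in> test_functions (ball 0 r)"
    unfolding \<phi>_def
  proof (rule test_function_coord_prod[OF g _ r])
    fix i t assume "g i t \<noteq> 0"
    then have "\<bar>t\<bar> \<le> b $ i"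
      using M(2)[of t] plateau_simps(2)[of R t] by (auto simp: g_def b_def split: if_splits) force+
    then show "(- b) $ i \<le> t \<and> t \<le> b $ i" by auto
  qed
  have Em: "E \<in> borel_measurable borel"
  proof -
    have "\<phi> \<in> borel_measurable borel" using test_function_borel[OF test, of "[]"] by simp
    moreover have "laplacian \<phi> \<in> borel_measurable borel"
      unfolding laplacian_def[abs_def] by (intro borel_measurable_sum test_function_borel[OF test])
    ultimately show ?thesis unfolding E_def[abs_def] by (intro energy_gap_measurable) auto
  qed
  have Ei: "integrable lborel E"
  proof (rule Bochner_Integration.integrable_bound)
    show "integrable lborel (\<lambda>x. K * p x)" using ip(1) by simp
    show "AE x in lborel. norm (E x) \<le> norm (K * p x)"
      using Ep p01 K0 by (intro AE_I2) (simp add: abs_mult)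
  qed (use Em in simp)
  have "0 \<le> (LINT x|lborel. E x)"
    unfolding E_def by (rule minimizer_energy_gap_nonneg[OF min open_ball bounded_ball test])
  also have "\<dots> \<le> (LINT x|lborel. qe x + K * (p x - q x))"
    using Ei iqe(1) iq(1) ip(1) Eq by (intro integral_mono) auto
  also have "\<dots> = (LINT t|lborel. e t) * (2 * R) ^ m + K * (2 * M * (2 * R + 2) ^ m - 2 * M * (2 * R) ^ m)"
    using iqe iq ip by simp
  finally show ?thesis by (simp add: e_def mult.commute)
qed

text \<open>
  Divide the previous estimate by \<open>(2 * R) ^ m\<close>: the error becomes a multiple of \<open>(1 + 1/R) ^ m - 1\<close>,
  which tends to zero.
\<close>

lemma one_dim_energy_gap_nonneg:
  fixes k :: "'n::finite"
  assumes min: "global_minimizer (two_phase k d1 d2)"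
    and h: "smooth_real h" and L: "\<And>t. \<bar>t\<bar> > L \<Longrightarrow> h t = 0"
  shows "0 \<le> (LINT t|lborel. energy_gap d1 d2 t (h t) (deriv (deriv h) t))" (is "0 \<le> ?J")
proof -
  define M where "M = \<bar>L\<bar> + 1"
  have M: "M > 0" "\<And>t. \<bar>t\<bar> > M \<Longrightarrow> h t = 0" using L by (auto simp: M_def)
  have h2: "deriv (deriv h) t = 0" if "\<bar>t\<bar> > M" for t
    by (rule deriv2_locally_const[of "{t. M < \<bar>t\<bar>}"]) (use that M(2) in \<open>auto intro!: open_Collect_less continuous_intros\<close>)
  obtain B1 where B1: "\<And>t. \<bar>h t\<bar> \<le> B1"
    by (rule bounded_of_compact_support[OF smooth_real_continuous[OF h] M(2)]) auto
  obtain B2 where B2: "\<And>t. \<bar>deriv (deriv h) t\<bar> \<le> B2"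
    by (rule bounded_of_compact_support[OF smooth_real_continuous[OF smooth_real_deriv[OF smooth_real_deriv[OF h]]] h2]) auto
  obtain B3 where B3: "\<And>R t. \<bar>deriv (deriv (plateau R)) t\<bar> \<le> B3"
    using plateau_deriv2_bounded by blast
  define C where "C = max 1 (max B1 (max B2 B3))"
  have C: "C \<ge> 1" "\<And>t. \<bar>h t\<bar> \<le> C" "\<And>t. \<bar>deriv (deriv h) t\<bar> \<le> C" "\<And>R t. \<bar>deriv (deriv (plateau R)) t\<bar> \<le> C"
    using B1 B2 B3 by (auto simp: C_def le_max_iff_disj)
  define m where "m = CARD('n) - 1"
  define \<Lambda> where "\<Lambda> = real CARD('n) * C ^ CARD('n)"
  define K where "K = 2 * (\<bar>d1\<bar> + \<bar>d2\<bar>) * \<Lambda> + \<Lambda>\<^sup>2 + 1"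
  have K: "0 \<le> (2 * R) ^ m * ?J + K * (2 * M * (2 * R + 2) ^ m - 2 * M * (2 * R) ^ m)" if "R > 0" for R
    using one_dim_gap_with_cutoff[OF min h M C that] unfolding m_def K_def \<Lambda>_def .
  have bound: "0 \<le> ?J + 2 * K * M * ((1 + inverse (real (Suc n))) ^ m - 1)" for n
  proof -
    let ?R = "real (Suc n)"
    have "2 * ?R + 2 = 2 * ?R * (1 + inverse ?R)" by (simp add: field_simps)
    then have "(2 * ?R + 2) ^ m = (2 * ?R) ^ m * (1 + inverse ?R) ^ m"
      by (simp only: power_mult_distrib)
    then have "0 \<le> (2 * ?R) ^ m * (?J + 2 * K * M * ((1 + inverse ?R) ^ m - 1))"
      using K[of ?R] by (simp add: algebra_simps)
    moreover have "(2 * ?R) ^ m > 0" by simp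
    ultimately show ?thesis by (smt (verit) mult_pos_neg)
  qed
  have "(\<lambda>n. ?J + 2 * K * M * ((1 + inverse (real (Suc n))) ^ m - 1)) \<longlonglongrightarrow> ?J + 2 * K * M * ((1 + 0) ^ m - 1)"
    by (intro tendsto_intros LIMSEQ_inverse_real_of_nat)
  then show ?thesis
    using LIMSEQ_le_const[where a=0 and x="?J + 2 * K * M * ((1 + 0) ^ m - 1)"] bound by force
qed

section \<open>Two nonzero phases, and reflection\<close>

text \<open>
  Adding a multiple of \<open>h\<close> cannot enlarge a set that already has full measure, so the volume term drops out
  and a quadratic polynomial in the multiple is nonnegative; its linear coefficient must vanish. That coefficient
  is a multiple of \<open>(d2 - d1) * h' 0\<close>, and \<open>h\<close> is chosen with slope one at the origin.
\<close>

lemma phase_equal_of_nonneg_gap: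
  assumes gap: "\<And>h L. smooth_real h \<Longrightarrow> (\<And>t. \<bar>t\<bar> > L \<Longrightarrow> h t = 0) \<Longrightarrow>
      0 \<le> (LINT t|lborel. energy_gap d1 d2 t (h t) (deriv (deriv h) t))"
    and d: "d1 \<noteq> 0" "d2 \<noteq> 0"
  shows "d1 = d2"
proof -
  define h where "h t = t * plateau 1 t" for t
  let ?h1 = "deriv h" and ?h2 = "deriv (deriv h)" and ?p = "phase_curvature d1 d2"
  have h: "smooth_real h" unfolding h_def[abs_def] by (intro smooth_real_mult smooth_real_id plateau_smooth)
  note h1 = smooth_real_deriv[OF h] and h2 = smooth_real_deriv[OF smooth_real_deriv[OF h]]
  have h0: "h t = 0" if "\<bar>t\<bar> > 2" for t using that plateau_simps(2)[of 1 t] by (simp add: h_def)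
  have z: "?h1 t = 0" "?h2 t = 0" if "\<bar>t\<bar> > 2" for t
    by (rule deriv_locally_const[of "{t. 2 < \<bar>t\<bar>}"], use that h0 in \<open>auto intro!: open_Collect_less continuous_intros\<close>)
       (rule deriv2_locally_const[of "{t. 2 < \<bar>t\<bar>}"], use that h0 in \<open>auto intro!: open_Collect_less continuous_intros\<close>)
  have h10: "?h1 0 = 1"
  proof -
    have "(h has_real_derivative 1) (at 0)"
      by (rule has_field_derivative_transform_within_open[OF DERIV_ident, of "{-1<..<1}"])
         (auto simp: h_def plateau_simps(1))
    then show ?thesis by (rule DERIV_imp_deriv)
  qed
  obtain B where B: "B \<ge> 0" "\<And>t. \<bar>?h2 t\<bar> \<le> B"
    using bounded_of_compact_support[OF smooth_real_continuous[OF h2] z(2)] by metis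
  have h2m: "?h2 \<in> borel_measurable borel"
    by (rule borel_measurable_continuous_onI[OF smooth_real_continuous[OF h2]])
  have hm: "h \<in> borel_measurable borel"
    by (rule borel_measurable_continuous_onI[OF smooth_real_continuous[OF h]])
  have ph: "\<bar>?p t * ?h2 t\<bar> \<le> (\<bar>d1\<bar> + \<bar>d2\<bar>) * B" for t
    unfolding abs_mult by (intro mult_mono phase_bounds B) auto
  have i1: "integrable lborel (\<lambda>t. ?p t * ?h2 t)"
    by (rule integrable_bounded_support[OF _ ph, where M=2]) (use h2m z in auto)
  have sqb: "\<bar>(?h2 t)\<^sup>2\<bar> \<le> B\<^sup>2" for t using B(2)[of t] abs_le_square_iff[of "?h2 t" B] by auto
  have i2: "integrable lborel (\<lambda>t. (?h2 t)\<^sup>2)"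
    by (rule integrable_bounded_support[OF _ sqb, where M=2]) (use h2m z in auto)
  define A where "A = (LINT t|lborel. ?p t * ?h2 t)"
  define Q where "Q = (LINT t|lborel. (?h2 t)\<^sup>2)"
  have Q0: "Q \<ge> 0" unfolding Q_def by (rule Bochner_Integration.integral_nonneg) simp
  have quad: "0 \<le> 2 * \<epsilon> * A + \<epsilon>\<^sup>2 * Q" for \<epsilon>
  proof -
    have sm: "smooth_real (\<lambda>t. \<epsilon> * h t)" by (intro smooth_real_mult smooth_real_const h)
    have D1: "deriv (\<lambda>t. \<epsilon> * h t) = (\<lambda>t. \<epsilon> * ?h1 t)"
      by (rule deriv_eq) (rule DERIV_cmult[OF smooth_real_DERIV[OF h]])
    have D2: "deriv (deriv (\<lambda>t. \<epsilon> * h t)) = (\<lambda>t. \<epsilon> * ?h2 t)"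
      unfolding D1 by (rule deriv_eq) (rule DERIV_cmult[OF smooth_real_DERIV[OF h1]])
    let ?e = "\<lambda>t. energy_gap d1 d2 t (\<epsilon> * h t) (\<epsilon> * ?h2 t)"
    have eb: "\<bar>?e t\<bar> \<le> 2 * (\<bar>d1\<bar> + \<bar>d2\<bar>) * (\<bar>\<epsilon>\<bar> * B) + (\<bar>\<epsilon>\<bar> * B)\<^sup>2 + 1" for t
      by (rule energy_gap_bound) (simp add: abs_mult mult_left_mono B)
    have ei: "integrable lborel ?e"
    proof (rule integrable_bounded_support[OF _ eb])
      show "?e \<in> borel_measurable borel" using hm h2m by (intro energy_gap_measurable) auto
      show "?e t = 0" if "norm t > 2" for t using that h0[of t] z[of t] by simp
    qed
    have "0 \<le> (LINT t|lborel. ?e t)" using gap[OF sm, of 2] h0 unfolding D2 by simp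
    also have "\<dots> \<le> (LINT t|lborel. 2 * \<epsilon> * (?p t * ?h2 t) + \<epsilon>\<^sup>2 * (?h2 t)\<^sup>2)"
    proof (rule integral_mono_AE[OF ei])
      show "integrable lborel (\<lambda>t. 2 * \<epsilon> * (?p t * ?h2 t) + \<epsilon>\<^sup>2 * (?h2 t)\<^sup>2)"
        using i1 i2 by (intro Bochner_Integration.integrable_add integrable_mult_right)
      have "AE t in lborel. t \<noteq> (0::real)" by (rule AE_lborel_singleton)
      then show "AE t in lborel. ?e t \<le> 2 * \<epsilon> * (?p t * ?h2 t) + \<epsilon>\<^sup>2 * (?h2 t)\<^sup>2"
      proof eventually_elim
        case (elim t)
        then have "phase_profile d1 d2 t \<noteq> 0" using d by (simp add: phase_profile_def)
        then show ?case by (simp add: energy_gap_def power2_sum power_mult_distrib algebra_simps)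
      qed
    qed
    also have "\<dots> = 2 * \<epsilon> * A + \<epsilon>\<^sup>2 * Q"
      unfolding A_def Q_def using i1 i2 by simp
    finally show ?thesis .
  qed
  have "A = 0"
  proof (rule ccontr)
    assume "A \<noteq> 0"
    \<comment> \<open>Replacing \<open>Q\<close> by \<open>Q + 1\<close> avoids a separate case for \<open>Q = 0\<close>; \<open>- A / c\<close> minimizes the larger polynomial.\<close>
    define c where "c = Q + 1"
    define \<epsilon> where "\<epsilon> = - A / c"
    have c: "c > 0" using Q0 by (simp add: c_def)
    have "2 * \<epsilon> * A + \<epsilon>\<^sup>2 * Q \<le> 2 * \<epsilon> * A + \<epsilon>\<^sup>2 * c"
      by (simp add: c_def mult_left_mono)
    also have "\<dots> = - (A\<^sup>2 / c)"
      using c by (simp add: \<epsilon>_def power2_eq_square)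
    also have "\<dots> < 0" using \<open>A \<noteq> 0\<close> c by simp
    finally show False using quad[of \<epsilon>] by simp
  qed
  have FTC: "(LINT t|lborel. ?h2 t * indicator {a..b} t) = ?h1 b - ?h1 a" if "a \<le> b" for a b
  proof (rule integral_FTC_Icc_real[OF that])
    show "(?h1 has_real_derivative ?h2 t) (at t)" for t by (rule smooth_real_DERIV[OF h1])
    show "isCont ?h2 t" for t using smooth_real_DERIV[OF h2] DERIV_isCont by blast
  qed
  have ib: "integrable lborel (\<lambda>t. ?h2 t * indicator {a..b} t)" for a b
  proof (rule integrable_bounded_support[where M=2 and B=B])
    show "\<bar>?h2 t * indicator {a..b} t\<bar> \<le> B" for t using B by (auto simp: indicator_def)
  qed (use h2m z in auto)
  have "A = (LINT t|lborel. d1 * (?h2 t * indicator {0..3} t) + d2 * (?h2 t * indicator {-3..0} t))"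
    unfolding A_def
  proof (rule integral_cong_AE)
    have "AE t in lborel. t \<noteq> (0::real)" by (rule AE_lborel_singleton)
    then show "AE t in lborel. ?p t * ?h2 t = d1 * (?h2 t * indicator {0..3} t) + d2 * (?h2 t * indicator {-3..0} t)"
    proof eventually_elim
      case (elim t)
      then show ?case using z(2)[of t]
        by (cases "\<bar>t\<bar> \<le> 3") (auto simp: phase_curvature_def indicator_def)
    qed
  qed (use h2m in measurable)
  also have "\<dots> = d1 * (?h1 3 - ?h1 0) + d2 * (?h1 0 - ?h1 (-3))"
    using ib FTC by simp
  also have "\<dots> = d2 - d1" using z(1)[of 3] z(1)[of "-3"] h10 by simp
  finally show ?thesis using \<open>A = 0\<close> by simp
qed

lemma energy_gap_reflect:
  "t \<noteq> 0 \<Longrightarrow> energy_gap d1 d2 (- t) v l = energy_gap d2 d1 t v l"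
  by (auto simp: energy_gap_def phase_curvature_def phase_profile_def)

text \<open>
  Substitute \<open>h (- t)\<close> for \<open>h t\<close>. The convention for the curvature at \<open>t = 0\<close> is not symmetric, but a
  single point is negligible.
\<close>

lemma nonneg_gap_reflect:
  assumes gap: "\<And>h L. smooth_real h \<Longrightarrow> (\<And>t. \<bar>t\<bar> > L \<Longrightarrow> h t = 0) \<Longrightarrow>
      0 \<le> (LINT t|lborel. energy_gap d1 d2 t (h t) (deriv (deriv h) t))"
    and h: "smooth_real h" "\<And>t. \<bar>t\<bar> > L \<Longrightarrow> h t = 0"
  shows "0 \<le> (LINT t|lborel. energy_gap d2 d1 t (h t) (deriv (deriv h) t))"
proof -
  let ?g = "\<lambda>t. h (- t)"
  have neg: "((\<lambda>t. f (- t)) has_real_derivative - f' (- t)) (at t)"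
    if "\<And>t. (f has_real_derivative f' t) (at t)" for f f' :: "real \<Rightarrow> real" and t
    using DERIV_chain2[OF that, of uminus "-1" t] by (simp add: DERIV_minus[OF DERIV_ident])
  have g: "smooth_real ?g" using smooth_real_affine[OF h(1), of "-1" 0] by simp
  have D1: "deriv ?g = (\<lambda>t. - deriv h (- t))"
    by (rule deriv_eq) (rule neg[OF smooth_real_DERIV[OF h(1)]])
  have D2: "deriv (deriv ?g) = (\<lambda>t. deriv (deriv h) (- t))"
  proof (unfold D1, rule deriv_eq)
    fix t
    show "((\<lambda>t. - deriv h (- t)) has_real_derivative deriv (deriv h) (- t)) (at t)"
      using DERIV_minus[OF neg[OF smooth_real_DERIV[OF smooth_real_deriv[OF h(1)]]], of t] by simp
  qed
  have m: "h \<in> borel_measurable borel" "deriv (deriv h) \<in> borel_measurable borel"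
    by (intro borel_measurable_continuous_onI smooth_real_continuous smooth_real_deriv h)+
  have "0 \<le> (LINT t|lborel. energy_gap d1 d2 t (?g t) (deriv (deriv ?g) t))"
    by (rule gap[OF g, of L]) (simp add: h(2))
  also have "\<dots> = (LINT t|lborel. energy_gap d1 d2 (- t) (h t) (deriv (deriv h) t))"
    unfolding D2 by (subst lborel_integral_real_affine[of "-1" _ 0]) auto
  also have "\<dots> = (LINT t|lborel. energy_gap d2 d1 t (h t) (deriv (deriv h) t))"
  proof (rule integral_cong_AE)
    have "AE t in lborel. t \<noteq> (0::real)" by (rule AE_lborel_singleton)
    then show "AE t in lborel. energy_gap d1 d2 (- t) (h t) (deriv (deriv h) t) = energy_gap d2 d1 t (h t) (deriv (deriv h) t)"
      by eventually_elim (rule energy_gap_reflect)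
  qed (auto intro!: energy_gap_measurable m)
  finally show ?thesis .
qed

section \<open>Moving the free boundary\<close>

lemma DERIV_rescale:
  assumes "\<And>x. (f has_real_derivative f' x) (at x)"
  shows "((\<lambda>x. f (c * x + b)) has_real_derivative c * f' (c * x + b)) (at x)"
proof -
  have "((\<lambda>x. c * x + b) has_real_derivative c) (at x)" by (auto intro!: derivative_eq_intros)
  from DERIV_chain2[OF assms this] show ?thesis by (simp add: mult.commute)
qed

text \<open>
  The parabola \<open>y\<^sup>2 / 2\<close>, switched on smoothly between \<open>0\<close> and \<open>1\<close>. Rescaled to \<open>S (m * x) / m\<^sup>2\<close> it is
  switched on within \<open>[0, 1/m]\<close>, and its second derivative there stays bounded as \<open>m\<close> grows.
\<close>

definition flat_parabola :: "real \<Rightarrow> real" where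
  "flat_parabola y = y\<^sup>2 / 2 * smooth_step y"

lemma flat_parabola_smooth: "smooth_real flat_parabola"
proof -
  have "smooth_real (\<lambda>y. (1 / 2) * (y * y) * smooth_step y)"
    by (intro smooth_real_mult smooth_real_const smooth_real_id smooth_step_smooth)
  then show ?thesis by (simp add: flat_parabola_def[abs_def] power2_eq_square)
qed

lemma flat_parabola_eq: "y \<le> 0 \<Longrightarrow> flat_parabola y = 0" "y \<ge> 1 \<Longrightarrow> flat_parabola y = y\<^sup>2 / 2"
  by (simp_all add: flat_parabola_def smooth_step_0 smooth_step_1)

lemma flat_parabola_deriv2:
  "y < 0 \<Longrightarrow> deriv (deriv flat_parabola) y = 0" "y > 1 \<Longrightarrow> deriv (deriv flat_parabola) y = 1"
proof -
  show "deriv (deriv flat_parabola) y = 0" if "y < 0"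
    by (rule deriv2_locally_const[of "{..<0}" _ _ 0]) (use that in \<open>auto simp: flat_parabola_eq\<close>)
  have d1: "deriv flat_parabola y = y" if "y > 1" for y
  proof -
    have "((\<lambda>y. y\<^sup>2 / 2) has_real_derivative y) (at y)" by (auto intro!: derivative_eq_intros)
    then have "(flat_parabola has_real_derivative y) (at y)"
      by (rule has_field_derivative_transform_within_open[where S="{1<..}"]) (use that in \<open>auto simp: flat_parabola_eq\<close>)
    then show ?thesis by (rule DERIV_imp_deriv)
  qed
  show "deriv (deriv flat_parabola) y = 1" if "y > 1"
  proof -
    have "(deriv flat_parabola has_real_derivative 1) (at y)"
      by (rule has_field_derivative_transform_within_open[OF DERIV_ident, where S="{1<..}"]) (use that in \<open>auto simp: d1\<close>)
    then show ?thesis by (rule DERIV_imp_deriv)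
  qed
qed

lemma flat_parabola_deriv2_bounded:
  obtains B where "B \<ge> 1" "\<And>y. \<bar>deriv (deriv flat_parabola) y\<bar> \<le> B"
proof -
  let ?s = "deriv (deriv flat_parabola)"
  have "bounded (?s ` {0..1})"
    by (intro compact_imp_bounded compact_continuous_image smooth_real_continuous smooth_real_deriv flat_parabola_smooth) simp
  then obtain B where B: "\<And>y. 0 \<le> y \<Longrightarrow> y \<le> 1 \<Longrightarrow> \<bar>?s y\<bar> \<le> B" unfolding bounded_iff by (force simp: Ball_def)
  have "\<bar>?s y\<bar> \<le> max 1 B" for y
  proof -
    consider "y < 0" | "y > 1" | "0 \<le> y" "y \<le> 1" by linarith
    then show ?thesis
    proof cases
      case 3
      then show ?thesis using B[of y] by (simp add: le_max_iff_disj)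
    qed (simp_all add: flat_parabola_deriv2)
  qed
  then show ?thesis using that[of "max 1 B"] by auto
qed

text \<open>
  With \<open>a = \<plusminus>1\<close>: the first term starts a new parabola at \<open>a\<close>, the second cancels the old one beyond
  \<open>1/m\<close>, and the third interpolates, over a length \<open>m\<close>, the difference
  \<open>x\<^sup>2 / 2 - (x - a)\<^sup>2 / 2 = a * x - 1 / 2\<close>, so that the sum has compact support. The arguments are written
  as affine functions of \<open>x\<close> to match the chain rule for rescalings.
\<close>

definition shifted_boundary :: "real \<Rightarrow> real \<Rightarrow> real \<Rightarrow> real" where
  "shifted_boundary a m x = flat_parabola (m * x + (- m * a)) / m\<^sup>2 - flat_parabola (m * x + 0) / m\<^sup>2
     + (a * x - 1 / 2) * smooth_step ((1 / m) * x + (- 1 / m))"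

text \<open>
  First derivative of the interpolating term in the shifted boundary.
\<close>

definition ramp_slope :: "real \<Rightarrow> real \<Rightarrow> real \<Rightarrow> real" where
  "ramp_slope a m x = a * smooth_step ((1 / m) * x + (- 1 / m))
     + (a * x - 1 / 2) * ((1 / m) * deriv smooth_step ((1 / m) * x + (- 1 / m)))"

text \<open>
  Second derivative of the interpolating term in the shifted boundary.
\<close>

definition ramp_curvature :: "real \<Rightarrow> real \<Rightarrow> real \<Rightarrow> real" where
  "ramp_curvature a m x = 2 * a * ((1 / m) * deriv smooth_step ((1 / m) * x + (- 1 / m)))
     + (a * x - 1 / 2) * ((1 / m) * ((1 / m) * deriv (deriv smooth_step) ((1 / m) * x + (- 1 / m))))"

lemma DERIV_ramp:
  "((\<lambda>x. (a * x - 1 / 2) * smooth_step ((1 / m) * x + (- 1 / m))) has_real_derivative ramp_slope a m x) (at x)"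
  "(ramp_slope a m has_real_derivative ramp_curvature a m x) (at x)"
proof -
  let ?u = "\<lambda>x. (1 / m) * x + (- 1 / m)"
  note D0 = DERIV_rescale[OF smooth_real_DERIV[OF smooth_step_smooth], of "1 / m" "- 1 / m"]
  note D1 = DERIV_rescale[OF smooth_real_DERIV[OF smooth_real_deriv[OF smooth_step_smooth]], of "1 / m" "- 1 / m"]
  have L: "((\<lambda>x. a * x - 1 / 2) has_real_derivative a) (at x)" for x by (auto intro!: derivative_eq_intros)
  show "((\<lambda>x. (a * x - 1 / 2) * smooth_step (?u x)) has_real_derivative ramp_slope a m x) (at x)"
    by (rule DERIV_cong[OF DERIV_mult[OF L D0]]) (simp add: ramp_slope_def algebra_simps)
  have "((\<lambda>x. a * smooth_step (?u x) + (a * x - 1 / 2) * ((1 / m) * deriv smooth_step (?u x))) has_real_derivative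
      a * ((1 / m) * deriv smooth_step (?u x)) + (a * ((1 / m) * deriv smooth_step (?u x))
        + (1 / m) * ((1 / m) * deriv (deriv smooth_step) (?u x)) * (a * x - 1 / 2))) (at x)"
    by (intro DERIV_add DERIV_cmult D0 DERIV_mult[OF L DERIV_cmult[OF D1]])
  then show "(ramp_slope a m has_real_derivative ramp_curvature a m x) (at x)"
    unfolding ramp_slope_def[abs_def] ramp_curvature_def by (simp add: algebra_simps)
qed

lemma shifted_boundary_smooth: "smooth_real (shifted_boundary a m)"
proof -
  have "smooth_real (\<lambda>x. flat_parabola (m * x + (- m * a)) * (1 / m\<^sup>2) - flat_parabola (m * x + 0) * (1 / m\<^sup>2)
     + (a * x - 1 / 2) * smooth_step ((1 / m) * x + (- 1 / m)))"
    by (intro smooth_real_add smooth_real_diff smooth_real_mult smooth_real_const smooth_real_id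
        smooth_real_affine flat_parabola_smooth smooth_step_smooth)
  then show ?thesis by (simp add: shifted_boundary_def[abs_def])
qed

lemma shifted_boundary_deriv2:
  assumes "m > 0"
  shows "deriv (deriv (shifted_boundary a m)) = (\<lambda>x. deriv (deriv flat_parabola) (m * (x - a))
      - deriv (deriv flat_parabola) (m * x) + ramp_curvature a m x)"
proof -
  let ?S = flat_parabola let ?S1 = "deriv ?S" let ?S2 = "deriv ?S1"
  note D0 = DERIV_rescale[OF smooth_real_DERIV[OF flat_parabola_smooth]]
  note D1 = DERIV_rescale[OF smooth_real_DERIV[OF smooth_real_deriv[OF flat_parabola_smooth]]]
  have 1: "deriv (shifted_boundary a m) = (\<lambda>x. m * ?S1 (m * x + (- m * a)) / m\<^sup>2 - m * ?S1 (m * x + 0) / m\<^sup>2 + ramp_slope a m x)"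
    by (rule deriv_eq, unfold shifted_boundary_def[abs_def]) (intro DERIV_add DERIV_diff DERIV_cdivide D0 DERIV_ramp(1))
  have 2: "deriv (deriv (shifted_boundary a m)) =
     (\<lambda>x. m * (m * ?S2 (m * x + (- m * a))) / m\<^sup>2 - m * (m * ?S2 (m * x + 0)) / m\<^sup>2 + ramp_curvature a m x)"
    unfolding 1 by (rule deriv_eq) (intro DERIV_add DERIV_diff DERIV_cdivide DERIV_cmult D1 DERIV_ramp(2))
  show ?thesis
    unfolding 2 using assms by (simp add: fun_eq_iff power2_eq_square right_diff_distrib)
qed

lemma ramp_outside:
  assumes "m \<ge> 1"
  shows "x < 1 \<Longrightarrow> ramp_curvature a m x = 0" "x > m + 1 \<Longrightarrow> ramp_curvature a m x = 0"
    "x < 1 \<Longrightarrow> ramp_slope a m x = 0" "x > m + 1 \<Longrightarrow> ramp_slope a m x = a"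
proof -
  have u: "(1 / m) * x + (- 1 / m) = (x - 1) / m" by (simp add: diff_divide_distrib)
  have lo: "(x - 1) / m < 0" if "x < 1" using that assms by (simp add: divide_less_0_iff)
  have hi: "(x - 1) / m > 1" if "x > m + 1" using that assms by (simp add: less_divide_eq)
  have s0: "deriv smooth_step y = 0 \<and> deriv (deriv smooth_step) y = 0" if "y < 0" for y
    using that deriv_locally_const[of "{..<0}" y smooth_step 0] deriv2_locally_const[of "{..<0}" y smooth_step 0]
    by (simp add: smooth_step_0)
  have s1: "deriv smooth_step y = 0 \<and> deriv (deriv smooth_step) y = 0" if "y > 1" for y
    using that deriv_locally_const[of "{1<..}" y smooth_step 1] deriv2_locally_const[of "{1<..}" y smooth_step 1]
    by (simp add: smooth_step_1)
  show "x < 1 \<Longrightarrow> ramp_curvature a m x = 0" "x < 1 \<Longrightarrow> ramp_slope a m x = 0"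
    unfolding ramp_curvature_def ramp_slope_def u using s0[OF lo] smooth_step_0 lo by auto
  show "x > m + 1 \<Longrightarrow> ramp_curvature a m x = 0" "x > m + 1 \<Longrightarrow> ramp_slope a m x = a"
    unfolding ramp_curvature_def ramp_slope_def u using s1[OF hi] smooth_step_1 hi by auto
qed

text \<open>
  The ramp has size of order \<open>m\<close> and slope of order one, spread over a length \<open>m\<close>, so its curvature is of order \<open>1 / m\<close>.
  Its square therefore contributes only order \<open>1 / m\<close> to the energy.
\<close>

lemma ramp_curvature_bound:
  obtains c where "c \<ge> 1" "\<And>a m x. m \<ge> 1 \<Longrightarrow> \<bar>a\<bar> = 1 \<Longrightarrow> \<bar>ramp_curvature a m x\<bar> \<le> c / m"
proof -
  obtain B where B: "B \<ge> 1" "\<And>t. \<bar>deriv smooth_step t\<bar> \<le> B" "\<And>t. \<bar>deriv (deriv smooth_step) t\<bar> \<le> B"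
    using smooth_step_derivs_bounded by blast
  have "\<bar>ramp_curvature a m x\<bar> \<le> (5 * B) / m" if m: "m \<ge> 1" and a: "\<bar>a\<bar> = 1" for a m x :: real
  proof (cases "1 \<le> x \<and> x \<le> m + 1")
    case False
    then show ?thesis using ramp_outside[OF m, of x a] B(1) m by (auto simp: not_le)
  next
    case True
    let ?u = "(1 / m) * x + (- 1 / m)"
    have "\<bar>a * x - 1 / 2\<bar> \<le> 3 * m"
    proof -
      have "a = 1 \<or> a = -1" using a by linarith
      then show ?thesis using True m by auto
    qed
    then have "\<bar>a * x - 1 / 2\<bar> * ((1 / m) * ((1 / m) * \<bar>deriv (deriv smooth_step) ?u\<bar>)) \<le> (3 * m) * ((1 / m) * ((1 / m) * B))"
      using m B by (intro mult_mono) auto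
    moreover have "2 * \<bar>a\<bar> * ((1 / m) * \<bar>deriv smooth_step ?u\<bar>) \<le> 2 * 1 * ((1 / m) * B)"
      using m B a by (intro mult_mono) auto
    moreover have "\<bar>ramp_curvature a m x\<bar> \<le> 2 * \<bar>a\<bar> * ((1 / m) * \<bar>deriv smooth_step ?u\<bar>)
       + \<bar>a * x - 1 / 2\<bar> * ((1 / m) * ((1 / m) * \<bar>deriv (deriv smooth_step) ?u\<bar>))"
      unfolding ramp_curvature_def using m by (intro order_trans[OF abs_triangle_ineq]) (simp add: abs_mult)
    moreover have "2 * 1 * ((1 / m) * B) + (3 * m) * ((1 / m) * ((1 / m) * B)) = 5 * B / m"
      using m by (simp add: field_simps)
    ultimately show ?thesis by linarith
  qed
  then show ?thesis using that[of "5 * B"] B(1) by auto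
qed

lemma shifted_boundary_outside:
  assumes m: "m \<ge> 1" and a: "\<bar>a\<bar> = 1" and x: "\<bar>x\<bar> > m + 1"
  shows "shifted_boundary a m x = 0"
proof -
  have a': "a = 1 \<or> a = -1" using a by linarith
  have u: "(1 / m) * x + (- 1 / m) = (x - 1) / m" by (simp add: diff_divide_distrib)
  have v: "m * x + (- m * a) = m * (x - a)" by (simp add: algebra_simps)
  show ?thesis
  proof (cases "x > 0")
    case True
    then have x2: "x > m + 1" using x by simp
    have "1 \<le> x - a" "1 \<le> x" using x2 m a' by auto
    then have "1 * 1 \<le> m * (x - a)" "1 * 1 \<le> m * x" using m by (intro mult_mono; simp)+
    moreover have "(x - 1) / m \<ge> 1" using x2 m by (simp add: le_divide_eq)
    ultimately have "shifted_boundary a m x = (m * (x - a))\<^sup>2 / 2 / m\<^sup>2 - (m * x)\<^sup>2 / 2 / m\<^sup>2 + (a * x - 1 / 2)"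
      unfolding shifted_boundary_def u v by (simp add: flat_parabola_eq smooth_step_1)
    also have "\<dots> = (x - a)\<^sup>2 / 2 - x\<^sup>2 / 2 + (a * x - 1 / 2)"
      using m by (simp add: power_mult_distrib)
    also have "\<dots> = 0" using a' by (auto simp: power2_eq_square field_simps)
    finally show ?thesis .
  next
    case False
    then have x2: "x < - (m + 1)" using x by simp
    have "x - a \<le> 0" "x \<le> 0" using x2 m a' by auto
    then have "m * (x - a) \<le> 0" "m * x \<le> 0" using m by (auto simp: mult_le_0_iff)
    moreover have "(x - 1) / m \<le> 0" using x2 m by (simp add: divide_le_0_iff)
    ultimately show ?thesis
      unfolding shifted_boundary_def u v by (simp add: flat_parabola_eq smooth_step_0)
  qed
qed

text \<open>
  The slope of the ramp rises from \<open>0\<close> to \<open>a\<close>; through the cross term in the square of the Laplacian, this is the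
  price of moving the boundary.
\<close>

lemma integral_ramp_curvature:
  assumes m: "m \<ge> 1" and a: "\<bar>a\<bar> = 1"
  shows "integrable lborel (ramp_curvature a m)" "(LINT x|lborel. ramp_curvature a m x) = a"
proof -
  obtain c where c: "\<And>x. \<bar>ramp_curvature a m x\<bar> \<le> c / m" using ramp_curvature_bound m a by metis
  have cont: "isCont (ramp_curvature a m) x" for x
    unfolding ramp_curvature_def[abs_def]
    by (intro continuous_intros DERIV_isCont[OF DERIV_rescale[OF smooth_real_DERIV]]
       smooth_real_deriv smooth_step_smooth)
  have rm: "ramp_curvature a m \<in> borel_measurable borel"
    by (rule borel_measurable_continuous_onI) (simp add: continuous_at_imp_continuous_on cont)
  show "integrable lborel (ramp_curvature a m)"
    by (rule integrable_bounded_support[OF rm c, of "m + 1"])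
       (use ramp_outside[OF m] m in \<open>auto simp: abs_if split: if_splits\<close>)
  have "(LINT x|lborel. ramp_curvature a m x) = (LINT x|lborel. ramp_curvature a m x * indicator {0..m + 2} x)"
  proof (intro Bochner_Integration.integral_cong refl)
    fix x show "ramp_curvature a m x = ramp_curvature a m x * indicator {0..m + 2} x"
    proof (cases "0 \<le> x \<and> x \<le> m + 2")
      case False
      then have "ramp_curvature a m x = 0" using ramp_outside(1,2)[OF m, of x a] m by force
      then show ?thesis by simp
    qed simp
  qed
  also have "\<dots> = ramp_slope a m (m + 2) - ramp_slope a m 0"
    by (rule integral_FTC_Icc_real) (use m DERIV_ramp(2) cont in auto)
  also have "\<dots> = a" using ramp_outside(3,4)[OF m] by simp
  finally show "(LINT x|lborel. ramp_curvature a m x) = a" .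
qed

section \<open>The energy of a moved boundary and the classification\<close>

text \<open>
  Off the two smoothing intervals of length \<open>1/m\<close> the second derivative of the competitor is
  \<open>d * (u + r)\<close>, where \<open>u\<close> is the indicator of \<open>x > a\<close> and \<open>r\<close> the curvature of the ramp, and the
  competitor vanishes for \<open>x < a\<close> there. Squaring, and counting the volume, gives the first three summands. On the smoothing intervals both sides are bounded, and
  \<open>K\<close> absorbs their difference.
\<close>

lemma shifted_boundary_energy_gap_le:
  fixes d a m c B :: real
  assumes m: "m \<ge> 1" and a: "a = 1 \<or> a = -1" and d: "d \<noteq> 0"
    and B: "\<And>y. \<bar>deriv (deriv flat_parabola) y\<bar> \<le> B" and c: "\<And>x. \<bar>ramp_curvature a m x\<bar> \<le> c / m"
  defines "\<Lambda> \<equiv> \<bar>d\<bar> * (2 * B + c)"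
  defines "K \<equiv> 2 * \<bar>d\<bar> * \<Lambda> + \<Lambda>\<^sup>2 + 1 + (d\<^sup>2 + 1) + 2 * d\<^sup>2 * c"
  shows "energy_gap d 0 x (d * shifted_boundary a m x) (d * deriv (deriv (shifted_boundary a m)) x)
    \<le> (d\<^sup>2 + 1) * (indicator {a<..m + 2} x - indicator {0<..m + 2} x) + 2 * d\<^sup>2 * ramp_curvature a m x
      + d\<^sup>2 * (c / m)\<^sup>2 * indicator {1..m + 1} x + K * (indicator {0..1 / m} x + indicator {a..a + 1 / m} x)"
    (is "?e \<le> ?U")
proof -
  let ?s2 = "deriv (deriv flat_parabola)"
  let ?r = "ramp_curvature a m x"
  have m0: "m > 0" using m by simp
  have c0: "c \<ge> 0"
  proof -
    have "0 \<le> c / m" using c[of 0] by linarith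
    then show ?thesis using m0 by (simp add: zero_le_divide_iff)
  qed
  have B0: "B \<ge> 0" using B[of 0] by linarith
  have cm: "c / m \<le> c" using m m0 mult_left_mono[OF m c0] by (simp add: divide_le_eq)
  have h2: "deriv (deriv (shifted_boundary a m)) x = ?s2 (m * (x - a)) - ?s2 (m * x) + ?r"
    unfolding shifted_boundary_deriv2[OF m0] ..
  have rc: "\<bar>?r\<bar> \<le> c" using c[of x] cm by linarith
  show ?thesis
  proof (cases "x \<in> {0..1 / m} \<or> x \<in> {a..a + 1 / m}")
    case True
    have "\<bar>d * deriv (deriv (shifted_boundary a m)) x\<bar> \<le> \<Lambda>"
      unfolding \<Lambda>_def abs_mult h2 using B[of "m * (x - a)"] B[of "m * x"] rc
      by (intro mult_left_mono) auto
    from energy_gap_bound[OF this, of d 0 x "d * shifted_boundary a m x"]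
    have e: "?e \<le> 2 * \<bar>d\<bar> * \<Lambda> + \<Lambda>\<^sup>2 + 1" by simp
    have K0: "K \<ge> 0" unfolding K_def \<Lambda>_def using B0 c0 by (intro add_nonneg_nonneg mult_nonneg_nonneg) auto
    have i: "(indicator {0..1 / m} x + indicator {a..a + 1 / m} x :: real) \<ge> 1"
      using True by (auto simp: indicator_def)
    have 1: "K \<le> K * (indicator {0..1 / m} x + indicator {a..a + 1 / m} x)"
      using mult_left_mono[OF i K0] by simp
    have 2: "- (d\<^sup>2 + 1) \<le> (d\<^sup>2 + 1) * (indicator {a<..m + 2} x - indicator {0<..m + 2} x)"
    proof -
      have "(d\<^sup>2 + 1) * (- 1) \<le> (d\<^sup>2 + 1) * (indicator {a<..m + 2} x - indicator {0<..m + 2} x)"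
        by (intro mult_left_mono) (auto simp: indicator_def)
      then show ?thesis by simp
    qed
    have 3: "- (2 * d\<^sup>2 * c) \<le> 2 * d\<^sup>2 * ?r"
    proof -
      have "2 * d\<^sup>2 * (- c) \<le> 2 * d\<^sup>2 * ?r" using rc by (intro mult_left_mono) auto
      then show ?thesis by (simp only: mult_minus_right)
    qed
    have 4: "0 \<le> d\<^sup>2 * (c / m)\<^sup>2 * indicator {1..m + 1} x" by simp
    have K_eq: "(2 * \<bar>d\<bar> * \<Lambda> + \<Lambda>\<^sup>2 + 1) + (d\<^sup>2 + 1) + 2 * d\<^sup>2 * c = K" by (simp only: K_def)
    have 1: "(2 * \<bar>d\<bar> * \<Lambda> + \<Lambda>\<^sup>2 + 1) + (d\<^sup>2 + 1) + 2 * d\<^sup>2 * c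
        \<le> K * (indicator {0..1 / m} x + indicator {a..a + 1 / m} x)"
      unfolding K_eq by (rule 1)
    have arith: "e' \<le> y1 + y2 + y3 + y4"
      if "e' \<le> k" "k + p1 + p2 \<le> y4" "- p1 \<le> y1" "- p2 \<le> y2" "0 \<le> y3"
      for e' k p1 p2 y1 y2 y3 y4 :: real
      using that by linarith
    show ?thesis by (rule arith[OF e 1 2 3 4])
  next
    case False
    define u v :: real where "u = of_bool (x > a)" and "v = of_bool (x > 0)"
    have x0: "x < 0 \<or> x > 1 / m" and xa: "x < a \<or> x > a + 1 / m" using False by auto
    have im: "1 / m > 0" using m0 by simp
    have s1: "?s2 (m * x) = v"
      using x0
    proof
      assume "x < 0"
      then show ?thesis using m0 flat_parabola_deriv2(1)[of "m * x"] by (simp add: v_def mult_pos_neg)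
    next
      assume *: "x > 1 / m"
      then have "m * x > 1" using m0 by (simp add: divide_less_eq mult.commute)
      moreover have "x > 0" using * im by linarith
      ultimately show ?thesis using flat_parabola_deriv2(2)[of "m * x"] by (simp add: v_def)
    qed
    have s2: "?s2 (m * (x - a)) = u"
      using xa
    proof
      assume "x < a"
      then show ?thesis using m0 flat_parabola_deriv2(1)[of "m * (x - a)"] by (simp add: u_def mult_pos_neg)
    next
      assume *: "x > a + 1 / m"
      then have "1 / m < x - a" by simp
      then have "m * (x - a) > 1" using m0 by (simp add: divide_less_eq mult.commute)
      moreover have "x > a" using * im by linarith
      ultimately show ?thesis using flat_parabola_deriv2(2)[of "m * (x - a)"] by (simp add: u_def)
    qed
    have p: "phase_curvature d 0 x = d * v"
      using x0 im by (auto simp: phase_curvature_def v_def)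
    \<comment> \<open>The ramp only starts at \<open>1\<close>, which is not to the left of the new boundary.\<close>
    have ur: "u * ?r = ?r"
    proof (cases "x < 1")
      case True then show ?thesis using ramp_outside(1)[OF m] by simp
    next
      case False then show ?thesis using a xa im by (auto simp: u_def)
    qed
    have uu: "u * u = u" "v * v = v" by (auto simp: u_def v_def)
    have r2: "?r\<^sup>2 \<le> (c / m)\<^sup>2 * indicator {1..m + 1} x"
    proof (cases "1 \<le> x \<and> x \<le> m + 1")
      case True
      have "?r\<^sup>2 \<le> (c / m)\<^sup>2" using power_mono[OF c[of x] abs_ge_zero, of 2] by simp
      then show ?thesis using True by simp
    next
      case False
      then have "?r = 0" using ramp_outside(1,2)[OF m, of x a] by force
      then show ?thesis by simp
    qed
    have "d * v + d * (u - v + ?r) = d * (u + ?r)" by (simp add: algebra_simps)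
    then have "(d * v + d * (u - v + ?r))\<^sup>2 - (d * v)\<^sup>2 = d\<^sup>2 * ((u + ?r)\<^sup>2 - v\<^sup>2)"
      by (simp add: power_mult_distrib right_diff_distrib)
    also have "(u + ?r)\<^sup>2 - v\<^sup>2 = (u * u) + 2 * (u * ?r) + ?r\<^sup>2 - v * v"
      by (simp add: power2_sum power2_eq_square[of u] power2_eq_square[of v])
    finally have sq: "(d * v + d * (u - v + ?r))\<^sup>2 - (d * v)\<^sup>2 = d\<^sup>2 * (u - v) + 2 * d\<^sup>2 * ?r + d\<^sup>2 * ?r\<^sup>2"
      unfolding ur uu by (simp add: algebra_simps)
    have w0: "of_bool (phase_profile d 0 x \<noteq> 0) = v"
      using d x0 im by (auto simp: phase_profile_def v_def)
    have w1: "of_bool (phase_profile d 0 x + d * shifted_boundary a m x \<noteq> 0) \<le> u"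
    proof (cases "x < a")
      case True
      have x1: "x < 1" using True a by auto
      have e0: "flat_parabola (m * x + (- m * a)) = 0"
        using True m0 mult_pos_neg[of m "x - a"] by (intro flat_parabola_eq) (simp add: right_diff_distrib)
      have "(1 / m) * x + (- 1 / m) = (x - 1) / m" by (simp add: diff_divide_distrib)
      then have e1: "smooth_step ((1 / m) * x + (- 1 / m)) = 0"
        using x1 m0 by (simp add: smooth_step_0 divide_le_0_iff)
      have "phase_profile d 0 x + d * shifted_boundary a m x = 0"
        using x0
      proof
        assume *: "x < 0"
        then have "flat_parabola (m * x + 0) = 0" using m0 by (intro flat_parabola_eq) (simp add: mult_le_0_iff)
        then show ?thesis unfolding shifted_boundary_def e0 e1 using * by (simp add: phase_profile_def)
      next
        assume *: "x > 1 / m"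
        then have "m * x > 1" using m0 by (simp add: divide_less_eq mult.commute)
        then have e2: "flat_parabola (m * x + 0) / m\<^sup>2 = x\<^sup>2 / 2"
          using m0 by (simp add: flat_parabola_eq power_mult_distrib)
        have "x > 0" using * im by linarith
        then show ?thesis unfolding shifted_boundary_def e0 e1 e2 by (simp add: phase_profile_def)
      qed
      then show ?thesis by (simp add: u_def)
    next
      case False
      then have "x > a" using xa im by linarith
      then show ?thesis by (simp add: u_def)
    qed
    have uv: "indicator {a<..m + 2} x - indicator {0<..m + 2} x = u - v"
      using a m by (auto simp: indicator_def u_def v_def)
    have "?e \<le> d\<^sup>2 * (u - v) + 2 * d\<^sup>2 * ?r + d\<^sup>2 * ?r\<^sup>2 + u - v"
      unfolding energy_gap_def p h2 s1 s2 sq w0 using w1 by simp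
    also have "\<dots> \<le> d\<^sup>2 * (u - v) + 2 * d\<^sup>2 * ?r + d\<^sup>2 * ((c / m)\<^sup>2 * indicator {1..m + 1} x) + u - v"
      using mult_left_mono[OF r2, of "d\<^sup>2"] by simp
    also have "\<dots> = (d\<^sup>2 + 1) * (u - v) + 2 * d\<^sup>2 * ?r + d\<^sup>2 * (c / m)\<^sup>2 * indicator {1..m + 1} x"
      by (simp add: algebra_simps)
    also have "\<dots> = ?U" unfolding uv using False by simp
    finally show ?thesis .
  qed
qed

text \<open>
  Integrating the pointwise bound gives \<open>- a * (d\<^sup>2 + 1) + 2 * a * d\<^sup>2 = a * (d\<^sup>2 - 1)\<close> up to order
  \<open>1 / m\<close>, for both signs of \<open>a\<close>.
\<close>

lemma one_phase_curvature:
  assumes gap: "\<And>h L. smooth_real h \<Longrightarrow> (\<And>t. \<bar>t\<bar> > L \<Longrightarrow> h t = 0) \<Longrightarrow>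
      0 \<le> (LINT t|lborel. energy_gap d 0 t (h t) (deriv (deriv h) t))"
    and d: "d \<noteq> 0"
  shows "d = 1 \<or> d = -1"
proof -
  obtain B where B: "B \<ge> 1" "\<And>y. \<bar>deriv (deriv flat_parabola) y\<bar> \<le> B"
    using flat_parabola_deriv2_bounded by blast
  obtain c where c: "c \<ge> 1" "\<And>a m x. m \<ge> 1 \<Longrightarrow> \<bar>a\<bar> = 1 \<Longrightarrow> \<bar>ramp_curvature a m x\<bar> \<le> c / m"
    using ramp_curvature_bound by blast
  define \<Lambda> where "\<Lambda> = \<bar>d\<bar> * (2 * B + c)"
  define K where "K = 2 * \<bar>d\<bar> * \<Lambda> + \<Lambda>\<^sup>2 + 1 + (d\<^sup>2 + 1) + 2 * d\<^sup>2 * c"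
  define C where "C = d\<^sup>2 * c\<^sup>2 + 2 * K"
  have bound: "0 \<le> a * (d\<^sup>2 - 1) + C * inverse m" if m: "m \<ge> 1" and a: "a = 1 \<or> a = -1" for a m :: real
  proof -
    have aa: "\<bar>a\<bar> = 1" using a by auto
    let ?g = "shifted_boundary a m"
    let ?e = "\<lambda>x. energy_gap d 0 x (d * ?g x) (d * deriv (deriv ?g) x)"
    let ?U = "\<lambda>x. (d\<^sup>2 + 1) * (indicator {a<..m + 2} x - indicator {0<..m + 2} x) + 2 * d\<^sup>2 * ramp_curvature a m x
      + d\<^sup>2 * (c / m)\<^sup>2 * indicator {1..m + 1} x + K * (indicator {0..1 / m} x + indicator {a..a + 1 / m} x)"
    have le: "?e x \<le> ?U x" for x
      unfolding K_def \<Lambda>_def by (rule shifted_boundary_energy_gap_le[OF m a d B(2) c(2)[OF m aa]])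
    note g = shifted_boundary_smooth[of a m]
    have h: "smooth_real (\<lambda>x. d * ?g x)" by (intro smooth_real_mult smooth_real_const g)
    have D1: "deriv (\<lambda>x. d * ?g x) = (\<lambda>x. d * deriv ?g x)"
      by (rule deriv_eq) (rule DERIV_cmult[OF smooth_real_DERIV[OF g]])
    have D2: "deriv (deriv (\<lambda>x. d * ?g x)) = (\<lambda>x. d * deriv (deriv ?g) x)"
      unfolding D1 by (rule deriv_eq) (rule DERIV_cmult[OF smooth_real_DERIV[OF smooth_real_deriv[OF g]]])
    have h0: "d * ?g x = 0" if "\<bar>x\<bar> > m + 1" for x
      using shifted_boundary_outside[OF m aa that] by simp
    have h20: "d * deriv (deriv ?g) x = 0" if "\<bar>x\<bar> > m + 1" for x
    proof -
      have "deriv (deriv ?g) x = 0"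
        by (rule deriv2_locally_const[of "{t. m + 1 < \<bar>t\<bar>}" _ _ 0])
           (use that shifted_boundary_outside[OF m aa] in \<open>auto intro!: open_Collect_less continuous_intros\<close>)
      then show ?thesis by simp
    qed
    have gm: "?g \<in> borel_measurable borel" "deriv (deriv ?g) \<in> borel_measurable borel"
      by (intro borel_measurable_continuous_onI smooth_real_continuous smooth_real_deriv g)+
    have em: "?e \<in> borel_measurable borel"
      by (intro energy_gap_measurable borel_measurable_times gm) auto
    have "continuous_on UNIV (\<lambda>x. d * deriv (deriv ?g) x)"
      by (intro smooth_real_continuous smooth_real_mult smooth_real_const smooth_real_deriv g)
    from bounded_of_compact_support[OF this h20]
    obtain B2 where B2: "\<And>x. \<bar>d * deriv (deriv ?g) x\<bar> \<le> B2" by blast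
    have ei: "integrable lborel ?e"
    proof (rule integrable_bounded_support[OF em])
      show "\<bar>?e x\<bar> \<le> 2 * (\<bar>d\<bar> + \<bar>0\<bar>) * B2 + B2\<^sup>2 + 1" for x by (rule energy_gap_bound[OF B2])
      show "?e x = 0" if "norm x > m + 1" for x
        using h0[of x] h20[of x] that by (simp only: real_norm_def energy_gap_0)
    qed
    have am: "a \<le> m + 2" "1 / m \<ge> 0" using a m by auto
    note ri = integral_ramp_curvature[OF m aa]
    have ind: "integrable lborel (indicator {s..t} :: real \<Rightarrow> real)" "integrable lborel (indicator {s<..t} :: real \<Rightarrow> real)" for s t :: real
      by (cases "s \<le> t"; auto intro!: integrable_real_indicator)+
    have Ui: "integrable lborel ?U"
      by (intro Bochner_Integration.integrable_add Bochner_Integration.integrable_diff integrable_mult_right ri(1) ind)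
    have "0 \<le> (LINT x|lborel. ?e x)" using gap[OF h h0] unfolding D2 .
    also have "\<dots> \<le> (LINT x|lborel. ?U x)" by (rule integral_mono[OF ei Ui le])
    also have "\<dots> = (d\<^sup>2 + 1) * ((m + 2 - a) - (m + 2)) + 2 * d\<^sup>2 * a + d\<^sup>2 * (c / m)\<^sup>2 * m + K * (1 / m + 1 / m)"
      using ri ind am m by simp
    also have "\<dots> = a * (d\<^sup>2 - 1) + C * inverse m"
      using m by (simp add: C_def field_simps power2_eq_square)
    finally show ?thesis .
  qed
  have lim: "0 \<le> a * (d\<^sup>2 - 1)" if a: "a = 1 \<or> a = -1" for a :: real
  proof -
    have "(\<lambda>n. a * (d\<^sup>2 - 1) + C * inverse (real (Suc n))) \<longlonglongrightarrow> a * (d\<^sup>2 - 1) + C * 0"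
      by (intro tendsto_intros LIMSEQ_inverse_real_of_nat)
    moreover have "0 \<le> a * (d\<^sup>2 - 1) + C * inverse (real (Suc n))" for n
      by (rule bound[OF _ a]) simp
    ultimately have "0 \<le> a * (d\<^sup>2 - 1) + C * 0" using LIMSEQ_le_const by blast
    then show ?thesis by simp
  qed
  have "d\<^sup>2 = 1" using lim[of 1] lim[of "-1"] by simp
  then show ?thesis by (simp add: power2_eq_1_iff)
qed

theorem theorem3:
  fixes k :: "'n::finite" and d1 d2 :: real
  assumes "global_minimizer (two_phase k d1 d2)"
    and "\<exists>x. two_phase k d1 d2 x \<noteq> 0"
  shows "((d1 = 1 \<or> d1 = -1) \<and> d2 = 0 \<or> d1 = 0 \<and> (d2 = 1 \<or> d2 = -1))
           \<and> type_I_minimizer (two_phase k d1 d2)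
       \<or> (d1 \<noteq> 0 \<and> d2 \<noteq> 0 \<and> d1 = d2) \<and> type_II_minimizer (two_phase k d1 d2)"
proof -
  have gap: "0 \<le> (LINT t|lborel. energy_gap d1 d2 t (h t) (deriv (deriv h) t))"
    if "smooth_real h" "\<And>t. \<bar>t\<bar> > L \<Longrightarrow> h t = 0" for h L
    by (rule one_dim_energy_gap_nonneg[OF assms(1) that])
  consider "d1 \<noteq> 0" "d2 \<noteq> 0" | "d1 \<noteq> 0" "d2 = 0" | "d1 = 0" "d2 \<noteq> 0"
    using assms(2) by (cases "d1 = 0"; cases "d2 = 0") (auto simp: two_phase_def)
  then show ?thesis
  proof cases
    case 1
    have eq: "d1 = d2" by (rule phase_equal_of_nonneg_gap[OF gap 1])
    have "AE x in lebesgue_on UNIV. weak_laplacian UNIV (two_phase k d1 d2) x = d1"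
      using weak_laplacian_eq[OF open_UNIV two_phase_has_weak_deriv[OF open_UNIV], of k d1 d2] eq
      by (simp add: phase_curvature_def)
    then have "AE x in lebesgue. weak_laplacian UNIV (two_phase k d1 d2) x = d1"
      by (simp add: AE_lebesgue_on_iff)
    then show ?thesis using 1 eq assms(1) unfolding type_II_minimizer_def by blast
  next
    case 2
    have d: "d1 = 1 \<or> d1 = -1" by (rule one_phase_curvature[OF gap[unfolded 2(2)] 2(1)])
    have "two_phase k d1 d2 = (\<lambda>x. d1 * (1/2) * ((x - 0) \<bullet> axis k 1)\<^sup>2 * indicator {0<..} ((x - 0) \<bullet> axis k 1))"
      using 2 by (auto simp: two_phase_def inner_axis indicator_def fun_eq_iff)
    moreover have "norm (axis k 1 :: real^'n) = 1" by simp
    ultimately have "type_I_minimizer (two_phase k d1 d2)"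
      using assms(1) d unfolding type_I_minimizer_def by blast
    then show ?thesis using 2 d by blast
  next
    case 3
    have "0 \<le> (LINT t|lborel. energy_gap d2 0 t (h t) (deriv (deriv h) t))"
      if "smooth_real h" "\<And>t. \<bar>t\<bar> > L \<Longrightarrow> h t = 0" for h L
      by (rule nonneg_gap_reflect[OF gap[unfolded 3(1)] that])
    then have d: "d2 = 1 \<or> d2 = -1" by (rule one_phase_curvature[OF _ 3(2)])
    have "two_phase k d1 d2 = (\<lambda>x. d2 * (1/2) * ((x - 0) \<bullet> (- axis k 1))\<^sup>2 * indicator {0<..} ((x - 0) \<bullet> (- axis k 1)))"
      using 3 by (auto simp: two_phase_def inner_axis indicator_def fun_eq_iff)
    moreover have "norm (- axis k 1 :: real^'n) = 1" by simp
    ultimately have "type_I_minimizer (two_phase k d1 d2)"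
      using assms(1) d unfolding type_I_minimizer_def by blast
    then show ?thesis using 3 d by blast
  qed
qed

end
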